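(* Let $B$ be a nonzero skew-symmetric $N\times N$ matrix over $\mathbb{C}$ and $G_B=\ker B\cap\mathbb{Z}^N$. Then, with respect to the $\mathbb{Z}^N$-gradings of $\widetilde{\mathcal Z}$ and $\widetilde{H_B}$: (1) $\dim\widetilde{\mathcal Z}_{\mathbf r}=0$ if $\mathbf 0\ne\mathbf r\in G_B$; (2) $\dim\widetilde{\mathcal Z}_{\mathbf r}=1$ if $\mathbf r\in\mathbb{Z}^N\setminus G_B$; (3) $\dim\widetilde{\mathcal Z}_{\mathbf 0}=N$; (4) $\dim(\widetilde{H_B})_{\mathbf r}=0$ if $\mathbf 0\neq\mathbf r\in G_B$; (5) $\dim(\widetilde{H_B})_{\mathbf r}=1$ if $\mathbf r\in\mathbb{Z}^N\setminus G_B$; (6) $\dim(\widetilde{H_B})_{\mathbf 0}=N$; (7) $\tau_B$ is an extended affine Lie algebra; (8) the core of $\tau_B$ is $\mathfrak g\otimes\mathcal A\oplus\widetilde{\mathcal Z}$.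
   Context: All is over $\mathbb{C}$; $(\mathbf u|\mathbf v)=\sum u_iv_i$ on $\mathbb{C}^N$. $\mathcal A=\mathbb{C}[t_1^{\pm1},\dots,t_N^{\pm1}]$. $\mathfrak g$ is a finite dimensional simple Lie algebra with Cartan subalgebra $\mathfrak h$ and nondegenerate invariant symmetric form $\langle\cdot,\cdot\rangle$; $X(\mathbf r)=X\otimes t^{\mathbf r}$. $\mathcal Z=\Omega_{\mathcal A}/d_{\mathcal A}$, where $\Omega_{\mathcal A}$ has basis $t^{\mathbf r}K_i$ ($\mathbf r\in\mathbb{Z}^N$, $1\le i\le N$; degree $\mathbf r$) and $d_{\mathcal A}=\mathrm{span}\{\sum_i r_it^{\mathbf r}K_i\}$; $K(\mathbf u,\mathbf r)$ is the class of $\sum_iu_it^{\mathbf r}K_i$. $D(\mathbf u,\mathbf r)=\sum_iu_it^{\mathbf r}d_i\in\mathrm{Der}\,\mathcal A$ (degree $\mathbf r$), $d_i=t_i\frac{d}{dt_i}$. The full toroidal Lie algebra is $\mathfrak g\otimes\mathcal A\oplus\mathcal Z\oplus\mathrm{Der}\,\mathcal A$ with $[X(\mathbf r),Y(\mathbf s)]=[X,Y](\mathbf r+\mathbf s)+\langle X,Y\rangle K(\mathbf r,\mathbf r+\mathbf s)$; $[\mathcal Z,\mathfrak g\otimes\mathcal A]=[\mathcal Z,\mathcal Z]=0$; $[D(\mathbf u,\mathbf r),X(\mathbf s)]=(\mathbf u|\mathbf s)X(\mathbf r+\mathbf s)$; $[D(\mathbf u,\mathbf r),K(\mathbf v,\mathbf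 s)]=(\mathbf u|\mathbf s)K(\mathbf v,\mathbf r+\mathbf s)+(\mathbf u|\mathbf v)K(\mathbf r,\mathbf r+\mathbf s)$; $[D(\mathbf u,\mathbf r),D(\mathbf v,\mathbf s)]=D((\mathbf u|\mathbf s)\mathbf v-(\mathbf v|\mathbf r)\mathbf u,\mathbf r+\mathbf s)-(\mathbf u|\mathbf s)(\mathbf v|\mathbf r)K(\mathbf r,\mathbf r+\mathbf s)$. $\widetilde{H_B}=\mathrm{span}\{D(B\mathbf r,\mathbf r):\mathbf r\in\mathbb{Z}^N\setminus\{\mathbf 0\}\}\oplus\mathcal D$, $\mathcal D=\mathrm{span}\{d_1,\dots,d_N\}$. $\mathcal K_B=\mathrm{span}\{K(\mathbf u,\mathbf r):(B\mathbf u|\mathbf r)=0,\ \mathbf u\in\mathbb{C}^N,\ \mathbf r\in\mathbb{Z}^N\setminus\{\mathbf 0\}\}$ is an ideal of $\mathfrak g\otimes\mathcal A\oplus\mathcal Z\oplus\widetilde{H_B}$; $\widetilde{\mathcal Z}=\mathcal Z/\mathcal K_B$, and $\tau_B=\mathfrak g\otimes\mathcal A\oplus\widetilde{\mathcal Z}\oplus\widetilde{H_B}$ is the quotient. An extended affine Lie algebra (EALA) is a Lie algebra $L$ such that: (EA1) $L$ has a nondegenerate invariant symmetric bilinear form $(\cdot,\cdot)$; (EA2) $L$ has a nontrivial finite dimensional self-centralizing ad-diagonalizable abelian subalgebra $H$. Write $L=\bigoplus_{\alpha\in H^*}L_\alpha$, $R=\{\alpha\in H^*:L_\alpha\ne0\}$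 (so $0\in R$); the form restricted to $H$ is nondegenerate and induces one on $H^*$; $R^\times=\{\alpha\in R:(\alpha,\alpha)\ne0\}$, $R^0=\{\alpha\in R:(\alpha,\alpha)=0\}$. (EA3) for $\alpha\in R^\times$ and $x\in L_\alpha$, $\mathrm{ad}\,x$ is locally nilpotent on $L$; (EA4) $R$ is a discrete subset of $H^*$; (EA5) (i) if $R^\times=R_1\cup R_2$ with $(R_1,R_2)=0$ then $R_1=\emptyset$ or $R_2=\emptyset$; (ii) for every $\sigma\in R^0$ there is $\alpha\in R^\times$ with $\sigma+\alpha\in R$. The core of $L$ is the subalgebra generated by $\bigcup_{\alpha\in R^\times}L_\alpha$. For $\tau_B$, the subalgebra in (EA2) is $H=\widetilde{\mathfrak h}=\mathfrak h\oplus\mathrm{span}\{K_1,\dots,K_N\}\oplus\mathcal D$. *)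

theory Defs
  imports
    "HOL-Analysis.Analysis"
    "HOL-Algebra.QuotRing"
    "HOL-Algebra.Module"
    "HOL-Library.Poly_Mapping"
begin

section \<open>Complex Lie algebras\<close>

text \<open>
  A complex Lie algebra is a record of type \<open>module\<close> whose field \<open>mult\<close>, written
  \<open>x \<otimes>\<^bsub>L\<^esub> y\<close>, holds the bracket \<open>[x, y]\<close>; the field \<open>one\<close> is not used.
\<close>

definition complex_ring :: "complex ring" where
  "complex_ring = \<lparr>carrier = UNIV, mult = (*), one = 1, zero = 0, add = (+)\<rparr>"

locale lie_algebra = Module.module complex_ring L for L :: "(complex, 'a) module" (structure) +
  assumes bracket_closed:
      "\<lbrakk>x \<in> carrier L; y \<in> carrier L\<rbrakk> \<Longrightarrow> x \<otimes>\<^bsub>L\<^esub> y \<in> carrier L"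
    and bracket_add_left:
      "\<lbrakk>x \<in> carrier L; y \<in> carrier L; z \<in> carrier L\<rbrakk>
        \<Longrightarrow> (x \<oplus>\<^bsub>L\<^esub> y) \<otimes>\<^bsub>L\<^esub> z = (x \<otimes>\<^bsub>L\<^esub> z) \<oplus>\<^bsub>L\<^esub> (y \<otimes>\<^bsub>L\<^esub> z)"
    and bracket_add_right:
      "\<lbrakk>x \<in> carrier L; y \<in> carrier L; z \<in> carrier L\<rbrakk>
        \<Longrightarrow> x \<otimes>\<^bsub>L\<^esub> (y \<oplus>\<^bsub>L\<^esub> z) = (x \<otimes>\<^bsub>L\<^esub> y) \<oplus>\<^bsub>L\<^esub> (x \<otimes>\<^bsub>L\<^esub> z)"
    and bracket_smult_left:
      "\<lbrakk>x \<in> carrier L; y \<in> carrier L\<rbrakk>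
        \<Longrightarrow> (c \<odot>\<^bsub>L\<^esub> x) \<otimes>\<^bsub>L\<^esub> y = c \<odot>\<^bsub>L\<^esub> (x \<otimes>\<^bsub>L\<^esub> y)"
    and bracket_smult_right:
      "\<lbrakk>x \<in> carrier L; y \<in> carrier L\<rbrakk>
        \<Longrightarrow> x \<otimes>\<^bsub>L\<^esub> (c \<odot>\<^bsub>L\<^esub> y) = c \<odot>\<^bsub>L\<^esub> (x \<otimes>\<^bsub>L\<^esub> y)"
    and bracket_self: "x \<in> carrier L \<Longrightarrow> x \<otimes>\<^bsub>L\<^esub> x = \<zero>\<^bsub>L\<^esub>"
    and jacobi:
      "\<lbrakk>x \<in> carrier L; y \<in> carrier L; z \<in> carrier L\<rbrakk>
        \<Longrightarrow> x \<otimes>\<^bsub>L\<^esub> (y \<otimes>\<^bsub>L\<^esub> z) \<oplus>\<^bsub>L\<^esub> y \<otimes>\<^bsub>L\<^esub> (z \<otimes>\<^bsub>L\<^esub> x) \<oplus>\<^bsub>L\<^esub> z \<otimes>\<^bsub>L\<^esub> (x \<otimes>\<^bsub>L\<^esub> y)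
             = \<zero>\<^bsub>L\<^esub>"

definition type_lie ::
    "(complex \<Rightarrow> 'a \<Rightarrow> 'a) \<Rightarrow> ('a \<Rightarrow> 'a \<Rightarrow> 'a) \<Rightarrow> (complex, 'a::ab_group_add) module" where
  "type_lie sc br =
     \<lparr>carrier = UNIV, mult = br, one = 0, zero = 0, add = (+), smult = sc\<rparr>"

definition lin_span :: "(complex, 'a) module \<Rightarrow> 'a set \<Rightarrow> 'a set" where
  "lin_span L S = \<Inter>{V. submodule V complex_ring L \<and> S \<subseteq> V}"

text \<open>Having dimension \<open>n\<close> includes being finite dimensional, so dimension \<open>0\<close> means \<open>{0}\<close>.\<close>

definition has_dim :: "(complex, 'a) module \<Rightarrow> 'a set \<Rightarrow> nat \<Rightarrow> bool" where
  "has_dim L V n \<longleftrightarrow>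
     (\<exists>S. finite S \<and> card S = n \<and> S \<subseteq> carrier L \<and> lin_span L S = V
        \<and> (\<forall>x\<in>S. x \<notin> lin_span L (S - {x})))"

definition finite_dimensional :: "(complex, 'a) module \<Rightarrow> 'a set \<Rightarrow> bool" where
  "finite_dimensional L V \<longleftrightarrow> (\<exists>n. has_dim L V n)"

definition lie_subalgebra :: "(complex, 'a) module \<Rightarrow> 'a set \<Rightarrow> bool" where
  "lie_subalgebra L V \<longleftrightarrow>
     submodule V complex_ring L \<and> (\<forall>x\<in>V. \<forall>y\<in>V. x \<otimes>\<^bsub>L\<^esub> y \<in> V)"

definition lie_ideal :: "(complex, 'a) module \<Rightarrow> 'a set \<Rightarrow> bool" where
  "lie_ideal L I \<longleftrightarrow>
     submodule I complex_ring L \<and> (\<forall>x\<in>carrier L. \<forall>y\<in>I. x \<otimes>\<^bsub>L\<^esub> y \<in> I)"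

definition generated_subalgebra :: "(complex, 'a) module \<Rightarrow> 'a set \<Rightarrow> 'a set" where
  "generated_subalgebra L S = \<Inter>{V. lie_subalgebra L V \<and> S \<subseteq> V}"

definition simple_lie_algebra :: "(complex, 'a) module \<Rightarrow> bool" where
  "simple_lie_algebra L \<longleftrightarrow>
     lie_algebra L \<and> (\<exists>x\<in>carrier L. \<exists>y\<in>carrier L. x \<otimes>\<^bsub>L\<^esub> y \<noteq> \<zero>\<^bsub>L\<^esub>)
     \<and> (\<forall>I. lie_ideal L I \<longrightarrow> I = {\<zero>\<^bsub>L\<^esub>} \<or> I = carrier L)"

definition lie_quot ::
    "(complex, 'a) module \<Rightarrow> 'a set \<Rightarrow> (complex, 'a set) module" where
  "lie_quot L I = ring.extend (L Quot I)
     (module.fields (\<lambda>c A. \<Union>a\<in>A. I +>\<^bsub>L\<^esub> (c \<odot>\<^bsub>L\<^esub> a)))"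

definition invariant_symmetric_form ::
    "(complex, 'a) module \<Rightarrow> ('a \<Rightarrow> 'a \<Rightarrow> complex) \<Rightarrow> bool" where
  "invariant_symmetric_form L f \<longleftrightarrow>
     (\<forall>x\<in>carrier L. \<forall>y\<in>carrier L. \<forall>z\<in>carrier L. f (x \<oplus>\<^bsub>L\<^esub> y) z = f x z + f y z)
     \<and> (\<forall>c. \<forall>x\<in>carrier L. \<forall>y\<in>carrier L. f (c \<odot>\<^bsub>L\<^esub> x) y = c * f x y)
     \<and> (\<forall>x\<in>carrier L. \<forall>y\<in>carrier L. f x y = f y x)
     \<and> (\<forall>x\<in>carrier L. \<forall>y\<in>carrier L. \<forall>z\<in>carrier L.
          f (x \<otimes>\<^bsub>L\<^esub> y) z = f x (y \<otimes>\<^bsub>L\<^esub> z))"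

definition nondegenerate_on ::
    "(complex, 'a) module \<Rightarrow> 'a set \<Rightarrow> ('a \<Rightarrow> 'a \<Rightarrow> complex) \<Rightarrow> bool" where
  "nondegenerate_on L V f \<longleftrightarrow> (\<forall>x\<in>V. (\<forall>y\<in>V. f x y = 0) \<longrightarrow> x = \<zero>\<^bsub>L\<^esub>)"


section \<open>Root spaces and extended affine Lie algebras\<close>

text \<open>
  Elements of \<open>H\<^sup>*\<close> are functions on the whole type that are linear on \<open>H\<close> and, to make them
  unique, vanish off \<open>H\<close>. Addition in \<open>H\<^sup>*\<close> is pointwise.
\<close>

definition dual :: "(complex, 'a) module \<Rightarrow> 'a set \<Rightarrow> ('a \<Rightarrow> complex) set" where
  "dual L H = {\<alpha>. (\<forall>x\<in>H. \<forall>y\<in>H. \<alpha> (x \<oplus>\<^bsub>L\<^esub> y) = \<alpha> x + \<alpha> y)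
                 \<and> (\<forall>c. \<forall>x\<in>H. \<alpha> (c \<odot>\<^bsub>L\<^esub> x) = c * \<alpha> x)
                 \<and> (\<forall>x. x \<notin> H \<longrightarrow> \<alpha> x = 0)}"

definition root_space ::
    "(complex, 'a) module \<Rightarrow> 'a set \<Rightarrow> ('a \<Rightarrow> complex) \<Rightarrow> 'a set" where
  "root_space L H \<alpha> = {x \<in> carrier L. \<forall>t\<in>H. t \<otimes>\<^bsub>L\<^esub> x = \<alpha> t \<odot>\<^bsub>L\<^esub> x}"

definition roots :: "(complex, 'a) module \<Rightarrow> 'a set \<Rightarrow> ('a \<Rightarrow> complex) set" where
  "roots L H = {\<alpha> \<in> dual L H. root_space L H \<alpha> \<noteq> {\<zero>\<^bsub>L\<^esub>}}"

text \<open>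
  \<open>L\<close> is the sum of the spaces \<open>L\<^sub>\<alpha>\<close> with \<open>\<alpha> \<in> H\<^sup>*\<close>; such a sum is automatically direct.
\<close>

definition ad_diagonalizable :: "(complex, 'a) module \<Rightarrow> 'a set \<Rightarrow> bool" where
  "ad_diagonalizable L H \<longleftrightarrow> lin_span L (\<Union>\<alpha>\<in>dual L H. root_space L H \<alpha>) = carrier L"

definition abelian_on :: "(complex, 'a) module \<Rightarrow> 'a set \<Rightarrow> bool" where
  "abelian_on L H \<longleftrightarrow> (\<forall>x\<in>H. \<forall>y\<in>H. x \<otimes>\<^bsub>L\<^esub> y = \<zero>\<^bsub>L\<^esub>)"

definition self_centralizing :: "(complex, 'a) module \<Rightarrow> 'a set \<Rightarrow> bool" where
  "self_centralizing L H \<longleftrightarrow> {x \<in> carrier L. \<forall>t\<in>H. t \<otimes>\<^bsub>L\<^esub> x = \<zero>\<^bsub>L\<^esub>} = H"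

text \<open>
  The definition of a Cartan subalgebra used for complex semisimple Lie algebras: a maximal
  abelian (equivalently, for abelian \<open>H\<close>, self-centralizing) subalgebra acting diagonalizably.
\<close>

definition cartan_subalgebra :: "(complex, 'a) module \<Rightarrow> 'a set \<Rightarrow> bool" where
  "cartan_subalgebra L H \<longleftrightarrow>
     lie_subalgebra L H \<and> abelian_on L H \<and> self_centralizing L H \<and> ad_diagonalizable L H"

text \<open>The form on \<open>H\<^sup>*\<close> induced by a form \<open>f\<close> that is nondegenerate on \<open>H\<close>.\<close>

definition dual_rep ::
    "'a set \<Rightarrow> ('a \<Rightarrow> 'a \<Rightarrow> complex) \<Rightarrow> ('a \<Rightarrow> complex) \<Rightarrow> 'a" where
  "dual_rep H f \<alpha> = (THE t. t \<in> H \<and> (\<forall>x\<in>H. f t x = \<alpha> x))"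

definition dual_form ::
    "'a set \<Rightarrow> ('a \<Rightarrow> 'a \<Rightarrow> complex) \<Rightarrow> ('a \<Rightarrow> complex) \<Rightarrow> ('a \<Rightarrow> complex) \<Rightarrow> complex" where
  "dual_form H f \<alpha> \<beta> = f (dual_rep H f \<alpha>) (dual_rep H f \<beta>)"

definition nonisotropic_roots ::
    "(complex, 'a) module \<Rightarrow> 'a set \<Rightarrow> ('a \<Rightarrow> 'a \<Rightarrow> complex) \<Rightarrow> ('a \<Rightarrow> complex) set" where
  "nonisotropic_roots L H f = {\<alpha> \<in> roots L H. dual_form H f \<alpha> \<alpha> \<noteq> 0}"

definition isotropic_roots ::
    "(complex, 'a) module \<Rightarrow> 'a set \<Rightarrow> ('a \<Rightarrow> 'a \<Rightarrow> complex) \<Rightarrow> ('a \<Rightarrow> complex) set" where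
  "isotropic_roots L H f = {\<alpha> \<in> roots L H. dual_form H f \<alpha> \<alpha> = 0}"

text \<open>
  In \<open>EA4\<close> the set of roots is a subset of a function space with the topology of pointwise
  convergence. As \<open>H\<close> is finite dimensional, this topology is the usual one on \<open>H\<^sup>*\<close>.
\<close>

locale extended_affine_lie_algebra = lie_algebra L for L :: "(complex, 'a) module" (structure) +
  fixes H :: "'a set" and f :: "'a \<Rightarrow> 'a \<Rightarrow> complex"
  assumes EA1: "invariant_symmetric_form L f" "nondegenerate_on L (carrier L) f"
    and EA2: "lie_subalgebra L H" "H \<noteq> {\<zero>\<^bsub>L\<^esub>}" "finite_dimensional L H" "abelian_on L H"
          "self_centralizing L H" "ad_diagonalizable L H"
    and EA3: "\<lbrakk>\<alpha> \<in> nonisotropic_roots L H f; x \<in> root_space L H \<alpha>; y \<in> carrier L\<rbrakk>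
          \<Longrightarrow> \<exists>n. ((\<lambda>z. x \<otimes>\<^bsub>L\<^esub> z) ^^ n) y = \<zero>\<^bsub>L\<^esub>"
    and EA4: "discrete (roots L H)"
    and EA5i: "\<lbrakk>nonisotropic_roots L H f = R1 \<union> R2;
          \<forall>\<alpha>\<in>R1. \<forall>\<beta>\<in>R2. dual_form H f \<alpha> \<beta> = 0\<rbrakk> \<Longrightarrow> R1 = {} \<or> R2 = {}"
    and EA5ii: "\<sigma> \<in> isotropic_roots L H f
          \<Longrightarrow> \<exists>\<alpha>\<in>nonisotropic_roots L H f. (\<lambda>t. \<sigma> t + \<alpha> t) \<in> roots L H"

definition core ::
    "(complex, 'a) module \<Rightarrow> 'a set \<Rightarrow> ('a \<Rightarrow> 'a \<Rightarrow> complex) \<Rightarrow> 'a set" where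
  "core L H f =
     generated_subalgebra L (\<Union>\<alpha>\<in>nonisotropic_roots L H f. root_space L H \<alpha>)"


section \<open>The full toroidal Lie algebra\<close>

text \<open>
  The index type \<open>'n\<close> has \<open>N\<close> elements. For a vector space \<open>V\<close>, the space \<open>V \<otimes> \<A>\<close> is the
  type of finitely supported functions from \<open>\<int>\<^sup>N\<close> to \<open>V\<close>, with
  \<open>Poly_Mapping.single r x\<close> for \<open>x \<otimes> t\<^sup>r\<close>. Both \<open>\<Omega>\<^sub>\<A>\<close> and \<open>Der \<A>\<close> are free \<open>\<A>\<close>-modules
  of rank \<open>N\<close>, so both are \<open>\<complex>\<^sup>N \<otimes> \<A>\<close>: \<open>Poly_Mapping.single r u\<close> stands for
  \<open>\<Sum>\<^sub>i u\<^sub>i t\<^sup>r K\<^sub>i\<close> in the former and for \<open>D(u, r)\<close> in the latter.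
\<close>

type_synonym ('v, 'n) loop = "(int, 'n) vec \<Rightarrow>\<^sub>0 'v"
type_synonym 'n vloop = "(int, 'n) vec \<Rightarrow>\<^sub>0 (complex, 'n) vec"

definition cvec :: "(int, 'n::finite) vec \<Rightarrow> (complex, 'n) vec" where
  "cvec r = (\<chi> i. of_int (r $ i))"

text \<open>This pairing is complex bilinear, unlike the library's (real) inner product.\<close>

definition cdot :: "(complex, 'n::finite) vec \<Rightarrow> (complex, 'n) vec \<Rightarrow> complex" where
  "cdot u v = (\<Sum>i\<in>UNIV. u $ i * v $ i)"

definition vloop_scale :: "complex \<Rightarrow> ('n::finite) vloop \<Rightarrow> 'n vloop" where
  "vloop_scale c = Poly_Mapping.map (\<lambda>u. c *s u)"

lemma lookup_vloop_scale [simp]: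
  "Poly_Mapping.lookup (vloop_scale c f) r = c *s Poly_Mapping.lookup f r"
  by (simp add: vloop_scale_def map.rep_eq when_def)

lemma vloop_scale_single:
  "vloop_scale c (Poly_Mapping.single r u) = Poly_Mapping.single r (c *s u)"
  by (rule poly_mapping_eqI) (simp add: lookup_single when_def)

global_interpretation vloop: vector_space vloop_scale
  by unfold_locales
    (auto intro!: poly_mapping_eqI simp: lookup_add vector_add_ldistrib vector_sadd_rdistrib
      vector_smult_assoc)

text \<open>Extension of a map given on homogeneous elements to a biadditive map.\<close>

definition bilin_ext ::
    "('i \<Rightarrow> 'x \<Rightarrow> 'j \<Rightarrow> 'y \<Rightarrow> 'z::comm_monoid_add)
      \<Rightarrow> ('i \<Rightarrow>\<^sub>0 'x::zero) \<Rightarrow> ('j \<Rightarrow>\<^sub>0 'y::zero) \<Rightarrow> 'z" where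
  "bilin_ext b f g =
     (\<Sum>r\<in>Poly_Mapping.keys f. \<Sum>s\<in>Poly_Mapping.keys g.
        b r (Poly_Mapping.lookup f r) s (Poly_Mapping.lookup g s))"

definition exact_forms :: "('n::finite) vloop set" where
  "exact_forms = vloop.span (range (\<lambda>r. Poly_Mapping.single r (cvec r)))"

text \<open>The space \<open>\<Z> = \<Omega>\<^sub>\<A> / d\<^sub>\<A>\<close>.\<close>

lemma exact_forms_zero: "0 \<in> exact_forms"
  unfolding exact_forms_def by (rule vloop.span_zero)

lemma exact_forms_add: "x \<in> exact_forms \<Longrightarrow> y \<in> exact_forms \<Longrightarrow> x + y \<in> exact_forms"
  unfolding exact_forms_def by (rule vloop.span_add)

lemma exact_forms_neg: "x \<in> exact_forms \<Longrightarrow> - x \<in> exact_forms"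
  unfolding exact_forms_def by (rule vloop.span_neg)

lemma exact_forms_scale: "x \<in> exact_forms \<Longrightarrow> vloop_scale c x \<in> exact_forms"
  unfolding exact_forms_def by (rule vloop.span_scale)

quotient_type (overloaded) 'n kz = "('n::finite) vloop" / "\<lambda>x y. x - y \<in> exact_forms"
proof (rule equivpI)
  show "reflp (\<lambda>x y. x - y \<in> (exact_forms :: 'n vloop set))"
    by (rule reflpI) (simp add: exact_forms_zero)
  show "symp (\<lambda>x y. x - y \<in> (exact_forms :: 'n vloop set))"
  proof (rule sympI)
    fix x y :: "'n vloop"
    assume "x - y \<in> exact_forms"
    from exact_forms_neg[OF this] show "y - x \<in> exact_forms"
      by (simp only: minus_diff_eq)
  qed
  show "transp (\<lambda>x y. x - y \<in> (exact_forms :: 'n vloop set))"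
  proof (rule transpI)
    fix x y z :: "'n vloop"
    assume "x - y \<in> exact_forms" "y - z \<in> exact_forms"
    from exact_forms_add[OF this] show "x - z \<in> exact_forms"
      by simp
  qed
qed

lemma kz_eqI: "x = y \<Longrightarrow> x - y \<in> exact_forms"
  by (simp only: diff_self exact_forms_zero)

instantiation kz :: (finite) ab_group_add
begin

lift_definition zero_kz :: "'a kz" is 0 .

lift_definition plus_kz :: "'a kz \<Rightarrow> 'a kz \<Rightarrow> 'a kz" is "(+)"
  by (subst add_diff_add) (rule exact_forms_add)

lift_definition minus_kz :: "'a kz \<Rightarrow> 'a kz \<Rightarrow> 'a kz" is "(-)"
proof -
  fix a b c d :: "'a vloop"
  assume "a - b \<in> exact_forms" "c - d \<in> exact_forms"
  then have "(a - b) + - (c - d) \<in> exact_forms"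
    by (intro exact_forms_add exact_forms_neg)
  moreover have "(a - b) + - (c - d) = a - c - (b - d)"
    by (simp add: algebra_simps)
  ultimately show "a - c - (b - d) \<in> exact_forms" by (simp only:)
qed

lift_definition uminus_kz :: "'a kz \<Rightarrow> 'a kz" is uminus
proof -
  fix a b :: "'a vloop"
  assume "a - b \<in> exact_forms"
  moreover have "- a - - b = - (a - b)" by simp
  ultimately show "- a - - b \<in> exact_forms" by (simp only: exact_forms_neg)
qed

instance
proof
  fix a b c :: "'a kz"
  show "a + b + c = a + (b + c)"
    by transfer (rule kz_eqI, rule add.assoc)
  show "a + b = b + a"
    by transfer (rule kz_eqI, rule add.commute)
  show "0 + a = a"
    by transfer (rule kz_eqI, rule add_0_left)
  show "- a + a = 0"
    by transfer (rule kz_eqI, rule left_minus)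
  show "a - b = a + - b"
    by transfer (rule kz_eqI, rule diff_conv_add_uminus)
qed

end

lift_definition kz_scale :: "complex \<Rightarrow> ('n::finite) kz \<Rightarrow> 'n kz" is vloop_scale
  by (subst vloop.scale_right_diff_distrib[symmetric]) (rule exact_forms_scale)

global_interpretation kz: vector_space kz_scale
proof
  fix a b :: complex and x y :: "'a kz"
  show "kz_scale a (x + y) = kz_scale a x + kz_scale a y"
    by transfer (rule kz_eqI, rule vloop.scale_right_distrib)
  show "kz_scale (a + b) x = kz_scale a x + kz_scale b x"
    by transfer (rule kz_eqI, rule vloop.scale_left_distrib)
  show "kz_scale a (kz_scale b x) = kz_scale (a * b) x"
    by transfer (rule kz_eqI, rule vloop.scale_scale)
  show "kz_scale 1 x = x"
    by transfer (rule kz_eqI, rule vloop.scale_one)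
qed

definition K :: "(complex, 'n::finite) vec \<Rightarrow> (int, 'n) vec \<Rightarrow> 'n kz" where
  "K u r = abs_kz (Poly_Mapping.single r u)"

text \<open>
  The action of \<open>Der \<A>\<close> on \<open>\<Omega>\<^sub>\<A>\<close>, which preserves \<open>d\<^sub>\<A>\<close> and so induces the bracket
  \<open>[D(u, r), K(v, s)] = (u|s) K(v, r + s) + (u|v) K(r, r + s)\<close>.
\<close>

definition der_form :: "('n::finite) vloop \<Rightarrow> 'n vloop \<Rightarrow> 'n vloop" where
  "der_form = bilin_ext (\<lambda>r u s v.
     Poly_Mapping.single (r + s) (cdot u (cvec s) *s v + cdot u v *s cvec r))"

lemma bilin_ext_superset:
  assumes "finite A" "Poly_Mapping.keys g \<subseteq> A" "\<And>r x s. b r x s 0 = 0"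
  shows "bilin_ext b f g =
    (\<Sum>r\<in>Poly_Mapping.keys f. \<Sum>s\<in>A. b r (Poly_Mapping.lookup f r) s (Poly_Mapping.lookup g s))"
  unfolding bilin_ext_def
  by (intro sum.cong refl sum.mono_neutral_left)
    (use assms in \<open>auto simp: in_keys_iff\<close>)

lemma cdot_add_right: "cdot u (v + w) = cdot u v + cdot u w"
  by (simp add: cdot_def algebra_simps sum.distrib)

lemma cdot_smult_right: "cdot u (c *s v) = c * cdot u v"
  by (simp add: cdot_def algebra_simps sum_distrib_left)

lemma cdot_zero_right [simp]: "cdot u 0 = 0"
  by (simp add: cdot_def)

lemma cvec_add: "cvec (r + s) = cvec r + cvec s"
  by (simp add: cvec_def vec_eq_iff)

lemma der_form_add: "der_form D (x + y) = der_form D x + der_form D y"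
proof -
  let ?A = "Poly_Mapping.keys x \<union> Poly_Mapping.keys y"
  let ?b = "\<lambda>r u s v.
     Poly_Mapping.single (r + s) (cdot u (cvec s) *s v + cdot u v *s cvec r) :: 'a vloop"
  have A: "finite ?A" "Poly_Mapping.keys x \<subseteq> ?A" "Poly_Mapping.keys y \<subseteq> ?A"
    "Poly_Mapping.keys (x + y) \<subseteq> ?A"
    using keys_add[of x y] by auto
  have b0: "?b r u s 0 = 0" for r u s
    by simp
  have bil: "?b r u s (v + w) = ?b r u s v + ?b r u s w" for r u s v w
    unfolding single_add[symmetric] cdot_add_right vector_add_ldistrib vector_sadd_rdistrib
    by (simp only: add.assoc add.commute add.left_commute)
  show ?thesis
    unfolding der_form_def
      bilin_ext_superset[of ?A _ ?b, OF A(1) A(2) b0]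
      bilin_ext_superset[of ?A _ ?b, OF A(1) A(3) b0]
      bilin_ext_superset[of ?A _ ?b, OF A(1) A(4) b0]
    by (simp only: lookup_add bil sum.distrib)
qed

lemma der_form_scale: "der_form D (vloop_scale c x) = vloop_scale c (der_form D x)"
proof -
  let ?A = "Poly_Mapping.keys x"
  let ?b = "\<lambda>r u s v.
     Poly_Mapping.single (r + s) (cdot u (cvec s) *s v + cdot u v *s cvec r) :: 'a vloop"
  have A: "finite ?A" "?A \<subseteq> ?A" "Poly_Mapping.keys (vloop_scale c x) \<subseteq> ?A"
    by (auto simp: in_keys_iff)
  have b0: "?b r u s 0 = 0" for r u s
    by simp
  have bil: "?b r u s (c *s v) = vloop_scale c (?b r u s v)" for r u s v
    unfolding vloop_scale_single cdot_smult_right vector_add_ldistrib vector_smult_assoc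
    by (simp only: mult.commute)
  show ?thesis
    unfolding der_form_def
      bilin_ext_superset[of ?A _ ?b, OF A(1) A(2) b0]
      bilin_ext_superset[of ?A _ ?b, OF A(1) A(3) b0]
    by (simp only: lookup_vloop_scale bil vloop.scale_sum_right)
qed

lemma der_form_exact:
  assumes "x \<in> exact_forms"
  shows "der_form D x \<in> exact_forms"
  using assms unfolding exact_forms_def
proof (induction rule: vloop.span_induct_alt)
  case base
  then show ?case
    by (simp add: der_form_def bilin_ext_def vloop.span_zero)
next
  case (step c x y)
  then obtain s where x: "x = Poly_Mapping.single s (cvec s)" by auto
  have "der_form D x = (\<Sum>r\<in>Poly_Mapping.keys D. vloop_scale
      (cdot (Poly_Mapping.lookup D r) (cvec s)) (Poly_Mapping.single (r + s) (cvec (r + s))))"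
    unfolding der_form_def x
    by (subst bilin_ext_superset[of "{s}"])
      (auto intro!: sum.cong simp: vloop_scale_single cvec_add vector_add_ldistrib add.commute)
  also have "\<dots> \<in> vloop.span (range (\<lambda>r. Poly_Mapping.single r (cvec r)))"
    by (intro vloop.span_sum vloop.span_scale vloop.span_base) auto
  finally show ?case
    using step by (simp add: der_form_add der_form_scale vloop.span_add vloop.span_scale)
qed

lift_definition der_kz :: "('n::finite) vloop \<Rightarrow> 'n kz \<Rightarrow> 'n kz" is der_form
proof -
  fix D x y :: "'n vloop"
  assume "x - y \<in> exact_forms"
  moreover have "der_form D x = der_form D (x - y) + der_form D y"
    by (simp flip: der_form_add)
  ultimately show "der_form D x - der_form D y \<in> exact_forms"
    using der_form_exact by simp
qed

text \<open>
  The sum \<open>\<gg> \<otimes> \<A> \<oplus> \<Z> \<oplus> Der \<A>\<close>, where \<open>\<gg>\<close> is the type \<open>'g\<close> with scalar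
  multiplication \<open>sc\<close>, bracket \<open>br\<close> and form \<open>f\<close>. The bracket extends bilinearly
  \<open>[X(r), Y(s)] = [X, Y](r + s) + f X Y K(r, r + s)\<close>,
  \<open>[D(u, r), X(s)] = (u|s) X(r + s)\<close>,
  \<open>[D(u, r), D(v, s)] = D((u|s) v - (v|r) u, r + s) - (u|s) (v|r) K(r, r + s)\<close>
  and the action of \<open>Der \<A>\<close> on \<open>\<Z>\<close> above.
\<close>

type_synonym ('g, 'n) toroidal = "('g, 'n) loop \<times> 'n kz \<times> 'n vloop"

context
  fixes sc :: "complex \<Rightarrow> 'g::ab_group_add \<Rightarrow> 'g" and br :: "'g \<Rightarrow> 'g \<Rightarrow> 'g"
    and f :: "'g \<Rightarrow> 'g \<Rightarrow> complex"
begin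

definition der_loop :: "('n::finite) vloop \<Rightarrow> ('g, 'n) loop \<Rightarrow> ('g, 'n) loop" where
  "der_loop = bilin_ext (\<lambda>r u s x. Poly_Mapping.single (r + s) (sc (cdot u (cvec s)) x))"

fun toroidal_scale ::
    "complex \<Rightarrow> ('g, 'n::finite) toroidal \<Rightarrow> ('g, 'n) toroidal" where
  "toroidal_scale c (X, k, D) = (Poly_Mapping.map (sc c) X, kz_scale c k, vloop_scale c D)"

fun toroidal_bracket ::
    "('g, 'n::finite) toroidal \<Rightarrow> ('g, 'n) toroidal \<Rightarrow> ('g, 'n) toroidal" where
  "toroidal_bracket (X, k, D) (Y, l, E) =
    (bilin_ext (\<lambda>r x s y. Poly_Mapping.single (r + s) (br x y)) X Y
       + der_loop D Y - der_loop E X,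
     bilin_ext (\<lambda>r x s y. kz_scale (f x y) (K (cvec r) (r + s))) X Y
       + der_kz D l - der_kz E k
       - bilin_ext (\<lambda>r u s v.
           kz_scale (cdot u (cvec s) * cdot v (cvec r)) (K (cvec r) (r + s))) D E,
     bilin_ext (\<lambda>r u s v.
       Poly_Mapping.single (r + s) (cdot u (cvec s) *s v - cdot v (cvec r) *s u)) D E)"

definition toroidal_algebra :: "(complex, ('g, 'n::finite) toroidal) module" where
  "toroidal_algebra = type_lie toroidal_scale toroidal_bracket"

end


section \<open>The algebra \<open>\<tau>\<^sub>B\<close>\<close>

definition torus_der :: "('n::finite) vloop set" where
  "torus_der = vloop.span (range (\<lambda>i. Poly_Mapping.single 0 (axis i 1)))"

definition HB :: "((complex, 'n::finite) vec, 'n) vec \<Rightarrow> 'n vloop set" where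
  "HB B = vloop.span
     ({Poly_Mapping.single r (B *v cvec r) | r. r \<noteq> 0} \<union> torus_der)"

definition KB :: "((complex, 'n::finite) vec, 'n) vec \<Rightarrow> 'n kz set" where
  "KB B = kz.span {K u r | u r. r \<noteq> 0 \<and> cdot (B *v u) (cvec r) = 0}"

definition GB :: "((complex, 'n::finite) vec, 'n) vec \<Rightarrow> (int, 'n) vec set" where
  "GB B = {r. B *v cvec r = 0}"

context
  fixes sc :: "complex \<Rightarrow> 'g::ab_group_add \<Rightarrow> 'g" and br :: "'g \<Rightarrow> 'g \<Rightarrow> 'g"
    and f :: "'g \<Rightarrow> 'g \<Rightarrow> complex" and B :: "((complex, 'n::finite) vec, 'n) vec"
begin

definition pre_tau :: "(complex, ('g, 'n) toroidal) module" where
  "pre_tau = toroidal_algebra sc br f \<lparr>carrier := UNIV \<times> UNIV \<times> HB B\<rparr>"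

definition tau :: "(complex, ('g, 'n) toroidal set) module" where
  "tau = lie_quot pre_tau ({0} \<times> KB B \<times> {0})"

definition tau_proj :: "('g, 'n) toroidal \<Rightarrow> ('g, 'n) toroidal set" where
  "tau_proj x = ({0} \<times> KB B \<times> {0}) +>\<^bsub>pre_tau\<^esub> x"

text \<open>Homogeneous components of the summands of \<open>\<tau>\<^sub>B\<close>, as subspaces of \<open>\<tau>\<^sub>B\<close>.\<close>

definition tau_Z_deg :: "(int, 'n) vec \<Rightarrow> ('g, 'n) toroidal set set" where
  "tau_Z_deg r = tau_proj ` {(0, K u r, 0) | u. True}"

definition tau_H_deg :: "(int, 'n) vec \<Rightarrow> ('g, 'n) toroidal set set" where
  "tau_H_deg r = tau_proj ` {(0, 0, D) | D. D \<in> HB B \<and> Poly_Mapping.keys D \<subseteq> {r}}"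

definition tau_cartan :: "'g set \<Rightarrow> ('g, 'n) toroidal set set" where
  "tau_cartan h = tau_proj `
     {(Poly_Mapping.single 0 x, k, D) | x k D.
        x \<in> h \<and> k \<in> kz.span (range (\<lambda>i. K (axis i 1) 0)) \<and> D \<in> torus_der}"

definition tau_gA_Z :: "('g, 'n) toroidal set set" where
  "tau_gA_Z = tau_proj ` {(X, k, 0) | X k. True}"

end

end

(*
  tau_B is the quotient of a Lie algebra with an invariant symmetric form by the radical of the form:
  on g (x) A (+) Z (+) H_B one pairs X(r) with Y(-r) and K(u, r) with D(v, -r), and K_B is exactly the
  annihilator of H_B under the second pairing. This gives at once that K_B is an ideal and that the
  form on tau_B is nondegenerate.

  Bracketing with D(u, 0) and h splits a root vector into one degree s and one h-weight a, so the
  roots are a + delta_s with a a root of g or 0. For ANY invariant nondegenerate form,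
  [x, y] = (x, y) t_alpha when x, y have weights alpha, -alpha; therefore (alpha, beta) vanishes iff
  beta vanishes on [L_alpha, L_-alpha]. Computing brackets of X(s) and Y(-s) shows that a + delta_s is
  nonisotropic iff a is nonzero. This reduces the axioms, and the core, to properties of the simple
  algebra g: nonzero roots are nonisotropic, the root system is irreducible, and g is generated by
  the root spaces of nonzero roots.
*)

theory Submission
  imports Defs
begin

section \<open>Lie algebras over the complex numbers\<close>

text \<open>The pairing of forms with derivations is the constant term of their contraction. An
  exact form of degree r contracts with D(u, -r) to (u|r), so the pairing does not descend to Z and
  all of Der A. On \<open>HB B\<close> it does: there every D(u, r) has (u|r) = 0, because B is
  skew. The same identity gives invariance of the form wherever derivations occur. Skewness also
  turns (B u|r) = 0 into (u|B r) = 0, that is, orthogonality to the line spanned by B r.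

  The claim about the core ranges over all forms that make the algebra an EALA, so isotropy may not
  be computed from the explicit form. The delicate case is \<open>\<delta>\<^sub>s\<close>: for an
  unknown form it is not known in advance which root vectors of degrees s and -s pair nontrivially.
  Brackets decide this, since \<open>\<delta>\<^sub>s\<close> vanishes on K(s, 0) although K(s, 0)
  is nonzero for nonzero s.

  The root theory of the simple algebra is built from the given form alone, without the Killing form
  or sl2 triples. Finiteness of root strings does the work: it gives both the nonisotropy of nonzero
  roots and, after restricting weights to the small Cartan subalgebra, the nilpotency in
  EA3.\<close>

lemma complex_ring_simps [simp]:
  "carrier complex_ring = UNIV" "\<one>\<^bsub>complex_ring\<^esub> = 1" "\<zero>\<^bsub>complex_ring\<^esub> = 0"
  "x \<otimes>\<^bsub>complex_ring\<^esub> y = x * y" "x \<oplus>\<^bsub>complex_ring\<^esub> y = x + y"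
  by (simp_all add: complex_ring_def)

lemma cring_complex_ring: "cring complex_ring"
proof (rule cringI)
  show "abelian_group complex_ring"
  proof (rule abelian_groupI)
    show "\<exists>y\<in>carrier complex_ring. y \<oplus>\<^bsub>complex_ring\<^esub> x = \<zero>\<^bsub>complex_ring\<^esub>" for x
      by (intro bexI[of _ "- x"]) auto
  qed (auto simp: algebra_simps)
  show "Group.comm_monoid complex_ring"
    by (rule comm_monoidI) (auto simp: algebra_simps)
qed (auto simp: algebra_simps)

context lie_algebra
begin

abbreviation subspace :: "'a set \<Rightarrow> bool" where
  "subspace V \<equiv> submodule V complex_ring L"

lemma scale_closed [simp]: "x \<in> carrier L \<Longrightarrow> c \<odot> x \<in> carrier L"
  by (rule smult_closed) auto

lemma scale_zero_left [simp]: "x \<in> carrier L \<Longrightarrow> 0 \<odot> x = \<zero>"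
  using smult_l_null[of x] by simp

lemma scale_zero_right [simp]: "c \<odot> \<zero> = \<zero>"
  using smult_r_null[of c] by simp

lemma scale_one [simp]: "x \<in> carrier L \<Longrightarrow> 1 \<odot> x = x"
  using smult_one[of x] by simp

lemma scale_scale [simp]: "x \<in> carrier L \<Longrightarrow> c \<odot> (d \<odot> x) = (c * d) \<odot> x"
  using smult_assoc1[of c d x] by simp

lemma scale_add_left: "x \<in> carrier L \<Longrightarrow> (c + d) \<odot> x = c \<odot> x \<oplus> d \<odot> x"
  using smult_l_distr[of c d x] by simp

lemma scale_add_right:
  "x \<in> carrier L \<Longrightarrow> y \<in> carrier L \<Longrightarrow> c \<odot> (x \<oplus> y) = c \<odot> x \<oplus> c \<odot> y"
  using smult_r_distr[of c x y] by simp

lemma scale_minus_one: "x \<in> carrier L \<Longrightarrow> (-1) \<odot> x = \<ominus> x"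
proof -
  assume x: "x \<in> carrier L"
  have "(-1) \<odot> x \<oplus> x = (-1 + 1) \<odot> x"
    using x by (subst scale_add_left) auto
  then show ?thesis
    using x by (intro M.minus_equality[symmetric]) auto
qed

lemma scale_eq_zero_iff: "x \<in> carrier L \<Longrightarrow> c \<odot> x = \<zero> \<longleftrightarrow> c = 0 \<or> x = \<zero>"
proof -
  assume x: "x \<in> carrier L"
  have "x = \<zero>" if "c \<odot> x = \<zero>" "c \<noteq> 0"
  proof -
    have "x = (1 / c) \<odot> (c \<odot> x)" using x that(2) by simp
    also have "\<dots> = \<zero>" unfolding that(1) by simp
    finally show ?thesis .
  qed
  then show ?thesis using x by auto
qed

lemma subspaceI:
  assumes "V \<subseteq> carrier L" "\<zero> \<in> V" "\<And>x y. x \<in> V \<Longrightarrow> y \<in> V \<Longrightarrow> x \<oplus> y \<in> V"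
    "\<And>c x. x \<in> V \<Longrightarrow> c \<odot> x \<in> V"
  shows "subspace V"
proof (rule submoduleI)
  show "\<ominus> x \<in> V" if "x \<in> V" for x
    using assms(1) assms(4)[OF that, of "-1"] that by (auto simp: scale_minus_one)
qed (use assms in auto)

lemma subspaceD:
  assumes "subspace V"
  shows "V \<subseteq> carrier L" "\<zero> \<in> V" "\<And>x y. x \<in> V \<Longrightarrow> y \<in> V \<Longrightarrow> x \<oplus> y \<in> V"
    "\<And>c x. x \<in> V \<Longrightarrow> c \<odot> x \<in> V"
proof -
  show V: "V \<subseteq> carrier L" and add: "\<And>x y. x \<in> V \<Longrightarrow> y \<in> V \<Longrightarrow> x \<oplus> y \<in> V"
    and sc: "\<And>c x. x \<in> V \<Longrightarrow> c \<odot> x \<in> V"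
    using submoduleE[OF assms] by auto
  from submoduleE(2)[OF assms] obtain x where "x \<in> V" by auto
  then show "\<zero> \<in> V" using sc[of x 0] V by auto
qed

lemma subspace_carrier: "subspace (carrier L)"
  by (rule carrier_is_submodule)

lemma subspace_zero: "subspace {\<zero>}"
  by (rule subspaceI) auto

lemma subspace_Inter:
  assumes "\<And>V. V \<in> F \<Longrightarrow> subspace V" "F \<noteq> {}"
  shows "subspace (\<Inter>F)"
proof (rule subspaceI)
  obtain W where "W \<in> F" using assms(2) by auto
  then show "\<Inter>F \<subseteq> carrier L" using subspaceD(1)[OF assms(1), of W] by auto
qed (use subspaceD[OF assms(1)] in auto)

lemma subspace_lin_span: "S \<subseteq> carrier L \<Longrightarrow> subspace (lin_span L S)"
  unfolding lin_span_def using subspace_carrier by (intro subspace_Inter) auto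

lemma lin_span_superset: "S \<subseteq> lin_span L S"
  unfolding lin_span_def by auto

lemma lin_span_minimal: "subspace V \<Longrightarrow> S \<subseteq> V \<Longrightarrow> lin_span L S \<subseteq> V"
  unfolding lin_span_def by auto

lemma lin_span_mono: "S \<subseteq> T \<Longrightarrow> T \<subseteq> carrier L \<Longrightarrow> lin_span L S \<subseteq> lin_span L T"
  by (rule lin_span_minimal[OF subspace_lin_span]) (use lin_span_superset[of T] in auto)

lemma lin_span_empty: "lin_span L {} = {\<zero>}"
  using lin_span_minimal[OF subspace_zero, of "{}"] subspaceD(2)[OF subspace_lin_span[of "{}"]]
  by auto

lemma bracket_zero_left [simp]: "x \<in> carrier L \<Longrightarrow> \<zero> \<otimes> x = \<zero>"
  using bracket_smult_left[of \<zero> x 0] bracket_closed by simp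

lemma bracket_zero_right [simp]: "x \<in> carrier L \<Longrightarrow> x \<otimes> \<zero> = \<zero>"
  using bracket_smult_right[of x \<zero> 0] bracket_closed by simp

lemma bracket_anti:
  assumes x: "x \<in> carrier L" and y: "y \<in> carrier L"
  shows "x \<otimes> y = \<ominus> (y \<otimes> x)"
proof -
  have "\<zero> = (x \<oplus> y) \<otimes> (x \<oplus> y)"
    using x y bracket_self[of "x \<oplus> y"] by simp
  also have "\<dots> = x \<otimes> y \<oplus> y \<otimes> x"
    using x y bracket_self[OF x] bracket_self[OF y]
    by (simp add: bracket_add_left bracket_add_right bracket_closed M.a_comm)
  finally show ?thesis
    using x y bracket_closed by (intro M.minus_equality[symmetric]) auto
qed

lemma bracket_eq_zero_sym:
  "x \<in> carrier L \<Longrightarrow> y \<in> carrier L \<Longrightarrow> x \<otimes> y = \<zero> \<Longrightarrow> y \<otimes> x = \<zero>"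
  using bracket_anti[of y x] by simp

text \<open>The Jacobi identity in the form used throughout: \<open>ad x\<close> is a derivation. It
  gives additivity of weights and closure of centralizers and normalizers.\<close>

lemma leibniz:
  assumes x: "x \<in> carrier L" and y: "y \<in> carrier L" and z: "z \<in> carrier L"
  shows "x \<otimes> (y \<otimes> z) = (x \<otimes> y) \<otimes> z \<oplus> y \<otimes> (x \<otimes> z)"
proof -
  note cl = bracket_closed[OF x y] bracket_closed[OF y z] bracket_closed[OF z x]
    bracket_closed[OF x z]
  have 1: "y \<otimes> (z \<otimes> x) = \<ominus> (y \<otimes> (x \<otimes> z))"
    using x y z cl bracket_anti[OF z x] bracket_smult_right[of y "x \<otimes> z" "-1"]
    by (simp add: scale_minus_one bracket_closed)
  have 2: "z \<otimes> (x \<otimes> y) = \<ominus> ((x \<otimes> y) \<otimes> z)"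
    by (rule bracket_anti[OF z cl(1)])
  have "x \<otimes> (y \<otimes> z) \<oplus> \<ominus> (y \<otimes> (x \<otimes> z)) \<oplus> \<ominus> ((x \<otimes> y) \<otimes> z) = \<zero>"
    using jacobi[OF x y z] 1 2 by simp
  then have "x \<otimes> (y \<otimes> z) \<oplus> \<ominus> ((x \<otimes> y) \<otimes> z \<oplus> y \<otimes> (x \<otimes> z)) = \<zero>"
    using x y z cl by (simp add: bracket_closed M.minus_add M.a_ac)
  then show ?thesis
    using x y z cl by (metis M.minus_equality M.minus_minus M.a_closed M.a_inv_closed
      bracket_closed)
qed

lemma lie_subalgebraD:
  assumes "lie_subalgebra L V"
  shows "subspace V" "\<And>x y. x \<in> V \<Longrightarrow> y \<in> V \<Longrightarrow> x \<otimes> y \<in> V"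
  using assms unfolding lie_subalgebra_def by auto

lemma lie_subalgebra_generated:
  assumes "S \<subseteq> carrier L"
  shows "lie_subalgebra L (generated_subalgebra L S)"
proof -
  have "lie_subalgebra L (carrier L)"
    using subspace_carrier bracket_closed unfolding lie_subalgebra_def by auto
  then have ne: "carrier L \<in> {V. lie_subalgebra L V \<and> S \<subseteq> V}" using assms by auto
  have "subspace (generated_subalgebra L S)"
    unfolding generated_subalgebra_def
    by (rule subspace_Inter) (use ne in \<open>auto simp: lie_subalgebra_def\<close>)
  then show ?thesis
    unfolding lie_subalgebra_def generated_subalgebra_def by blast
qed

lemma generated_superset: "S \<subseteq> generated_subalgebra L S"
  unfolding generated_subalgebra_def by auto

lemma generated_minimal: "lie_subalgebra L V \<Longrightarrow> S \<subseteq> V \<Longrightarrow> generated_subalgebra L S \<subseteq> V"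
  unfolding generated_subalgebra_def by auto

text \<open>Lets commutation with a set be checked on generators of a subalgebra. For
  \<open>S = carrier L\<close> it is the centre.\<close>

lemma lie_subalgebra_centralizer:
  assumes S: "S \<subseteq> carrier L"
  shows "lie_subalgebra L {x \<in> carrier L. \<forall>y\<in>S. x \<otimes> y = \<zero>}"
  unfolding lie_subalgebra_def
proof (intro conjI subspaceI ballI)
  let ?V = "{x \<in> carrier L. \<forall>y\<in>S. x \<otimes> y = \<zero>}"
  fix x y assume xy: "x \<in> ?V" "y \<in> ?V"
  have "(x \<otimes> y) \<otimes> z = \<zero>" if z: "z \<in> S" for z
  proof -
    have "x \<otimes> (y \<otimes> z) = (x \<otimes> y) \<otimes> z \<oplus> y \<otimes> (x \<otimes> z)"
      using xy z S by (intro leibniz) auto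
    moreover have "(x \<otimes> y) \<otimes> z \<in> carrier L" using xy z S by (auto intro!: bracket_closed)
    ultimately show ?thesis using xy z by simp
  qed
  then show "x \<otimes> y \<in> ?V"
    using xy by (auto intro: bracket_closed)
qed (use S in \<open>auto simp: bracket_add_left bracket_smult_left subset_eq\<close>)

text \<open>\<open>has_dim\<close> asks for an independent spanning set. A subset of
  \<open>S\<close> of least cardinality with the same span is one, since a redundant vector could be
  removed.\<close>

lemma finite_dimensionalI:
  assumes "finite S" "S \<subseteq> carrier L"
  shows "finite_dimensional L (lin_span L S)"
proof -
  define P where "P T \<longleftrightarrow> T \<subseteq> S \<and> lin_span L T = lin_span L S" for T
  have "P S" by (simp add: P_def)
  then obtain T where T: "P T" "\<And>T'. P T' \<Longrightarrow> card T \<le> card T'"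
    using ex_has_least_nat[of P S card] by auto
  have fin: "finite T" and TS: "T \<subseteq> S"
    using T(1) assms(1) finite_subset unfolding P_def by auto
  have "x \<notin> lin_span L (T - {x})" if x: "x \<in> T" for x
  proof
    assume in_span: "x \<in> lin_span L (T - {x})"
    have sub: "T - {x} \<subseteq> carrier L" "T \<subseteq> carrier L" using TS assms by auto
    have "T \<subseteq> lin_span L (T - {x})"
      using in_span lin_span_superset[of "T - {x}"] by auto
    then have "lin_span L T \<subseteq> lin_span L (T - {x})"
      by (rule lin_span_minimal[OF subspace_lin_span[OF sub(1)]])
    then have "P (T - {x})"
      using T(1) lin_span_mono[of "T - {x}" T] sub unfolding P_def by auto
    from T(2)[OF this] show False
      using x fin by (meson card_Diff1_less leD)
  qed
  then show ?thesis
    unfolding finite_dimensional_def has_dim_def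
    using T(1) fin TS assms(2) by (intro exI[of _ "card T"] exI[of _ T]) (auto simp: P_def)
qed

lemma has_dim_zero: "has_dim L {\<zero>} 0"
  unfolding has_dim_def by (intro exI[of _ "{}"]) (auto simp: lin_span_empty)

text \<open>This lemma and the next two carry subspaces, spans and bases from a type-based vector
  space, where basis theory is available, along \<open>\<phi>\<close> into the carrier-based module
  \<open>L\<close>.\<close>

lemma subspace_linear_image:
  assumes vs: "vector_space s" and closed: "\<And>v. \<phi> v \<in> carrier L"
    and add: "\<And>v w. \<phi> (v + w) = \<phi> v \<oplus> \<phi> w" and scale: "\<And>c v. \<phi> (s c v) = c \<odot> \<phi> v"
    and U: "module.subspace s U"
  shows "subspace (\<phi> ` U)"
proof -
  interpret VS: vector_space s by fact
  have "\<phi> 0 = \<zero>" using scale[of 0 0] closed by simp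
  then show ?thesis
    using U closed VS.subspace_0[OF U] VS.subspace_add[OF U] VS.subspace_scale[OF U]
    by (intro subspaceI) (force simp flip: add scale)+
qed

lemma lin_span_linear_image:
  assumes vs: "vector_space s" and closed: "\<And>v. \<phi> v \<in> carrier L"
    and add: "\<And>v w. \<phi> (v + w) = \<phi> v \<oplus> \<phi> w" and scale: "\<And>c v. \<phi> (s c v) = c \<odot> \<phi> v"
  shows "lin_span L (\<phi> ` S) = \<phi> ` module.span s S"
proof
  interpret VS: vector_space s by fact
  show "lin_span L (\<phi> ` S) \<subseteq> \<phi> ` VS.span S"
    using subspace_linear_image[OF assms VS.subspace_span, of S] VS.span_superset
    by (intro lin_span_minimal) auto
  have sub: "subspace (lin_span L (\<phi> ` S))"
    using closed by (intro subspace_lin_span) auto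
  have zero: "\<phi> 0 = \<zero>" using scale[of 0 0] closed by simp
  have "\<phi> v \<in> lin_span L (\<phi> ` S)" if "v \<in> VS.span S" for v
    using that
  proof (induction rule: VS.span_induct_alt)
    case base
    then show ?case using subspaceD(2)[OF sub] zero by simp
  next
    case (step c x y)
    then show ?case
      using subspaceD(3,4)[OF sub] lin_span_superset[of "\<phi> ` S"] by (auto simp: add scale)
  qed
  then show "\<phi> ` VS.span S \<subseteq> lin_span L (\<phi> ` S)" by auto
qed

lemma has_dim_injective_image:
  assumes vs: "vector_space s" and closed: "\<And>v. \<phi> v \<in> carrier L"
    and add: "\<And>v w. \<phi> (v + w) = \<phi> v \<oplus> \<phi> w" and scale: "\<And>c v. \<phi> (s c v) = c \<odot> \<phi> v"
    and inj: "\<And>v. \<phi> v = \<zero> \<Longrightarrow> v = 0"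
    and basis: "finite S" "module.span s S = UNIV" "\<not> module.dependent s S"
  shows "has_dim L (range \<phi>) (card S)"
proof -
  interpret VS: vector_space s by fact
  have "v = w" if eq: "\<phi> v = \<phi> w" for v w
  proof -
    have "\<phi> (v + s (-1) w) = \<phi> (w + s (-1) w)"
      by (simp only: add eq)
    also have "\<dots> = \<phi> (s 0 0)" by simp
    also have "\<dots> = \<zero>" using scale[of 0 0] closed by simp
    finally show ?thesis using inj[of "v + s (-1) w"] by simp
  qed
  then have \<phi>: "inj \<phi>" by (rule injI)
  have "\<phi> v \<notin> lin_span L (\<phi> ` S - {\<phi> v})" if "v \<in> S" for v
  proof -
    have "\<phi> ` S - {\<phi> v} = \<phi> ` (S - {v})"
      using \<phi> by (auto simp: inj_eq)
    moreover have "v \<notin> VS.span (S - {v})"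
      using basis(3) that unfolding VS.dependent_def by auto
    ultimately show ?thesis
      using \<phi> lin_span_linear_image[OF vs closed add scale] by (auto simp: inj_eq)
  qed
  then show ?thesis
    unfolding has_dim_def
    using basis closed lin_span_linear_image[OF vs closed add scale, of S]
    by (intro exI[of _ "\<phi> ` S"]) (auto simp: card_image[OF inj_on_subset[OF \<phi>]])
qed

end

text \<open>Every Lie algebra axiom is checked on preimages, so a surjection compatible with the
  operations transports the structure. It is applied to the coset map.\<close>

lemma lie_algebra_hom_image:
  fixes L :: "(complex, 'a) module" and M :: "(complex, 'b) module"
  assumes "lie_algebra L" and M: "carrier M = p ` carrier L" "p \<zero>\<^bsub>L\<^esub> = \<zero>\<^bsub>M\<^esub>"
    and add: "\<And>x y. x \<in> carrier L \<Longrightarrow> y \<in> carrier L \<Longrightarrow> p x \<oplus>\<^bsub>M\<^esub> p y = p (x \<oplus>\<^bsub>L\<^esub> y)"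
    and bracket: "\<And>x y. x \<in> carrier L \<Longrightarrow> y \<in> carrier L \<Longrightarrow> p x \<otimes>\<^bsub>M\<^esub> p y = p (x \<otimes>\<^bsub>L\<^esub> y)"
    and scale: "\<And>c x. x \<in> carrier L \<Longrightarrow> c \<odot>\<^bsub>M\<^esub> p x = p (c \<odot>\<^bsub>L\<^esub> x)"
  shows "lie_algebra M"
proof -
  interpret lie_algebra L by fact
  have "module complex_ring M"
  proof (rule moduleI[OF cring_complex_ring abelian_groupI])
    show "\<exists>y\<in>carrier M. y \<oplus>\<^bsub>M\<^esub> x = \<zero>\<^bsub>M\<^esub>" if "x \<in> carrier M" for x
    proof -
      from that obtain a where a: "a \<in> carrier L" "x = p a" using M by auto
      then show ?thesis
        using M by (intro bexI[of _ "p (\<ominus>\<^bsub>L\<^esub> a)"]) (auto simp: add M.l_neg)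
    qed
  qed (auto simp: M(1) add scale M.a_ac scale_add_left scale_add_right simp flip: M(2))
  then show ?thesis
  proof (rule lie_algebra.intro, unfold_locales)
    show "x \<otimes>\<^bsub>M\<^esub> (y \<otimes>\<^bsub>M\<^esub> z) \<oplus>\<^bsub>M\<^esub> y \<otimes>\<^bsub>M\<^esub> (z \<otimes>\<^bsub>M\<^esub> x) \<oplus>\<^bsub>M\<^esub> z \<otimes>\<^bsub>M\<^esub> (x \<otimes>\<^bsub>M\<^esub> y) = \<zero>\<^bsub>M\<^esub>"
      if xyz: "x \<in> carrier M" "y \<in> carrier M" "z \<in> carrier M" for x y z
    proof -
      from xyz obtain a b c where
        "a \<in> carrier L" "b \<in> carrier L" "c \<in> carrier L" "x = p a" "y = p b" "z = p c"
        using M(1) by auto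
      then show ?thesis by (simp add: add bracket bracket_closed jacobi M(2))
    qed
  qed (auto simp: M(1) add bracket scale bracket_closed bracket_add_left bracket_add_right
      bracket_smult_left bracket_smult_right bracket_self simp flip: M(2))
qed

context lie_algebra
begin

lemma lie_algebra_subalgebra:
  assumes "lie_subalgebra L V"
  shows "lie_algebra (L\<lparr>carrier := V\<rparr>)"
proof -
  note V = subspaceD(1)[OF lie_subalgebraD(1)[OF assms]]
  have "module complex_ring (L\<lparr>carrier := V\<rparr>)"
    using lie_subalgebraD(1)[OF assms] module_axioms by (rule submodule.submodule_is_module)
  then show ?thesis
  proof (rule lie_algebra.intro, unfold_locales)
  qed (use V lie_subalgebraD(2)[OF assms] in \<open>auto simp: subset_eq bracket_add_left
      bracket_add_right bracket_smult_left bracket_smult_right bracket_self jacobi\<close>)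
qed

lemma bracket_minus_left:
  "x \<in> carrier L \<Longrightarrow> y \<in> carrier L \<Longrightarrow> (\<ominus> x) \<otimes> y = \<ominus> (x \<otimes> y)"
  using bracket_smult_left[of x y "-1"] by (simp add: scale_minus_one bracket_closed)

lemma bracket_minus_right:
  "x \<in> carrier L \<Longrightarrow> y \<in> carrier L \<Longrightarrow> x \<otimes> (\<ominus> y) = \<ominus> (x \<otimes> y)"
  using bracket_smult_right[of x y "-1"] by (simp add: scale_minus_one bracket_closed)

lemma scale_minus_right: "x \<in> carrier L \<Longrightarrow> c \<odot> (\<ominus> x) = \<ominus> (c \<odot> x)"
  using smult_r_minus[of c x] by simp

text \<open>Prepares the bracket of cosets: if \<open>a \<ominus> x\<close> and
  \<open>b \<ominus> y\<close> lie in an ideal, so does the right side.\<close>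

lemma bracket_diff:
  assumes "a \<in> carrier L" "b \<in> carrier L" "x \<in> carrier L" "y \<in> carrier L"
  shows "a \<otimes> b \<ominus> x \<otimes> y = (a \<ominus> x) \<otimes> b \<oplus> x \<otimes> (b \<ominus> y)"
proof -
  have 1: "(a \<ominus> x) \<otimes> b = a \<otimes> b \<oplus> \<ominus> (x \<otimes> b)"
    using assms by (simp add: M.minus_eq bracket_add_left bracket_minus_left)
  have 2: "x \<otimes> (b \<ominus> y) = x \<otimes> b \<oplus> \<ominus> (x \<otimes> y)"
    using assms by (simp add: M.minus_eq bracket_add_right bracket_minus_right)
  show ?thesis
    unfolding 1 2 unfolding M.minus_eq
    using assms by (simp add: bracket_closed M.a_assoc M.r_neg1)
qed

end

section \<open>Quotients by ideals\<close>

locale lie_quotient = lie_algebra L for L :: "(complex, 'a) module" (structure) +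
  fixes I :: "'a set"
  assumes ideal: "lie_ideal L I"
begin

lemma subspace_ideal: "subspace I"
  using ideal unfolding lie_ideal_def by auto

lemma ideal_closed: "I \<subseteq> carrier L"
  using subspaceD(1)[OF subspace_ideal] .

lemma ideal_bracket_right: "x \<in> carrier L \<Longrightarrow> y \<in> I \<Longrightarrow> x \<otimes> y \<in> I"
  using ideal unfolding lie_ideal_def by auto

lemma ideal_bracket_left:
  assumes "x \<in> I" "y \<in> carrier L"
  shows "x \<otimes> y \<in> I"
  using assms ideal_closed bracket_anti[of x y] ideal_bracket_right[of y x]
    submoduleE(3)[OF subspace_ideal] by auto

sublocale abelian_subgroup I L
  using subspace_ideal
  by (intro abelian_subgroupI3 additive_subgroup.intro M.abelian_group_axioms)
    (auto dest: submodule.axioms(1))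

lemma coset_eq_iff:
  assumes x: "x \<in> carrier L" and y: "y \<in> carrier L"
  shows "I +> x = I +> y \<longleftrightarrow> x \<ominus> y \<in> I"
proof -
  have "I +> x = I +> y \<longleftrightarrow> x \<in> I +> y"
    using a_rcos_self[OF x] a_repr_independence[OF _ y a_subgroup, of x] by metis
  also have "\<dots> \<longleftrightarrow> x \<ominus> y \<in> I"
  proof
    assume "x \<in> I +> y"
    then obtain i where i: "i \<in> I" "x = i \<oplus> y" by (auto simp: a_r_coset_def')
    then have "x \<ominus> y = i"
      using y ideal_closed by (auto simp: M.minus_eq M.a_assoc M.r_neg subset_eq)
    then show "x \<ominus> y \<in> I" using i by simp
  next
    assume "x \<ominus> y \<in> I"
    moreover have "x = (x \<ominus> y) \<oplus> y"
      using x y by (simp add: M.minus_eq M.a_assoc M.l_neg)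
    ultimately show "x \<in> I +> y" by (auto simp: a_r_coset_def')
  qed
  finally show ?thesis .
qed

lemma carrier_quot: "carrier (lie_quot L I) = (\<lambda>x. I +> x) ` carrier L"
  by (auto simp: lie_quot_def FactRing_def A_RCOSETS_def' ring.extend_def)

lemma zero_quot: "\<zero>\<^bsub>lie_quot L I\<^esub> = I"
  by (simp add: lie_quot_def FactRing_def ring.extend_def)

lemma coset_zero: "I +> \<zero> = I"
  using a_coset_join2[OF M.zero_closed a_subgroup] subspaceD(2)[OF subspace_ideal] by simp

lemma add_quot:
  "x \<in> carrier L \<Longrightarrow> y \<in> carrier L \<Longrightarrow> (I +> x) \<oplus>\<^bsub>lie_quot L I\<^esub> (I +> y) = I +> (x \<oplus> y)"
  by (simp add: lie_quot_def FactRing_def ring.extend_def a_rcos_sum)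

lemma mem_cosetD:
  assumes "a \<in> I +> x" "x \<in> carrier L"
  shows "a \<in> carrier L" "a \<ominus> x \<in> I"
proof -
  show a: "a \<in> carrier L" using assms ideal_closed by (auto simp: a_r_coset_def')
  have "I +> x = I +> a" by (rule a_repr_independence[OF assms a_subgroup])
  then show "a \<ominus> x \<in> I" using coset_eq_iff[OF a assms(2)] by simp
qed

text \<open>The library product of two cosets is the union of the cosets of
  \<open>a \<otimes> b\<close> over all representatives. It collapses to one coset because these all
  coincide.\<close>

lemma bracket_quot:
  assumes "x \<in> carrier L" "y \<in> carrier L"
  shows "(I +> x) \<otimes>\<^bsub>lie_quot L I\<^esub> (I +> y) = I +> (x \<otimes> y)"
proof -
  have "I +> a \<otimes> b = I +> x \<otimes> y" if "a \<in> I +> x" "b \<in> I +> y" for a b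
  proof -
    note a = mem_cosetD[OF that(1) assms(1)] and b = mem_cosetD[OF that(2) assms(2)]
    have "a \<otimes> b \<ominus> x \<otimes> y \<in> I"
      unfolding bracket_diff[OF a(1) b(1) assms]
      using a b assms subspaceD(3)[OF subspace_ideal] ideal_bracket_left ideal_bracket_right
      by auto
    then show ?thesis using a b assms by (subst coset_eq_iff) (auto intro: bracket_closed)
  qed
  then have "rcoset_mult L I (I +> x) (I +> y) = I +> (x \<otimes> y)"
    unfolding rcoset_mult_def using a_rcos_self[OF assms(1)] a_rcos_self[OF assms(2)] by blast
  then show ?thesis by (simp add: lie_quot_def FactRing_def ring.extend_def)
qed

lemma scale_quot:
  assumes x: "x \<in> carrier L"
  shows "c \<odot>\<^bsub>lie_quot L I\<^esub> (I +> x) = I +> (c \<odot> x)"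
proof -
  have "I +> c \<odot> a = I +> c \<odot> x" if "a \<in> I +> x" for a
  proof -
    note a = mem_cosetD[OF that x]
    have "c \<odot> a \<ominus> c \<odot> x = c \<odot> (a \<ominus> x)"
      using a x by (simp add: M.minus_eq scale_add_right scale_minus_right)
    also have "\<dots> \<in> I" using a subspaceD(4)[OF subspace_ideal] by auto
    finally show ?thesis using a x by (subst coset_eq_iff) auto
  qed
  then have "(\<Union>a\<in>I +> x. I +> (c \<odot> a)) = I +> (c \<odot> x)"
    using a_rcos_self[OF x] by blast
  then show ?thesis by (simp add: lie_quot_def module.fields_def ring.extend_def)
qed

lemma lie_algebra_quot: "lie_algebra (lie_quot L I)"
proof (rule lie_algebra_hom_image[OF lie_algebra_axioms carrier_quot])
  show "I +> \<zero> = \<zero>\<^bsub>lie_quot L I\<^esub>" using coset_zero zero_quot by simp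
qed (auto simp: add_quot bracket_quot scale_quot)

end

section \<open>Invariant forms and their radicals\<close>

lemma invariant_symmetric_formD:
  assumes "invariant_symmetric_form L f" "x \<in> carrier L" "y \<in> carrier L"
  shows "z \<in> carrier L \<Longrightarrow> f (x \<oplus>\<^bsub>L\<^esub> y) z = f x z + f y z"
    "f (c \<odot>\<^bsub>L\<^esub> x) y = c * f x y" "f x y = f y x"
    "z \<in> carrier L \<Longrightarrow> f (x \<otimes>\<^bsub>L\<^esub> y) z = f x (y \<otimes>\<^bsub>L\<^esub> z)"
  using assms unfolding invariant_symmetric_form_def by auto

definition form_radical :: "(complex, 'a) module \<Rightarrow> ('a \<Rightarrow> 'a \<Rightarrow> complex) \<Rightarrow> 'a set" where
  "form_radical L f = {x \<in> carrier L. \<forall>y\<in>carrier L. f x y = 0}"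

text \<open>Evaluated at chosen representatives, so the value is meaningful only when the choice
  does not matter; \<open>quot_form_coset\<close> shows this for \<open>I\<close> the radical of the
  form.\<close>

definition quot_form ::
    "(complex, 'a) module \<Rightarrow> 'a set \<Rightarrow> ('a \<Rightarrow> 'a \<Rightarrow> complex) \<Rightarrow> 'a set \<Rightarrow> 'a set \<Rightarrow> complex" where
  "quot_form L I f A C =
     (let rep = \<lambda>A. SOME a. a \<in> carrier L \<and> I +>\<^bsub>L\<^esub> a = A in f (rep A) (rep C))"

context lie_algebra
begin

lemma form_add_right:
  assumes "invariant_symmetric_form L f" "x \<in> carrier L" "y \<in> carrier L" "z \<in> carrier L"
  shows "f x (y \<oplus> z) = f x y + f x z"
  using assms invariant_symmetric_formD(1)[OF assms(1), of y z x]
    invariant_symmetric_formD(3)[OF assms(1)] by simp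

lemma form_scale_right:
  assumes "invariant_symmetric_form L f" "x \<in> carrier L" "y \<in> carrier L"
  shows "f x (c \<odot> y) = c * f x y"
  using assms invariant_symmetric_formD(2)[OF assms(1), of y x c]
    invariant_symmetric_formD(3)[OF assms(1)] by simp

lemma form_zero [simp]:
  assumes "invariant_symmetric_form L f" "x \<in> carrier L"
  shows "f \<zero> x = 0" "f x \<zero> = 0"
proof -
  show "f \<zero> x = 0" using invariant_symmetric_formD(2)[OF assms(1) assms(2) assms(2), of 0]
    assms(2) by simp
  then show "f x \<zero> = 0" using invariant_symmetric_formD(3)[OF assms(1)] assms(2) by simp
qed

text \<open>Invariance moves the bracket to the other argument: f([y, x], z) = f(y, [x, z]), which
  is 0 for y in the radical.\<close>

lemma lie_ideal_form_radical:
  assumes "invariant_symmetric_form L f"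
  shows "lie_ideal L (form_radical L f)"
  unfolding lie_ideal_def
proof (intro conjI ballI)
  note [simp] = invariant_symmetric_formD(1,2)[OF assms] form_zero[OF assms]
  show "subspace (form_radical L f)"
    by (rule subspaceI) (auto simp: form_radical_def)
  fix x y assume x: "x \<in> carrier L" and y: "y \<in> form_radical L f"
  then have yc: "y \<in> carrier L" by (simp add: form_radical_def)
  have "f (x \<otimes> y) z = 0" if z: "z \<in> carrier L" for z
  proof -
    have "f (x \<otimes> y) z = (-1) * f (y \<otimes> x) z"
      using x yc z bracket_anti[OF x yc] invariant_symmetric_formD(2)[OF assms, of "y \<otimes> x" z "-1"]
      by (simp add: scale_minus_one bracket_closed)
    also have "f (y \<otimes> x) z = f y (x \<otimes> z)"
      by (rule invariant_symmetric_formD(4)[OF assms yc x z])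
    finally show ?thesis using y x z bracket_closed by (auto simp: form_radical_def)
  qed
  then show "x \<otimes> y \<in> form_radical L f"
    using x yc by (auto simp: form_radical_def bracket_closed)
qed

end

lemma (in lie_quotient) quot_form_coset:
  assumes f: "invariant_symmetric_form L f" and I: "I = form_radical L f"
    and x: "x \<in> carrier L" and y: "y \<in> carrier L"
  shows "quot_form L I f (I +> x) (I +> y) = f x y"
proof -
  define rep where "rep A = (SOME a. a \<in> carrier L \<and> I +> a = A)" for A
  have rep: "rep (I +> a) \<in> carrier L" "rep (I +> a) \<ominus> a \<in> I" if "a \<in> carrier L" for a
  proof -
    have "rep (I +> a) \<in> carrier L \<and> I +> rep (I +> a) = I +> a"
      unfolding rep_def by (rule someI[of _ a]) (use that in auto)
    then show "rep (I +> a) \<in> carrier L" "rep (I +> a) \<ominus> a \<in> I"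
      using that coset_eq_iff[of "rep (I +> a)" a] by auto
  qed
  have eq: "f (rep (I +> a)) b = f a b" if "a \<in> carrier L" "b \<in> carrier L" for a b
  proof -
    have radical: "f i b = 0" if "i \<in> I" for i
      using that \<open>b \<in> carrier L\<close> unfolding I form_radical_def by blast
    have "0 = f (rep (I +> a) \<ominus> a) b"
      using radical[OF rep(2)[OF that(1)]] by simp
    also have "\<dots> = f (rep (I +> a)) b + f ((-1) \<odot> a) b"
      unfolding M.minus_eq scale_minus_one[OF that(1), symmetric]
      using rep[OF that(1)] that by (intro invariant_symmetric_formD(1)[OF f]) auto
    also have "f ((-1) \<odot> a) b = - f a b"
      using that by (subst invariant_symmetric_formD(2)[OF f]) auto
    finally show ?thesis by simp
  qed
  have "quot_form L I f (I +> x) (I +> y) = f (rep (I +> x)) (rep (I +> y))"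
    unfolding quot_form_def rep_def Let_def ..
  also have "\<dots> = f (rep (I +> y)) x"
    using eq[OF x, of "rep (I +> y)"] rep[OF y] invariant_symmetric_formD(3)[OF f x] by simp
  also have "\<dots> = f x y" using eq[OF y x] invariant_symmetric_formD(3)[OF f x y] by simp
  finally show ?thesis .
qed

lemma (in lie_quotient) quot_form_nondegenerate:
  assumes f: "invariant_symmetric_form L f" and I: "I = form_radical L f"
  shows "invariant_symmetric_form (lie_quot L I) (quot_form L I f)"
    "nondegenerate_on (lie_quot L I) (carrier (lie_quot L I)) (quot_form L I f)"
proof -
  note [simp] = quot_form_coset[OF f I] add_quot scale_quot bracket_quot
  show "invariant_symmetric_form (lie_quot L I) (quot_form L I f)"
    unfolding invariant_symmetric_form_def carrier_quot
    unfolding invariant_symmetric_form_def carrier_quot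
    by (intro conjI allI ballI; elim imageE;
        simp add: bracket_closed invariant_symmetric_formD(1,2,4)[OF f];
        rule invariant_symmetric_formD(3)[OF f]; assumption)
  show "nondegenerate_on (lie_quot L I) (carrier (lie_quot L I)) (quot_form L I f)"
    unfolding nondegenerate_on_def carrier_quot zero_quot
  proof (clarsimp)
    fix x assume x: "x \<in> carrier L" "\<forall>y\<in>carrier L. f x y = 0"
    then have "x \<in> I" unfolding I form_radical_def by blast
    then show "I +> x = I" using a_coset_join2[OF x(1) a_subgroup] by simp
  qed
qed

section \<open>Root spaces of a Lie algebra with an invariant form\<close>

text \<open>Neither finite dimension nor simplicity is assumed, because the locale serves twice: for
  the simple algebra with its Cartan subalgebra, and for \<tau> with H and an arbitrary
  form.\<close>

locale split_quadratic_lie_algebra = lie_algebra L for L :: "(complex, 'a) module" (structure) +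
  fixes H :: "'a set" and f :: "'a \<Rightarrow> 'a \<Rightarrow> complex"
  assumes form: "invariant_symmetric_form L f" "nondegenerate_on L (carrier L) f"
    and subalgebra: "lie_subalgebra L H"
    and abelian: "abelian_on L H"
    and self_centralizing: "self_centralizing L H"
    and diagonalizable: "ad_diagonalizable L H"
begin

lemma H_closed: "t \<in> H \<Longrightarrow> t \<in> carrier L"
  using subspaceD(1)[OF lie_subalgebraD(1)[OF subalgebra]] by auto

lemmas H_subspace = subspaceD[OF lie_subalgebraD(1)[OF subalgebra]]

lemma root_spaceD:
  assumes "x \<in> root_space L H \<alpha>"
  shows "x \<in> carrier L" "t \<in> H \<Longrightarrow> t \<otimes> x = \<alpha> t \<odot> x"
  using assms unfolding root_space_def by auto

lemma root_space_subspace: "subspace (root_space L H \<alpha>)"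
  by (rule subspaceI)
    (auto simp: root_space_def H_closed bracket_add_right bracket_smult_right scale_add_right
      mult.commute)

lemmas root_space_closed = subspaceD[OF root_space_subspace]

lemma root_space_cong: "(\<And>t. t \<in> H \<Longrightarrow> \<alpha> t = \<beta> t) \<Longrightarrow> root_space L H \<alpha> = root_space L H \<beta>"
  unfolding root_space_def by auto

lemma bracket_root_space:
  assumes x: "x \<in> root_space L H \<alpha>" and y: "y \<in> root_space L H \<beta>"
  shows "x \<otimes> y \<in> root_space L H (\<lambda>t. \<alpha> t + \<beta> t)"
proof -
  have "t \<otimes> (x \<otimes> y) = (\<alpha> t + \<beta> t) \<odot> (x \<otimes> y)" if t: "t \<in> H" for t
    using leibniz[OF H_closed[OF t] root_spaceD(1)[OF x] root_spaceD(1)[OF y]]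
      root_spaceD[OF x] root_spaceD[OF y] t
    by (simp add: bracket_smult_left bracket_smult_right scale_add_left bracket_closed)
  then show ?thesis
    using root_spaceD(1)[OF x] root_spaceD(1)[OF y] by (simp add: root_space_def bracket_closed)
qed

text \<open>Self-centralization says precisely that the weight space of weight 0 is
  \<open>H\<close>.\<close>

lemma root_space_zero: "(\<And>t. t \<in> H \<Longrightarrow> \<alpha> t = 0) \<Longrightarrow> root_space L H \<alpha> = H"
proof -
  assume "\<And>t. t \<in> H \<Longrightarrow> \<alpha> t = 0"
  then have "root_space L H \<alpha> = {x \<in> carrier L. \<forall>t\<in>H. t \<otimes> x = \<zero>}"
    unfolding root_space_def by auto
  then show ?thesis using self_centralizing unfolding self_centralizing_def by simp
qed

lemma H_subset_root_space: "H \<subseteq> root_space L H (\<lambda>_. 0)"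
  by (simp add: root_space_zero)

text \<open>Takes the place of a decomposition into weight components: a linear condition need only
  be checked on weight vectors.\<close>

lemma root_space_induct:
  assumes "subspace V" "\<And>\<alpha>. \<alpha> \<in> dual L H \<Longrightarrow> root_space L H \<alpha> \<subseteq> V"
  shows "carrier L \<subseteq> V"
  using diagonalizable lin_span_minimal[OF assms(1), of "\<Union>\<alpha>\<in>dual L H. root_space L H \<alpha>"] assms(2)
  unfolding ad_diagonalizable_def by auto

lemma dual_zero: "(\<lambda>_. 0) \<in> dual L H"
  by (simp add: dual_def)

lemma dual_add: "\<alpha> \<in> dual L H \<Longrightarrow> \<beta> \<in> dual L H \<Longrightarrow> (\<lambda>t. \<alpha> t + \<beta> t) \<in> dual L H"
  by (simp add: dual_def algebra_simps)

lemma dual_scale: "\<alpha> \<in> dual L H \<Longrightarrow> (\<lambda>t. c * \<alpha> t) \<in> dual L H"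
  by (simp add: dual_def algebra_simps)

lemma dual_uminus: "\<alpha> \<in> dual L H \<Longrightarrow> (\<lambda>t. - \<alpha> t) \<in> dual L H"
  by (simp add: dual_def algebra_simps)

lemma dual_eqI: "\<alpha> \<in> dual L H \<Longrightarrow> \<beta> \<in> dual L H \<Longrightarrow> (\<And>t. t \<in> H \<Longrightarrow> \<alpha> t = \<beta> t) \<Longrightarrow> \<alpha> = \<beta>"
  unfolding dual_def by (rule ext) (metis (mono_tags, lifting) mem_Collect_eq)

lemma rootI: "\<alpha> \<in> dual L H \<Longrightarrow> x \<in> root_space L H \<alpha> \<Longrightarrow> x \<noteq> \<zero> \<Longrightarrow> \<alpha> \<in> roots L H"
  unfolding roots_def by auto

lemma rootE:
  assumes "\<alpha> \<in> roots L H"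
  obtains x where "\<alpha> \<in> dual L H" "x \<in> root_space L H \<alpha>" "x \<noteq> \<zero>"
proof -
  have "\<zero> \<in> root_space L H \<alpha>" using root_space_closed(2) .
  then show thesis using assms that unfolding roots_def by blast
qed

lemmas form_add_left = invariant_symmetric_formD(1)[OF form(1)]
lemmas form_scale_left = invariant_symmetric_formD(2)[OF form(1)]
lemmas form_sym = invariant_symmetric_formD(3)[OF form(1)]
lemmas form_invariant = invariant_symmetric_formD(4)[OF form(1)]
lemmas form_simps = form_add_left form_scale_left form_add_right[OF form(1)]
  form_scale_right[OF form(1)] form_zero[OF form(1)]

text \<open>Invariance under t in \<open>H\<close> gives (\<alpha> t + \<beta> t) f(x, y) =
  0.\<close>

lemma form_root_spaces:
  assumes x: "x \<in> root_space L H \<alpha>" and y: "y \<in> root_space L H \<beta>" and nz: "f x y \<noteq> 0"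
    and t: "t \<in> H"
  shows "\<beta> t = - \<alpha> t"
proof -
  note c = root_spaceD(1)[OF x] root_spaceD(1)[OF y] H_closed[OF t]
  have "\<alpha> t * f x y = f (t \<otimes> x) y"
    using root_spaceD(2)[OF x t] c by (simp add: form_scale_left)
  also have "\<dots> = f (x \<otimes> ((-1) \<odot> t)) y"
    using c bracket_anti[of t x] by (simp add: scale_minus_one bracket_minus_right)
  also have "\<dots> = f x ((-1) \<odot> (t \<otimes> y))"
    using c by (simp add: form_invariant bracket_smult_left)
  also have "\<dots> = - \<beta> t * f x y"
    using c root_spaceD(2)[OF y t] by (simp add: form_simps)
  finally have "(\<alpha> t + \<beta> t) * f x y = 0" by (simp add: algebra_simps)
  then show ?thesis using nz by (simp add: eq_neg_iff_add_eq_0 add.commute)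
qed

text \<open>Weight vectors span, so by nondegeneracy one of them pairs nontrivially with x, and by
  \<open>form_root_spaces\<close> its weight is -\<alpha> on \<open>H\<close>.\<close>

lemma exists_dual_root_vector:
  assumes x: "x \<in> root_space L H \<alpha>" "x \<noteq> \<zero>"
  obtains y where "y \<in> root_space L H (\<lambda>t. - \<alpha> t)" "f x y \<noteq> 0"
proof -
  note xc = root_spaceD(1)[OF x(1)]
  have "\<exists>\<beta>\<in>dual L H. \<exists>y\<in>root_space L H \<beta>. f x y \<noteq> 0"
  proof (rule ccontr)
    assume *: "\<not> ?thesis"
    have "carrier L \<subseteq> {y \<in> carrier L. f x y = 0}"
    proof (rule root_space_induct)
      show "subspace {y \<in> carrier L. f x y = 0}"
        using xc by (intro subspaceI) (auto simp: form_simps)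
    qed (use * in \<open>auto simp: root_spaceD(1)\<close>)
    then have "x = \<zero>" using form(2) xc unfolding nondegenerate_on_def by blast
    with x(2) show False by simp
  qed
  then obtain \<beta> y where y: "y \<in> root_space L H \<beta>" "f x y \<noteq> 0" by auto
  have "root_space L H \<beta> = root_space L H (\<lambda>t. - \<alpha> t)"
    using form_root_spaces[OF x(1) y] by (intro root_space_cong) auto
  with y show thesis by (intro that[of y]) auto
qed

lemma form_nondegenerate_on_H:
  assumes t: "t \<in> H" and orth: "\<And>s. s \<in> H \<Longrightarrow> f t s = 0"
  shows "t = \<zero>"
proof (rule ccontr)
  assume "t \<noteq> \<zero>"
  moreover have "t \<in> root_space L H (\<lambda>_. 0)" using t H_subset_root_space by auto
  ultimately obtain y where "y \<in> root_space L H (\<lambda>_. - 0)" "f t y \<noteq> 0"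
    using exists_dual_root_vector by blast
  then show False using orth by (simp add: root_space_zero)
qed

lemma bracket_opposite_in_H:
  "x \<in> root_space L H \<alpha> \<Longrightarrow> y \<in> root_space L H (\<lambda>t. - \<alpha> t) \<Longrightarrow> x \<otimes> y \<in> H"
  using bracket_root_space[of x \<alpha> y "\<lambda>t. - \<alpha> t"] by (simp add: root_space_zero)

text \<open>This is [x, y] = f(x, y) \<open>t\<^sub>\<alpha>\<close> tested against
  \<open>H\<close>, stated before \<open>t\<^sub>\<alpha>\<close> is known to exist.\<close>

lemma form_bracket_opposite:
  assumes x: "x \<in> root_space L H \<alpha>" and y: "y \<in> root_space L H (\<lambda>t. - \<alpha> t)" and t: "t \<in> H"
  shows "f (x \<otimes> y) t = \<alpha> t * f x y"
proof -
  note c = root_spaceD(1)[OF x] root_spaceD(1)[OF y] H_closed[OF t]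
  have "f (x \<otimes> y) t = f t (x \<otimes> y)" using c by (simp add: form_sym bracket_closed)
  also have "\<dots> = f (t \<otimes> x) y" using c by (simp add: form_invariant)
  finally show ?thesis using c root_spaceD(2)[OF x t] by (simp add: form_scale_left)
qed

lemma dual_rep_eqI:
  assumes "t \<in> H" "\<And>s. s \<in> H \<Longrightarrow> f t s = \<alpha> s"
  shows "dual_rep H f \<alpha> = t"
  unfolding dual_rep_def
proof (rule the_equality)
  fix u assume u: "u \<in> H \<and> (\<forall>s\<in>H. f u s = \<alpha> s)"
  have "u \<oplus> (-1) \<odot> t = \<zero>"
    using u assms by (intro form_nondegenerate_on_H) (auto simp: H_subspace form_simps H_closed)
  then have "t \<oplus> (u \<ominus> t) = t"
    using u assms by (simp add: scale_minus_one H_closed flip: M.minus_eq)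
  then show "u = t"
    using u assms by (simp add: M.minus_eq H_closed M.a_lcomm[of t u] M.r_neg)
qed (use assms in auto)

text \<open>\<open>dual_rep\<close> is a definite description, so existence has to be shown.
  \<open>H\<close> is not assumed finite dimensional here; instead the bracket of opposite root
  vectors with f(x, y) \<noteq> 0, rescaled, represents \<alpha>.\<close>

lemma dual_rep_root:
  assumes "\<alpha> \<in> roots L H"
  shows "dual_rep H f \<alpha> \<in> H" "s \<in> H \<Longrightarrow> f (dual_rep H f \<alpha>) s = \<alpha> s"
proof -
  from assms obtain x where x: "x \<in> root_space L H \<alpha>" "x \<noteq> \<zero>" by (rule rootE)
  then obtain y where y: "y \<in> root_space L H (\<lambda>t. - \<alpha> t)" "f x y \<noteq> 0"
    by (rule exists_dual_root_vector)
  define t where "t = (1 / f x y) \<odot> (x \<otimes> y)"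
  have t: "t \<in> H" unfolding t_def by (intro H_subspace(4) bracket_opposite_in_H[OF x(1) y(1)])
  have ft: "f t s = \<alpha> s" if "s \<in> H" for s
    unfolding t_def using that y(2) bracket_opposite_in_H[OF x(1) y(1)]
    by (simp add: form_scale_left H_closed form_bracket_opposite[OF x(1) y(1)])
  show "dual_rep H f \<alpha> \<in> H" "s \<in> H \<Longrightarrow> f (dual_rep H f \<alpha>) s = \<alpha> s"
    using dual_rep_eqI[OF t ft] t ft by auto
qed

text \<open>No nonvanishing of f(x, y) is required: if it is 0, then [x, y] is orthogonal to
  \<open>H\<close> and hence 0. Later the formula is also read backwards, to conclude that a form
  vanishes on a given pair.\<close>

lemma dual_form_bracket:
  assumes \<alpha>: "\<alpha> \<in> roots L H" and \<beta>: "\<beta> \<in> roots L H"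
    and x: "x \<in> root_space L H \<alpha>" and y: "y \<in> root_space L H (\<lambda>t. - \<alpha> t)"
  shows "\<beta> (x \<otimes> y) = f x y * dual_form H f \<alpha> \<beta>"
proof -
  note b = bracket_opposite_in_H[OF x y]
  have "\<beta> (x \<otimes> y) = f (x \<otimes> y) (dual_rep H f \<beta>)"
    using dual_rep_root[OF \<beta>] b form_sym[OF H_closed[OF b] H_closed[OF dual_rep_root(1)[OF \<beta>]]]
    by simp
  also have "\<dots> = f x y * dual_form H f \<alpha> \<beta>"
    using form_bracket_opposite[OF x y dual_rep_root(1)[OF \<beta>]]
      dual_rep_root(2)[OF \<alpha> dual_rep_root(1)[OF \<beta>]] by (simp add: dual_form_def)
  finally show ?thesis .
qed

lemma dual_form_sym:
  "\<alpha> \<in> roots L H \<Longrightarrow> \<beta> \<in> roots L H \<Longrightarrow> dual_form H f \<alpha> \<beta> = dual_form H f \<beta> \<alpha>"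
  unfolding dual_form_def using dual_rep_root(1) by (auto intro!: form_sym H_closed)

text \<open>The sum is required to be a root because \<open>dual_rep\<close> is controlled only on
  roots. Then the claim is evaluation of a sum of functionals at the vector representing
  \<gamma>.\<close>

lemma dual_form_add_left:
  assumes "\<alpha> \<in> roots L H" "\<beta> \<in> roots L H" "(\<lambda>t. \<alpha> t + \<beta> t) \<in> roots L H" "\<gamma> \<in> roots L H"
  shows "dual_form H f (\<lambda>t. \<alpha> t + \<beta> t) \<gamma> = dual_form H f \<alpha> \<gamma> + dual_form H f \<beta> \<gamma>"
  unfolding dual_form_def using assms by (simp add: dual_rep_root)

lemma uminus_root: "\<alpha> \<in> roots L H \<Longrightarrow> (\<lambda>t. - \<alpha> t) \<in> roots L H"
proof -
  assume "\<alpha> \<in> roots L H"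
  then obtain x where x: "\<alpha> \<in> dual L H" "x \<in> root_space L H \<alpha>" "x \<noteq> \<zero>" by (rule rootE)
  then obtain y where y: "y \<in> root_space L H (\<lambda>t. - \<alpha> t)" "f x y \<noteq> 0"
    by (metis exists_dual_root_vector)
  then have "y \<noteq> \<zero>" using root_spaceD(1)[OF x(2)] by (auto simp: form_simps)
  then show ?thesis using y(1) dual_uminus[OF x(1)] by (intro rootI)
qed

lemma nonisotropic_roots_iff:
  "\<alpha> \<in> nonisotropic_roots L H f \<longleftrightarrow> \<alpha> \<in> roots L H \<and>
     (\<exists>x\<in>root_space L H \<alpha>. \<exists>y\<in>root_space L H (\<lambda>t. - \<alpha> t). \<alpha> (x \<otimes> y) \<noteq> 0)"
proof -
  have "(\<exists>x\<in>root_space L H \<alpha>. \<exists>y\<in>root_space L H (\<lambda>t. - \<alpha> t). \<alpha> (x \<otimes> y) \<noteq> 0)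
      \<longleftrightarrow> dual_form H f \<alpha> \<alpha> \<noteq> 0" if \<alpha>: "\<alpha> \<in> roots L H"
  proof
    assume nz: "dual_form H f \<alpha> \<alpha> \<noteq> 0"
    obtain x where x: "x \<in> root_space L H \<alpha>" "x \<noteq> \<zero>" using rootE[OF \<alpha>] by metis
    then obtain y where y: "y \<in> root_space L H (\<lambda>t. - \<alpha> t)" "f x y \<noteq> 0"
      by (rule exists_dual_root_vector)
    then show "\<exists>x\<in>root_space L H \<alpha>. \<exists>y\<in>root_space L H (\<lambda>t. - \<alpha> t). \<alpha> (x \<otimes> y) \<noteq> 0"
      using dual_form_bracket[OF \<alpha> \<alpha> x(1) y(1)] nz x(1) by (intro bexI[of _ x] bexI[of _ y]) auto
  qed (auto simp: dual_form_bracket[OF \<alpha> \<alpha>])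
  then show ?thesis unfolding nonisotropic_roots_def by auto
qed

lemma ad_power_root_space:
  assumes x: "x \<in> root_space L H \<alpha>" and y: "y \<in> root_space L H \<beta>"
  shows "((\<lambda>z. x \<otimes> z) ^^ n) y \<in> root_space L H (\<lambda>t. \<beta> t + of_nat n * \<alpha> t)"
proof (induction n)
  case (Suc n)
  show ?case
    using bracket_root_space[OF x Suc] by (simp add: algebra_simps)
qed (use y in simp)

text \<open>The vectors killed by some power of \<open>ad x\<close> form a subspace, since exponents
  m and n for two vectors give m + n for their sum. So weight vectors suffice.\<close>

lemma ad_locally_nilpotentI:
  assumes x: "x \<in> carrier L"
    and nil: "\<And>\<beta> y. \<beta> \<in> dual L H \<Longrightarrow> y \<in> root_space L H \<beta> \<Longrightarrow> \<exists>n. ((\<lambda>z. x \<otimes> z) ^^ n) y = \<zero>"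
    and y: "y \<in> carrier L"
  shows "\<exists>n. ((\<lambda>z. x \<otimes> z) ^^ n) y = \<zero>"
proof -
  let ?ad = "\<lambda>z. x \<otimes> z"
  let ?V = "{y \<in> carrier L. \<exists>n. (?ad ^^ n) y = \<zero>}"
  have cl: "(?ad ^^ n) y \<in> carrier L" if "y \<in> carrier L" for n y
    by (induction n) (use x that in \<open>auto intro: bracket_closed\<close>)
  have zero: "(?ad ^^ n) \<zero> = \<zero>" for n
    by (induction n) (use x in auto)
  have add: "(?ad ^^ n) (y \<oplus> z) = (?ad ^^ n) y \<oplus> (?ad ^^ n) z"
    if "y \<in> carrier L" "z \<in> carrier L" for n y z
    by (induction n) (use x that cl in \<open>auto simp: bracket_add_right\<close>)
  have scale: "(?ad ^^ n) (c \<odot> y) = c \<odot> (?ad ^^ n) y" if "y \<in> carrier L" for n c y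
    by (induction n) (use x that cl in \<open>auto simp: bracket_smult_right\<close>)
  have mono: "(?ad ^^ (m + n)) y = \<zero>" if "(?ad ^^ n) y = \<zero>" for m n y
    using that zero[of m] by (simp add: funpow_add)
  have "carrier L \<subseteq> ?V"
  proof (rule root_space_induct)
    show "subspace ?V"
    proof (rule subspaceI)
      fix y z assume "y \<in> ?V"
        "z \<in> ?V"
      then obtain m n where mn: "y \<in> carrier L" "z \<in> carrier L" "(?ad ^^ m) y = \<zero>"
        "(?ad ^^ n) z = \<zero>"
        by auto
      then have "(?ad ^^ (m + n)) (y \<oplus> z) = \<zero>"
        using mono[OF mn(4), of m] mono[OF mn(3), of n] by (simp add: add add.commute)
      then show "y \<oplus> z \<in> ?V" using mn by blast
    next
      fix c y assume "y \<in> ?V"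
      then obtain n where "y \<in> carrier L" "(?ad ^^ n) y = \<zero>" by auto
      then show "c \<odot> y \<in> ?V"
        by (auto simp: scale intro!: exI[of _ n])
    qed (use zero in auto)
  qed (use nil in \<open>auto simp: root_spaceD(1)\<close>)
  then show ?thesis using y by auto
qed

end


section \<open>Root systems of simple Lie algebras\<close>

locale simple_split_lie_algebra = split_quadratic_lie_algebra +
  assumes simple: "simple_lie_algebra L" and finite_dim: "finite_dimensional L (carrier L)"
begin

text \<open>The centre is an ideal, and it is proper because some bracket is nonzero.\<close>

lemma center_trivial:
  assumes x: "x \<in> carrier L" "\<And>y. y \<in> carrier L \<Longrightarrow> x \<otimes> y = \<zero>"
  shows "x = \<zero>"
proof -
  let ?Z = "{x \<in> carrier L. \<forall>y\<in>carrier L. x \<otimes> y = \<zero>}"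
  have "lie_ideal L ?Z"
    unfolding lie_ideal_def
  proof (intro conjI ballI)
    show "subspace ?Z" using lie_subalgebraD(1)[OF lie_subalgebra_centralizer[of "carrier L"]]
      by simp
    fix x y assume "x \<in> carrier L" "y \<in> ?Z"
    then have "x \<otimes> y = \<zero>" by (auto intro: bracket_eq_zero_sym)
    then show "x \<otimes> y \<in> ?Z" by auto
  qed
  moreover have "?Z \<noteq> carrier L" using simple unfolding simple_lie_algebra_def by blast
  ultimately have "?Z = {\<zero>}" using simple unfolding simple_lie_algebra_def by blast
  then show ?thesis using x by auto
qed

lemma nonzero_element: "\<exists>x\<in>carrier L. x \<noteq> \<zero>"
  using simple unfolding simple_lie_algebra_def by (metis bracket_closed)

text \<open>Each vector of a finite spanning set needs only finitely many weight spaces, so a finite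
  set \<open>G\<close> of weights spans \<open>L\<close>. Nondegeneracy then forces every root to be
  the negative of a weight in \<open>G\<close>. This avoids the linear independence of weight
  spaces.\<close>

lemma finite_roots: "finite (roots L H)"
proof -
  define U where "U F = (\<Union>\<alpha>\<in>F. root_space L H \<alpha>)" for F
  have Uc: "U F \<subseteq> carrier L" for F
    unfolding U_def using root_spaceD(1) by auto
  obtain S where S: "finite S" "S \<subseteq> carrier L" "lin_span L S = carrier L"
    using finite_dim unfolding finite_dimensional_def has_dim_def by auto
  let ?V = "{x \<in> carrier L. \<exists>F. finite F \<and> x \<in> lin_span L (U F)}"
  have "carrier L \<subseteq> ?V"
  proof (rule root_space_induct)
    show "subspace ?V"
    proof (rule subspaceI)
      have "lin_span L (U {}) = {\<zero>}" by (simp add: U_def lin_span_empty)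
      then show "\<zero> \<in> ?V" by auto
    next
      fix x y assume "x \<in> ?V" "y \<in> ?V"
      then obtain F G where "finite F" "finite G" "x \<in> lin_span L (U F)" "y \<in> lin_span L (U G)"
        "x \<in> carrier L" "y \<in> carrier L" by auto
      moreover have "lin_span L (U F) \<subseteq> lin_span L (U (F \<union> G))"
        "lin_span L (U G) \<subseteq> lin_span L (U (F \<union> G))"
        by (rule lin_span_mono[OF _ Uc], force simp: U_def)+
      ultimately show "x \<oplus> y \<in> ?V"
        using subspaceD(3)[OF subspace_lin_span[OF Uc], of x "F \<union> G" y]
        by (auto intro!: exI[of _ "F \<union> G"])
    next
      fix c x assume "x \<in> ?V"
      then show "c \<odot> x \<in> ?V" using subspaceD(4)[OF subspace_lin_span[OF Uc]] by auto
    qed auto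
  next
    fix \<alpha>
    show "root_space L H \<alpha> \<subseteq> ?V"
      using lin_span_superset[of "U {\<alpha>}"] root_spaceD(1)
      by (auto intro!: exI[of _ "{\<alpha>}"] simp: U_def)
  qed
  then have "\<forall>x\<in>S. \<exists>F. finite F \<and> x \<in> lin_span L (U F)" using S(2) by auto
  then obtain F where F: "\<And>x. x \<in> S \<Longrightarrow> finite (F x)" "\<And>x. x \<in> S \<Longrightarrow> x \<in> lin_span L (U (F x))"
    by metis
  define G where "G = (\<Union>x\<in>S. F x)"
  have fin: "finite G" using F(1) S(1) by (auto simp: G_def)
  have "S \<subseteq> lin_span L (U G)"
  proof
    fix x assume x: "x \<in> S"
    have "lin_span L (U (F x)) \<subseteq> lin_span L (U G)"
      using Uc x by (intro lin_span_mono) (auto simp: U_def G_def)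
    then show "x \<in> lin_span L (U G)" using F(2)[OF x] by auto
  qed
  then have span: "carrier L \<subseteq> lin_span L (U G)"
    using lin_span_minimal[OF subspace_lin_span[OF Uc]] S(3) by metis
  \<comment> \<open>The negative is cut off to 0 outside \<open>H\<close>, as the convention for
    \<open>dual\<close> requires.\<close>
  have "roots L H \<subseteq> (\<lambda>\<beta> t. if t \<in> H then - \<beta> t else 0) ` G"
  proof
    fix \<alpha> assume "\<alpha> \<in> roots L H"
    then obtain x where x: "\<alpha> \<in> dual L H" "x \<in> root_space L H \<alpha>" "x \<noteq> \<zero>" by (rule rootE)
    note xc = root_spaceD(1)[OF x(2)]
    have "\<exists>y\<in>U G. f x y \<noteq> 0"
    proof (rule ccontr)
      assume *: "\<not> ?thesis"
      have "subspace {y \<in> carrier L. f x y = 0}"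
        using xc by (intro subspaceI) (auto simp: form_simps)
      then have "lin_span L (U G) \<subseteq> {y \<in> carrier L. f x y = 0}"
        using * Uc by (intro lin_span_minimal) auto
      then have "x = \<zero>" using form(2) xc span unfolding nondegenerate_on_def by blast
      with x(3) show False by simp
    qed
    then obtain \<beta> y where \<beta>: "\<beta> \<in> G" "y \<in> root_space L H \<beta>" "f x y \<noteq> 0" by (auto simp: U_def)
    have "\<alpha> = (\<lambda>t. if t \<in> H then - \<beta> t else 0)"
      using form_root_spaces[OF x(2) \<beta>(2,3)] x(1) by (auto simp: dual_def)
    then show "\<alpha> \<in> (\<lambda>\<beta> t. if t \<in> H then - \<beta> t else 0) ` G" using \<beta>(1) by auto
  qed
  then show ?thesis using fin finite_surj by blast
qed

lemma root_string_finite: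
  assumes "\<alpha> \<noteq> (\<lambda>_. 0)"
  shows "finite {n::int. (\<lambda>t. \<beta> t + of_int n * \<alpha> t) \<in> roots L H}"
proof (rule finite_imageD)
  obtain s where s: "\<alpha> s \<noteq> 0" using assms by auto
  let ?g = "\<lambda>(n::int) t. \<beta> t + of_int n * \<alpha> t"
  show "finite (?g ` {n. ?g n \<in> roots L H})"
    by (rule finite_subset[OF _ finite_roots]) auto
  show "inj_on ?g {n. ?g n \<in> roots L H}"
  proof (rule inj_onI)
    fix m n assume "?g m = ?g n"
    from fun_cong[OF this, of s] show "m = n" using s by simp
  qed
qed

text \<open>
  If \<open>\<alpha>\<close> were isotropic, then \<open>x\<close>, \<open>y\<close> and \<open>t = [x, y]\<close> would span a Heisenberg algebra.
  Its central element \<open>t\<close> acts on a root string by a scalar \<open>c\<close>, and the lowering argument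
  \<open>[x, y\<^sup>k\<^sup>+\<^sup>1 v] = (k + 1) c y\<^sup>k v\<close> on a highest vector \<open>v\<close> forces \<open>c = 0\<close>. Hence \<open>t\<close> is central in \<open>L\<close>.
\<close>

lemma nonzero_root_nonisotropic:
  assumes \<alpha>: "\<alpha> \<in> roots L H" "\<alpha> \<noteq> (\<lambda>_. 0)"
  shows "dual_form H f \<alpha> \<alpha> \<noteq> 0"
proof
  assume iso: "dual_form H f \<alpha> \<alpha> = 0"
  from \<alpha>(1) obtain x where x: "\<alpha> \<in> dual L H" "x \<in> root_space L H \<alpha>" "x \<noteq> \<zero>" by (rule rootE)
  from x(2,3) obtain y where y: "y \<in> root_space L H (\<lambda>t. - \<alpha> t)" "f x y \<noteq> 0"
    by (rule exists_dual_root_vector)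
  note xc = root_spaceD(1)[OF x(2)] and yc = root_spaceD(1)[OF y(1)]
  define t where "t = x \<otimes> y"
  have tH: "t \<in> H" unfolding t_def by (rule bracket_opposite_in_H[OF x(2) y(1)])
  have \<alpha>t: "\<alpha> t = 0" unfolding t_def using dual_form_bracket[OF \<alpha>(1) \<alpha>(1) x(2) y(1)] iso by simp
  have roots0: "\<beta> t = 0" if \<beta>: "\<beta> \<in> roots L H" for \<beta>
  proof (rule ccontr)
    assume c: "\<beta> t \<noteq> 0"
    have \<beta>d: "\<beta> \<in> dual L H" using rootE[OF \<beta>] by metis
    have dual: "(\<lambda>s. \<beta> s + of_int n * \<alpha> s) \<in> dual L H" for n
      using dual_add[OF \<beta>d dual_scale[OF x(1)]] .
    define N where "N = {n::int. (\<lambda>t. \<beta> t + of_int n * \<alpha> t) \<in> roots L H}"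
    have N: "finite N" "0 \<in> N"
      using root_string_finite[OF \<alpha>(2), of \<beta>] \<beta> by (auto simp: N_def)
    \<comment> \<open>The top of the \<alpha>-string through \<beta>; a vector v of this weight is
      killed by x.\<close>
    define n where "n = Max N"
    have "n \<in> N" unfolding n_def using N by (intro Max_in) auto
    then obtain v where v: "v \<in> root_space L H (\<lambda>t. \<beta> t + of_int n * \<alpha> t)" "v \<noteq> \<zero>"
      unfolding N_def using rootE by blast
    define w where "w k = ((\<lambda>z. y \<otimes> z) ^^ k) v" for k
    have w: "w k \<in> root_space L H (\<lambda>t. \<beta> t + of_int (n - int k) * \<alpha> t)" for k
      using ad_power_root_space[OF y(1) v(1), of k] unfolding w_def by (simp add: algebra_simps)
    note wc = root_spaceD(1)[OF w]
    \<comment> \<open>Lowering by y does not change the eigenvalue of t, because \<alpha> vanishes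
      at t.\<close>
    have tw: "t \<otimes> w k = \<beta> t \<odot> w k" for k
      using root_spaceD(2)[OF w tH] \<alpha>t by simp
    have "x \<otimes> v \<in> root_space L H (\<lambda>t. \<beta> t + of_int (n + 1) * \<alpha> t)"
      using bracket_root_space[OF x(2) v(1)] by (simp add: algebra_simps)
    moreover have "n + 1 \<notin> N"
      using N Max_ge[of N "n + 1"] unfolding n_def by auto
    ultimately have xv: "x \<otimes> v = \<zero>"
      using rootI[OF dual, of _ "n + 1"] unfolding N_def by blast
    have step: "x \<otimes> w (Suc k) = (of_nat (Suc k) * \<beta> t) \<odot> w k" for k
    proof (induction k)
      case 0
      show ?case using leibniz[OF xc yc wc[of 0]] tw[of 0] xv wc[of 0] yc xc
        by (simp add: w_def t_def bracket_closed)
    next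
      case (Suc k)
      have "x \<otimes> w (Suc (Suc k)) = t \<otimes> w (Suc k) \<oplus> y \<otimes> (x \<otimes> w (Suc k))"
        using leibniz[OF xc yc wc[of "Suc k"]] by (simp add: w_def t_def)
      also have "y \<otimes> (x \<otimes> w (Suc k)) = (of_nat (Suc k) * \<beta> t) \<odot> w (Suc k)"
        unfolding Suc using yc wc by (simp add: bracket_smult_right) (simp add: w_def)
      also have "t \<otimes> w (Suc k) = \<beta> t \<odot> w (Suc k)" by (rule tw)
      finally show ?case using wc by (simp add: algebra_simps flip: scale_add_left)
    qed
    have nz: "w k \<noteq> \<zero>" for k
    proof (induction k)
      case 0
      then show ?case using v by (simp add: w_def)
    next
      case (Suc k)
      have "(of_nat (Suc k) * \<beta> t) \<odot> w k \<noteq> \<zero>"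
        using Suc c wc by (simp only: scale_eq_zero_iff) (simp del: of_nat_Suc)
      then show ?case using step[of k] xc by auto
    qed
    have "n - int k \<in> N" for k
      unfolding N_def using rootI[OF dual w nz] by auto
    then have "range (\<lambda>k. n - int k) \<subseteq> N" by auto
    then have "finite (range (\<lambda>k. n - int k))" using N(1) finite_subset by blast
    moreover have "inj (\<lambda>k. n - int k)" by (rule injI) simp
    ultimately show False using finite_imageD by fastforce
  qed
  have "carrier L \<subseteq> {z \<in> carrier L. t \<otimes> z = \<zero>}"
  proof (rule root_space_induct)
    show "subspace {z \<in> carrier L. t \<otimes> z = \<zero>}"
      using H_closed[OF tH] by (intro subspaceI) (auto simp: bracket_add_right bracket_smult_right)
    fix \<beta> assume "\<beta> \<in> dual L H"
    then have "t \<otimes> z = \<zero>" if "z \<in> root_space L H \<beta>" for z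
      using that roots0[of \<beta>] rootI[of \<beta> z] root_spaceD[OF that] tH H_closed[OF tH]
      by (cases "z = \<zero>") auto
    then show "root_space L H \<beta> \<subseteq> {z \<in> carrier L. t \<otimes> z = \<zero>}" using root_spaceD(1) by auto
  qed
  then have t0: "t = \<zero>" by (intro center_trivial[OF H_closed[OF tH]]) blast
  \<comment> \<open>f(t, s) = \<alpha>(s) f(x, y), so t = 0 would make \<alpha> vanish on
    \<open>H\<close>.\<close>
  have "\<alpha> s = 0" if "s \<in> H" for s
    using form_bracket_opposite[OF x(2) y(1) that] y(2) t0 H_closed[OF that]
    unfolding t_def by (simp add: form_simps)
  then have "\<alpha> = (\<lambda>_. 0)" using dual_eqI[OF x(1) dual_zero] by auto
  with \<alpha>(2) show False by simp
qed

text \<open>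
  The subalgebra generated by the root spaces in \<open>P\<close> is an ideal as soon as it is normalised by
  all other nonzero root spaces, since \<open>H\<close> acts on each root space by scalars.
\<close>

lemma generated_eq_carrier:
  assumes P: "P \<subseteq> roots L H" "P \<noteq> {}"
    and other: "\<And>\<beta> y x. \<beta> \<in> roots L H \<Longrightarrow> \<beta> \<noteq> (\<lambda>_. 0) \<Longrightarrow> \<beta> \<notin> P \<Longrightarrow> y \<in> root_space L H \<beta>
      \<Longrightarrow> x \<in> (\<Union>\<alpha>\<in>P. root_space L H \<alpha>) \<Longrightarrow> y \<otimes> x = \<zero>"
  shows "generated_subalgebra L (\<Union>\<alpha>\<in>P. root_space L H \<alpha>) = carrier L"
proof -
  define S where "S = (\<Union>\<alpha>\<in>P. root_space L H \<alpha>)"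
  define A where "A = generated_subalgebra L S"
  have Sc: "S \<subseteq> carrier L" unfolding S_def using root_spaceD(1) by auto
  have A: "lie_subalgebra L A" unfolding A_def by (rule lie_subalgebra_generated[OF Sc])
  note As = subspaceD[OF lie_subalgebraD(1)[OF A]] and Ab = lie_subalgebraD(2)[OF A]
  have SA: "S \<subseteq> A" unfolding A_def by (rule generated_superset)
  \<comment> \<open>Since \<open>ad z\<close> is a derivation, it preserves \<open>A\<close> as soon
    as it maps the generators into \<open>A\<close>.\<close>
  have norm: "z \<otimes> a \<in> A" if z: "z \<in> carrier L" "\<And>s. s \<in> S \<Longrightarrow> z \<otimes> s \<in> A" and a: "a \<in> A" for z a
  proof -
    have "lie_subalgebra L {a \<in> A. z \<otimes> a \<in> A}"
      unfolding lie_subalgebra_def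
    proof (intro conjI ballI subspaceI)
      fix a b assume ab: "a \<in> {a \<in> A. z \<otimes> a \<in> A}" "b \<in> {a \<in> A. z \<otimes> a \<in> A}"
      then have "z \<otimes> (a \<otimes> b) = (z \<otimes> a) \<otimes> b \<oplus> a \<otimes> (z \<otimes> b)"
        using As(1) z by (intro leibniz) auto
      then show "a \<otimes> b \<in> {a \<in> A. z \<otimes> a \<in> A}" using ab As Ab by auto
    qed (use As z in \<open>auto simp: bracket_add_right bracket_smult_right subset_eq\<close>)
    then have "A \<subseteq> {a \<in> A. z \<otimes> a \<in> A}"
      unfolding A_def[of] by (rule generated_minimal) (use z SA in \<open>auto simp: A_def\<close>)
    then show ?thesis using a by auto
  qed
  have "carrier L \<subseteq> {z \<in> carrier L. \<forall>a\<in>A. z \<otimes> a \<in> A}"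
  proof (rule root_space_induct)
    show "subspace {z \<in> carrier L. \<forall>a\<in>A. z \<otimes> a \<in> A}"
      using As by (intro subspaceI) (auto simp: bracket_add_left bracket_smult_left subset_eq)
    fix \<beta> assume \<beta>: "\<beta> \<in> dual L H"
    have "z \<otimes> s \<in> A" if z: "z \<in> root_space L H \<beta>" and s: "s \<in> S" for z s
    proof (cases "z = \<zero> \<or> \<beta> \<in> P")
      case True
      then show ?thesis
      proof
        assume "z = \<zero>"
        then show ?thesis using As s Sc by auto
      next
        assume "\<beta> \<in> P"
        then have "z \<in> A" using z SA by (auto simp: S_def)
        then show ?thesis using s SA Ab by auto
      qed
    next
      case False
      show ?thesis
      proof (cases "\<beta> = (\<lambda>_. 0)")
        case True
        then have "z \<in> H" using z by (simp add: root_space_zero)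
        moreover obtain \<alpha> where "\<alpha> \<in> P" "s \<in> root_space L H \<alpha>" using s by (auto simp: S_def)
        ultimately have "z \<otimes> s = \<alpha> z \<odot> s" by (simp add: root_spaceD(2))
        then show ?thesis using As(4) SA s by auto
      next
        case False
        then have "z \<otimes> s = \<zero>"
          using other[of \<beta> z s] rootI[OF \<beta> z] \<open>\<not> (z = \<zero> \<or> \<beta> \<in> P)\<close> z s by (auto simp: S_def)
        then show ?thesis using As(2) by simp
      qed
    qed
    then show "root_space L H \<beta> \<subseteq> {z \<in> carrier L. \<forall>a\<in>A. z \<otimes> a \<in> A}"
      using norm root_spaceD(1) by auto
  qed
  then have "lie_ideal L A"
    unfolding lie_ideal_def using lie_subalgebraD(1)[OF A] by auto
  moreover have "A \<noteq> {\<zero>}"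
  proof -
    obtain \<alpha> where \<alpha>: "\<alpha> \<in> P" using P by auto
    then obtain x where "x \<in> root_space L H \<alpha>" "x \<noteq> \<zero>" using P rootE by (metis subsetD)
    then show ?thesis using SA \<alpha> by (auto simp: S_def)
  qed
  ultimately have "A = carrier L" using simple unfolding simple_lie_algebra_def by blast
  then show ?thesis by (simp add: A_def S_def)
qed

lemma zero_root: "(\<lambda>_. 0) \<in> roots L H"
proof -
  have "H \<noteq> {\<zero>}"
  proof
    assume "H = {\<zero>}"
    have "carrier L \<subseteq> root_space L H (\<lambda>_. 0)"
      unfolding root_space_def \<open>H = {\<zero>}\<close> by auto
    then show False
      using \<open>H = {\<zero>}\<close> nonzero_element root_space_zero[of "\<lambda>_. 0"] by blast
  qed
  then obtain t where "t \<in> H" "t \<noteq> \<zero>" using H_subspace(2) by auto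
  then show ?thesis using H_subset_root_space by (intro rootI[OF dual_zero, of t]) auto
qed

text \<open>Otherwise \<open>L = H\<close> would be abelian.\<close>

lemma exists_nonzero_root: "\<exists>\<alpha>\<in>roots L H. \<alpha> \<noteq> (\<lambda>_. 0)"
proof (rule ccontr)
  assume *: "\<not> ?thesis"
  have "carrier L \<subseteq> H"
  proof (rule root_space_induct[OF lie_subalgebraD(1)[OF subalgebra]])
    fix \<alpha> assume \<alpha>: "\<alpha> \<in> dual L H"
    show "root_space L H \<alpha> \<subseteq> H"
    proof
      fix x assume x: "x \<in> root_space L H \<alpha>"
      show "x \<in> H"
      proof (cases "x = \<zero>")
        case False
        then have "\<alpha> = (\<lambda>_. 0)" using rootI[OF \<alpha> x] * by auto
        then show ?thesis using x by (simp add: root_space_zero)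
      qed (use H_subspace in auto)
    qed
  qed
  then have "x \<otimes> y = \<zero>" if "x \<in> carrier L" "y \<in> carrier L" for x y
    using that abelian unfolding abelian_on_def by auto
  then show False using simple unfolding simple_lie_algebra_def by blast
qed

text \<open>With all nonzero roots in \<open>P\<close>, the commutation hypothesis of
  \<open>generated_eq_carrier\<close> is vacuous.\<close>

lemma generated_by_nonzero_root_spaces:
  "generated_subalgebra L (\<Union>\<alpha>\<in>roots L H - {\<lambda>_. 0}. root_space L H \<alpha>) = carrier L"
  using exists_nonzero_root by (intro generated_eq_carrier) auto

text \<open>If root vectors for \<alpha> in \<open>P1\<close> and \<beta> in \<open>P2\<close> did
  not commute, \<alpha> + \<beta> would be a root whose products with \<alpha> and \<beta> are
  (\<alpha>, \<alpha>) and (\<beta>, \<beta>), both nonzero. It would be nonzero and in neither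
  part. So the root spaces of \<open>P1\<close> commute with those of \<open>P2\<close>; as they
  generate \<open>L\<close>, a root vector of \<open>P2\<close> would be central.\<close>

lemma roots_irreducible:
  assumes P: "roots L H - {\<lambda>_. 0} = P1 \<union> P2"
    and orth: "\<And>\<alpha> \<beta>. \<alpha> \<in> P1 \<Longrightarrow> \<beta> \<in> P2 \<Longrightarrow> dual_form H f \<alpha> \<beta> = 0"
  shows "P1 = {} \<or> P2 = {}"
proof (rule ccontr)
  assume ne: "\<not> ?thesis"
  have roots: "\<alpha> \<in> roots L H" "\<alpha> \<noteq> (\<lambda>_. 0)" if "\<alpha> \<in> P1 \<union> P2" for \<alpha> using that P by auto
  have zero: "y \<otimes> x = \<zero>"
    if \<alpha>: "\<alpha> \<in> P1" and \<beta>: "\<beta> \<in> P2" and x: "x \<in> root_space L H \<alpha>" and y: "y \<in> root_space L H \<beta>"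
      for \<alpha> \<beta> x y
  proof (rule ccontr)
    assume nz: "y \<otimes> x \<noteq> \<zero>"
    define \<gamma> where "\<gamma> = (\<lambda>t. \<beta> t + \<alpha> t)"
    have \<gamma>: "\<gamma> \<in> roots L H"
      unfolding \<gamma>_def using roots \<alpha> \<beta> nz bracket_root_space[OF y x] dual_add
      by (intro rootI[of _ "y \<otimes> x"]) (auto simp: roots_def)
    note [simp] = roots(1)[of \<alpha>] roots(1)[of \<beta>]
    have a: "dual_form H f \<gamma> \<alpha> = dual_form H f \<alpha> \<alpha>" and b: "dual_form H f \<gamma> \<beta> = dual_form H f \<beta> \<beta>"
      using \<gamma> \<alpha> \<beta> orth[OF \<alpha> \<beta>] dual_form_sym[of \<beta> \<alpha>] unfolding \<gamma>_def
      by (simp_all add: dual_form_add_left)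
    have "dual_form H f \<alpha> \<alpha> \<noteq> 0" "dual_form H f \<beta> \<beta> \<noteq> 0"
      using roots \<alpha> \<beta> nonzero_root_nonisotropic by auto
    then have "\<gamma> \<notin> P1" "\<gamma> \<notin> P2"
      using a b orth[of \<gamma> \<beta>] orth[of \<alpha> \<gamma>] \<alpha> \<beta> dual_form_sym[OF \<gamma>, of \<alpha>] by auto
    then have "\<gamma> = (\<lambda>_. 0)" using P \<gamma> by auto
    \<comment> \<open>Additivity applied to 0 + 0 = 0 in the first argument.\<close>
    moreover have "dual_form H f (\<lambda>_. 0) \<alpha> = 0"
      using zero_root \<alpha> dual_form_add_left[OF zero_root zero_root _ roots(1)[of \<alpha>]] by simp
    ultimately show False using a \<open>dual_form H f \<alpha> \<alpha> \<noteq> 0\<close> by simp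
  qed
  let ?S = "\<lambda>P. \<Union>\<alpha>\<in>P. root_space L H \<alpha>"
  have "generated_subalgebra L (?S P1) = carrier L"
  proof (rule generated_eq_carrier)
    fix \<beta> y x assume "\<beta> \<in> roots L H" "\<beta> \<noteq> (\<lambda>_. 0)" "\<beta> \<notin> P1" "y \<in> root_space L H \<beta>" "x \<in> ?S P1"
    then show "y \<otimes> x = \<zero>" using P zero by blast
  qed (use P ne in auto)
  moreover have "generated_subalgebra L (?S P1) \<subseteq> {x \<in> carrier L. \<forall>y\<in>?S P2. x \<otimes> y = \<zero>}"
  proof (rule generated_minimal[OF lie_subalgebra_centralizer])
    show "?S P1 \<subseteq> {x \<in> carrier L. \<forall>y\<in>?S P2. x \<otimes> y = \<zero>}"
    proof clarify
      fix x \<alpha> assume "\<alpha> \<in> P1" "x \<in> root_space L H \<alpha>"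
      moreover from this have "x \<otimes> y = \<zero>" if "y \<in> root_space L H \<beta>" "\<beta> \<in> P2" for y \<beta>
        using zero[of \<alpha> \<beta> x y] that bracket_eq_zero_sym[of y x] root_spaceD(1) by metis
      ultimately show "x \<in> carrier L \<and> (\<forall>y\<in>?S P2. x \<otimes> y = \<zero>)"
        using root_spaceD(1) by auto
    qed
  qed (use root_spaceD(1) in auto)
  ultimately have central: "x \<otimes> y = \<zero>" if "x \<in> carrier L" "y \<in> ?S P2" for x y using that by auto
  obtain \<beta> where \<beta>: "\<beta> \<in> P2" using ne by auto
  then obtain y where y: "y \<in> root_space L H \<beta>" "y \<noteq> \<zero>" using roots(1) rootE by (metis UnI2)
  have "y \<otimes> x = \<zero>" if "x \<in> carrier L" for x
    using central[OF that, of y] y(1) \<beta> bracket_eq_zero_sym[OF that root_spaceD(1)[OF y(1)]] by auto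
  then have "y = \<zero>" by (rule center_trivial[OF root_spaceD(1)[OF y(1)]])
  with y show False by simp
qed

end

section \<open>Bilinear extension from homogeneous elements\<close>

abbreviation mon :: "'i \<Rightarrow> 'x::zero \<Rightarrow> 'i \<Rightarrow>\<^sub>0 'x" where
  "mon \<equiv> Poly_Mapping.single"

abbreviation coef :: "('i \<Rightarrow>\<^sub>0 'x::zero) \<Rightarrow> 'i \<Rightarrow> 'x" where
  "coef \<equiv> Poly_Mapping.lookup"

lemma poly_mapping_add_induct [case_names single add]:
  fixes a :: "'i \<Rightarrow>\<^sub>0 'x::comm_monoid_add"
  assumes single: "\<And>r x. P (mon r x)"
    and add: "\<And>a b. P a \<Longrightarrow> P b \<Longrightarrow> P (a + b)"
  shows "P a"
proof -
  have a: "a = (\<Sum>k\<in>Poly_Mapping.keys a. mon k (coef a k))"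
    by (rule poly_mapping_eqI)
      (auto simp: lookup_sum lookup_single when_def in_keys_iff sum.delta)
  have "P (\<Sum>k\<in>F. mon k (coef a k))" if "finite F" for F
    using that
  proof (induction F rule: finite_induct)
    case empty
    then show ?case using single[of undefined 0] by simp
  qed (simp add: single add)
  then show ?thesis using a by (metis finite_keys)
qed

text \<open>Only additivity is asked, so that one locale covers brackets, cocycles and scalar-valued
  pairings. Compatibility with scalars is checked later on homogeneous generators.\<close>

locale biadditive_family =
  fixes b :: "'i \<Rightarrow> 'x::ab_group_add \<Rightarrow> 'j \<Rightarrow> 'y::ab_group_add \<Rightarrow> 'z::ab_group_add"
  assumes add_left: "b r (x + x') s y = b r x s y + b r x' s y"
    and add_right: "b r x s (y + y') = b r x s y + b r x s y'"
begin

lemma zero_left [simp]: "b r 0 s y = 0"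
  using add_left[of r 0 0 s y] by simp

lemma zero_right [simp]: "b r x s 0 = 0"
  using add_right[of r x s 0 0] by simp

text \<open>Sums over supersets of the supports let \<open>p\<close>, \<open>p'\<close> and
  \<open>p + p'\<close> share one index set, even when coefficients cancel.\<close>

lemma bilin_ext_eq_sum:
  assumes "finite A" "Poly_Mapping.keys p \<subseteq> A" "finite C" "Poly_Mapping.keys q \<subseteq> C"
  shows "bilin_ext b p q =
    (\<Sum>r\<in>A. \<Sum>s\<in>C. b r (coef p r) s (coef q s))"
proof -
  have "bilin_ext b p q = (\<Sum>r\<in>Poly_Mapping.keys p. \<Sum>s\<in>C.
      b r (coef p r) s (coef q s))"
    using assms by (intro bilin_ext_superset) auto
  also have "\<dots> = (\<Sum>r\<in>A. \<Sum>s\<in>C. b r (coef p r) s (coef q s))"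
    using assms by (intro sum.mono_neutral_left) (auto simp: in_keys_iff)
  finally show ?thesis .
qed

lemma bilin_ext_add_left: "bilin_ext b (p + p') q = bilin_ext b p q + bilin_ext b p' q"
proof -
  let ?A = "Poly_Mapping.keys p \<union> Poly_Mapping.keys p'"
  have "Poly_Mapping.keys (p + p') \<subseteq> ?A" by (rule keys_add)
  then show ?thesis
    by (simp add: bilin_ext_eq_sum[of ?A _ "Poly_Mapping.keys q"] lookup_add add_left sum.distrib)
qed

lemma bilin_ext_add_right: "bilin_ext b p (q + q') = bilin_ext b p q + bilin_ext b p q'"
proof -
  let ?A = "Poly_Mapping.keys q \<union> Poly_Mapping.keys q'"
  have "Poly_Mapping.keys (q + q') \<subseteq> ?A" by (rule keys_add)
  then show ?thesis
    by (simp add: bilin_ext_eq_sum[of "Poly_Mapping.keys p" _ ?A] lookup_add add_right sum.distrib)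
qed

lemma bilin_ext_zero_left: "bilin_ext b 0 q = 0"
  by (simp add: bilin_ext_def)

lemma bilin_ext_zero_right: "bilin_ext b p 0 = 0"
  by (simp add: bilin_ext_def)

lemma bilin_ext_single:
  "bilin_ext b (mon r x) (mon s y) = b r x s y"
  by (subst bilin_ext_eq_sum[of "{r}" _ "{s}"]) auto

lemmas bilin_ext_simps =
  bilin_ext_add_left bilin_ext_add_right bilin_ext_zero_left bilin_ext_zero_right bilin_ext_single

end


section \<open>The toroidal Lie algebra\<close>

lemma cdot_commute: "cdot u v = cdot v u"
  by (simp add: cdot_def mult.commute)

lemma cdot_add_left: "cdot (u + v) w = cdot u w + cdot v w"
  by (simp add: cdot_def algebra_simps sum.distrib)

lemma cdot_smult_left: "cdot (c *s u) w = c * cdot u w"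
  by (simp add: cdot_def algebra_simps sum_distrib_left)

lemma cdot_zero_left [simp]: "cdot 0 u = 0"
  by (simp add: cdot_def)

lemma cdot_minus_left: "cdot (- u) w = - cdot u w"
  by (simp add: cdot_def sum_negf)

lemma cdot_minus_right: "cdot u (- w) = - cdot u w"
  by (simp add: cdot_def sum_negf)

lemma cdot_diff_left: "cdot (u - v) w = cdot u w - cdot v w"
  by (simp add: cdot_def algebra_simps sum_subtractf)

lemma cdot_diff_right: "cdot w (u - v) = cdot w u - cdot w v"
  by (simp add: cdot_def algebra_simps sum_subtractf)

lemma cvec_zero [simp]: "cvec 0 = 0"
  by (simp add: cvec_def vec_eq_iff)

lemma cvec_minus: "cvec (- r) = - cvec r"
  by (simp add: cvec_def vec_eq_iff)

lemma cvec_diff: "cvec (r - s) = cvec r - cvec s"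
  by (simp add: cvec_def vec_eq_iff)

lemmas cdot_simps = cdot_add_left cdot_add_right cdot_smult_left cdot_smult_right
  cdot_minus_left cdot_minus_right cdot_diff_left cdot_diff_right cvec_add cvec_minus cvec_diff

lemma cdot_axis_right [simp]: "cdot u (axis i 1) = u $ i"
  by (simp add: cdot_def axis_def if_distrib cong: if_cong)

lemma cdot_axis_left [simp]: "cdot (axis i 1) u = u $ i"
  by (simp add: cdot_commute[of "axis i 1"])

lemma cdot_nondegenerate: "(\<And>v. cdot u v = 0) \<Longrightarrow> u = 0"
  by (metis cdot_axis_right vec_eq_iff zero_index)

lemma cdot_mult_skew: "transpose B = - B \<Longrightarrow> cdot (B *v u) v = - cdot u (B *v v)"
proof -
  assume B: "transpose B = - B"
  have skew: "B $ i $ j = - (B $ j $ i)" for i j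
    using arg_cong[OF B, of "\<lambda>M. M $ j $ i"] by (simp add: transpose_def)
  have "cdot (B *v u) v = (\<Sum>i\<in>UNIV. \<Sum>j\<in>UNIV. B $ i $ j * u $ j * v $ i)"
    by (simp add: cdot_def matrix_vector_mult_def sum_distrib_right)
  also have "\<dots> = (\<Sum>j\<in>UNIV. \<Sum>i\<in>UNIV. B $ i $ j * u $ j * v $ i)"
    by (rule sum.swap)
  also have "\<dots> = (\<Sum>j\<in>UNIV. \<Sum>i\<in>UNIV. - (u $ j * (B $ j $ i * v $ i)))"
    by (intro sum.cong refl) (subst skew, simp add: algebra_simps)
  also have "\<dots> = - cdot u (B *v v)"
    by (simp add: cdot_def matrix_vector_mult_def sum_distrib_left sum_negf)
  finally show ?thesis .
qed

lemma K_add: "K (u + v) r = K u r + K v r"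
  unfolding K_def single_add plus_kz.abs_eq ..

lemma K_zero [simp]: "K 0 r = 0"
  unfolding K_def zero_kz_def by simp

lemma K_minus: "K (- u) r = - K u r"
  unfolding K_def single_uminus uminus_kz.abs_eq ..

lemma kz_scale_K: "kz_scale c (K u r) = K (c *s u) r"
  unfolding K_def kz_scale.abs_eq vloop_scale_single ..

lemma K_cvec [simp]: "K (cvec r) r = 0"
proof -
  have "mon r (cvec r) \<in> exact_forms"
    unfolding exact_forms_def by (intro vloop.span_base) auto
  then show ?thesis unfolding K_def zero_kz_def by (simp add: kz.abs_eq_iff)
qed

text \<open>In degree r a coefficient vector matters only modulo multiples of \<open>cvec r\<close>,
  which are exact.\<close>

lemma K_eqI: "u - v = c *s cvec r \<Longrightarrow> K u r = K v r"
proof -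
  assume "u - v = c *s cvec r"
  then have "u = v + c *s cvec r" by (simp add: algebra_simps)
  then have "K u r = K v r + kz_scale c (K (cvec r) r)" by (simp only: K_add kz_scale_K)
  then show ?thesis by simp
qed

lemma K_eq_zeroI: "u = c *s cvec r \<Longrightarrow> K u r = 0"
  using K_eqI[of u 0 c r] by simp

lemma kz_induct [case_names K add]:
  assumes "\<And>u r. P (K u r)" "\<And>k l. P k \<Longrightarrow> P l \<Longrightarrow> P (k + l)"
  shows "P k"
proof (induction k rule: kz.abs_induct)
  fix w
  show "P (abs_kz w)"
  proof (induction w rule: poly_mapping_add_induct)
    case (single r x)
    then show ?case using assms(1) by (simp add: K_def)
  next
    case (add a b)
    then show ?case using assms(2) by (simp flip: plus_kz.abs_eq)
  qed
qed

global_interpretation der_form: biadditive_family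
  "\<lambda>r u s v. mon (r + s) (cdot u (cvec s) *s v + cdot u v *s cvec r) ::
     ('n::finite) vloop"
  by unfold_locales (simp_all add: cdot_simps vector_add_ldistrib vector_sadd_rdistrib algebra_simps
      flip: single_add)

lemma der_kz_add_left: "der_kz (D + E) k = der_kz D k + der_kz E k"
  by (induction k rule: kz.abs_induct) (simp add: der_kz.abs_eq der_form_def
    der_form.bilin_ext_simps plus_kz.abs_eq)

lemma der_kz_add_right: "der_kz D (k + l) = der_kz D k + der_kz D l"
  by (induction k rule: kz.abs_induct; induction l rule: kz.abs_induct)
    (simp add: der_kz.abs_eq der_form_def der_form.bilin_ext_simps plus_kz.abs_eq)

lemma der_kz_zero_left [simp]: "der_kz 0 k = 0"
  using der_kz_add_left[of 0 0 k] by simp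

lemma der_kz_zero_right [simp]: "der_kz D 0 = 0"
  using der_kz_add_right[of D 0 0] by simp

lemma der_kz_K:
  "der_kz (mon r u) (K v s)
     = K (cdot u (cvec s) *s v + cdot u v *s cvec r) (r + s)"
  by (simp add: K_def der_kz.abs_eq der_form_def der_form.bilin_ext_simps)

global_interpretation vect_bracket: biadditive_family
  "\<lambda>r u s v. mon (r + s) (cdot u (cvec s) *s v - cdot v (cvec r) *s u) ::
     ('n::finite) vloop"
  by unfold_locales (simp_all add: cdot_simps vector_add_ldistrib vector_sadd_rdistrib algebra_simps
      flip: single_add)

global_interpretation cocycle: biadditive_family
  "\<lambda>r u s v. kz_scale (cdot u (cvec s) * cdot v (cvec r)) (K (cvec r) (r + s)) ::
     ('n::finite) kz"
  by unfold_locales (simp_all add: cdot_simps algebra_simps kz_scale_K vector_sadd_rdistrib K_add)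

definition X_gen :: "'g \<Rightarrow> (int, 'n) vec \<Rightarrow> ('g::ab_group_add, 'n::finite) toroidal" where
  "X_gen x r = (mon r x, 0, 0)"

definition K_gen :: "(complex, 'n) vec \<Rightarrow> (int, 'n) vec \<Rightarrow> ('g::ab_group_add, 'n::finite) toroidal"
  where
  "K_gen u r = (0, K u r, 0)"

definition D_gen :: "(complex, 'n) vec \<Rightarrow> (int, 'n) vec \<Rightarrow> ('g::ab_group_add, 'n::finite) toroidal"
  where
  "D_gen u r = (0, 0, mon r u)"

lemma gen_add:
  "X_gen (x + y) r = X_gen x r + X_gen y r" "K_gen (u + v) r = K_gen u r + K_gen v r"
  "D_gen (u + v) r = D_gen u r + D_gen v r"
  by (simp_all add: X_gen_def K_gen_def D_gen_def single_add K_add)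

lemma gen_minus:
  "X_gen (- x) r = - X_gen x r" "K_gen (- u) r = - K_gen u r" "D_gen (- u) r = - D_gen u r"
  by (simp_all add: X_gen_def K_gen_def D_gen_def single_uminus K_minus)

lemma gen_diff:
  "X_gen (x - y) r = X_gen x r - X_gen y r" "K_gen (u - v) r = K_gen u r - K_gen v r"
  "D_gen (u - v) r = D_gen u r - D_gen v r"
  using gen_add(1)[of x "- y" r] gen_add(2)[of u "- v" r] gen_add(3)[of u "- v" r]
  by (simp_all add: gen_minus)

lemma gen_zero [simp]: "X_gen 0 r = 0" "K_gen 0 r = 0" "D_gen 0 r = 0"
  by (simp_all add: X_gen_def K_gen_def D_gen_def zero_prod_def)

text \<open>The normal form to which the identities below are reduced: the outer parts must vanish
  identically, the middle one only modulo exact forms.\<close>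

lemma toroidal_eqI:
  "X_gen x r + K_gen u s + D_gen v t = (0 :: ('g::ab_group_add, 'n::finite) toroidal)"
  if "x = 0" "K u s = 0" "v = 0"
  using that by (simp add: K_gen_def zero_prod_def)

lemma toroidal_induct [case_names X K D add]:
  fixes x :: "('g::ab_group_add, 'n::finite) toroidal"
  assumes X: "\<And>y r. P (X_gen y r)" and K: "\<And>u r. P (K_gen u r)" and D: "\<And>u r. P (D_gen u r)"
    and add: "\<And>x y. P x \<Longrightarrow> P y \<Longrightarrow> P (x + y)"
  shows "P x"
proof -
  obtain p k D where x: "x = (p, k, D)" by (cases x) auto
  have "P (p, 0, 0)"
  proof (induction p rule: poly_mapping_add_induct)
    case (single r y)
    then show ?case using X[of y r] by (simp add: X_gen_def)
  next
    case (add a b)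
    then show ?case using assms(4)[OF add] by simp
  qed
  moreover have "P (0, k, 0)"
  proof (induction k rule: kz_induct)
    case (K u r)
    then show ?case using assms(2)[of u r] by (simp add: K_gen_def)
  next
    case (add a b)
    then show ?case using assms(4)[OF add] by simp
  qed
  moreover have "P (0, 0, D)"
  proof (induction D rule: poly_mapping_add_induct)
    case (single r u)
    then show ?case using D[of u r] by (simp add: D_gen_def)
  next
    case (add a b)
    then show ?case using assms(4)[OF add] by simp
  qed
  ultimately have "P ((p, 0, 0) + ((0, k, 0) + (0, 0, D)))" using add by blast
  then show ?thesis using x by simp
qed

section \<open>The toroidal bracket on homogeneous generators\<close>

locale toroidal_data =
  fixes sc :: "complex \<Rightarrow> 'g::ab_group_add \<Rightarrow> 'g" and br :: "'g \<Rightarrow> 'g \<Rightarrow> 'g"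
    and f :: "'g \<Rightarrow> 'g \<Rightarrow> complex"
  assumes lie: "lie_algebra (type_lie sc br)"
    and invariant: "invariant_symmetric_form (type_lie sc br) f"
begin

lemma type_lie_simps [simp]:
  "carrier (type_lie sc br) = UNIV" "x \<oplus>\<^bsub>type_lie sc br\<^esub> y = x + y"
  "x \<otimes>\<^bsub>type_lie sc br\<^esub> y = br x y" "c \<odot>\<^bsub>type_lie sc br\<^esub> x = sc c x" "\<zero>\<^bsub>type_lie sc br\<^esub> = 0"
  by (simp_all add: type_lie_def)

sublocale sc: vector_space sc
proof
  interpret lie_algebra "type_lie sc br" by (rule lie)
  show "sc a (x + y) = sc a x + sc a y" for a x y using scale_add_right[of x y a] by simp
  show "sc (a + b) x = sc a x + sc b x" for a b x using scale_add_left[of x a b] by simp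
  show "sc a (sc b x) = sc (a * b) x" for a b x using scale_scale[of x a b] by simp
  show "sc 1 x = x" for x using scale_one[of x] by simp
qed

lemma br_simps:
  "br (x + y) z = br x z + br y z" "br z (x + y) = br z x + br z y"
  "br (sc c x) y = sc c (br x y)" "br x (sc c y) = sc c (br x y)"
  using lie_algebra.bracket_add_left[OF lie, of x y z] lie_algebra.bracket_add_right[OF lie, of z
    x y]
    lie_algebra.bracket_smult_left[OF lie, of x y c] lie_algebra.bracket_smult_right[OF lie, of x
      y c]
  by simp_all

lemma br_zero [simp]: "br 0 x = 0" "br x 0 = 0"
  using br_simps(1)[of 0 0 x] br_simps(2)[of x 0 0] by simp_all

lemma br_minus [simp]: "br (- x) y = - br x y" "br x (- y) = - br x y"
  using br_simps(3)[of "-1" x y] br_simps(4)[of x "-1" y] by simp_all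

lemma br_self [simp]: "br x x = 0"
  using lie_algebra.bracket_self[OF lie, of x] by simp

lemma br_anti: "br x y = - br y x"
  using br_self[of "x + y"] unfolding br_simps by (simp add: eq_neg_iff_add_eq_0 add.commute)

lemma br_jacobi: "br x (br y z) + br y (br z x) + br z (br x y) = 0"
  using lie_algebra.jacobi[OF lie, of x y z] by simp

lemma f_simps:
  "f (x + y) z = f x z + f y z" "f z (x + y) = f z x + f z y"
  "f (sc c x) y = c * f x y" "f x (sc c y) = c * f x y"
  using invariant_symmetric_formD[OF invariant, of x y]
    lie_algebra.form_add_right[OF lie invariant, of z x y]
    lie_algebra.form_scale_right[OF lie invariant, of x y c] by simp_all

lemma f_sym: "f x y = f y x"
  using invariant_symmetric_formD(3)[OF invariant, of x y] by simp

lemma f_invariant: "f (br x y) z = f x (br y z)"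
  using invariant_symmetric_formD(4)[OF invariant, of x y z] by simp

lemma f_zero [simp]: "f 0 x = 0" "f x 0 = 0"
  using f_simps(1)[of 0 0 x] f_simps(2)[of x 0 0] by simp_all

lemma f_minus [simp]: "f (- x) y = - f x y" "f x (- y) = - f x y"
  using f_simps(3)[of "-1" x y] f_simps(4)[of x "-1" y] by simp_all

sublocale loop_bracket: biadditive_family
  "\<lambda>r x s y. mon (r + s) (br x y) :: ('g, 'n::finite) loop"
  by unfold_locales (simp_all add: br_simps single_add)

sublocale loop_cocycle: biadditive_family
  "\<lambda>r x s y. kz_scale (f x y) (K (cvec r) (r + s)) :: ('n::finite) kz"
  by unfold_locales (simp_all add: f_simps kz_scale_K vector_sadd_rdistrib K_add)

sublocale der_loop: biadditive_family
  "\<lambda>r u s x. mon (r + s) (sc (cdot u (cvec s)) x) :: ('g, 'n::finite) loop"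
  by unfold_locales (simp_all add: cdot_simps sc.scale_left_distrib sc.scale_right_distrib
    single_add)

abbreviation toroidal_br ::
    "('g, 'n::finite) toroidal \<Rightarrow> ('g, 'n) toroidal \<Rightarrow> ('g, 'n) toroidal" where
  "toroidal_br \<equiv> toroidal_bracket sc br f"

lemma toroidal_br_add:
  "toroidal_br (x + y) z = toroidal_br x z + toroidal_br y z"
  "toroidal_br z (x + y) = toroidal_br z x + toroidal_br z y"
  by (cases x; cases y; cases z; simp add: der_loop_def loop_bracket.bilin_ext_simps
      loop_cocycle.bilin_ext_simps der_loop.bilin_ext_simps vect_bracket.bilin_ext_simps
      cocycle.bilin_ext_simps der_kz_add_left der_kz_add_right algebra_simps)+

lemma toroidal_br_zero [simp]: "toroidal_br 0 x = 0" "toroidal_br x 0 = 0"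
  using toroidal_br_add(1)[of 0 0 x] toroidal_br_add(2)[of x 0 0] by simp_all

lemma toroidal_br_minus [simp]: "toroidal_br (- x) y = - toroidal_br x y"
  "toroidal_br x (- y) = - toroidal_br x y"
  using toroidal_br_add(1)[of "- x" x y] toroidal_br_add(2)[of x "- y" y]
  by (simp_all add: eq_neg_iff_add_eq_0)

lemma toroidal_br_gen:
  "toroidal_br (X_gen x r) (X_gen y s) = X_gen (br x y) (r + s) + K_gen (f x y *s cvec r) (r + s)"
  "toroidal_br (X_gen x r) (K_gen v s) = 0"
  "toroidal_br (X_gen x r) (D_gen v s) = - X_gen (sc (cdot v (cvec r)) x) (s + r)"
  "toroidal_br (K_gen u r) (X_gen y s) = 0"
  "toroidal_br (K_gen u r) (K_gen v s) = 0"
  "toroidal_br (K_gen u r) (D_gen v s)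
    = - K_gen (cdot v (cvec r) *s u + cdot v u *s cvec s) (s + r)"
  "toroidal_br (D_gen u r) (X_gen y s) = X_gen (sc (cdot u (cvec s)) y) (r + s)"
  "toroidal_br (D_gen u r) (K_gen v s) = K_gen (cdot u (cvec s) *s v + cdot u v *s cvec r) (r + s)"
  "toroidal_br (D_gen u r) (D_gen v s) =
     D_gen (cdot u (cvec s) *s v - cdot v (cvec r) *s u) (r + s)
     - K_gen ((cdot u (cvec s) * cdot v (cvec r)) *s cvec r) (r + s)"
  by (simp_all add: X_gen_def K_gen_def D_gen_def der_loop_def loop_bracket.bilin_ext_simps
      loop_cocycle.bilin_ext_simps der_loop.bilin_ext_simps vect_bracket.bilin_ext_simps
      cocycle.bilin_ext_simps der_kz_K zero_prod_def)
    (simp_all add: kz_scale_K)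

lemma lookup_map_sc [simp]: "coef (Poly_Mapping.map (sc c) p) r = sc c (coef p r)"
  by (simp add: map.rep_eq when_def)

lemma toroidal_scale_gen:
  "toroidal_scale sc c (X_gen x r) = X_gen (sc c x) r"
  "toroidal_scale sc c (K_gen u r) = K_gen (c *s u) r"
  "toroidal_scale sc c (D_gen u r) = D_gen (c *s u) r"
  by (simp_all add: X_gen_def K_gen_def D_gen_def kz_scale_K vloop_scale_single)
    (simp_all add: poly_mapping_eq_iff fun_eq_iff)

lemma toroidal_vector_space: "vector_space (toroidal_scale sc :: _ \<Rightarrow> ('g, 'n::finite) toroidal \<Rightarrow> _)"
proof
  fix a b and x y :: "('g, 'n) toroidal"
  show "toroidal_scale sc a (x + y) = toroidal_scale sc a x + toroidal_scale sc a y"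
    by (cases x; cases y) (auto simp: kz.scale_right_distrib vloop.scale_right_distrib
        sc.scale_right_distrib lookup_add intro!: poly_mapping_eqI)
  show "toroidal_scale sc (a + b) x = toroidal_scale sc a x + toroidal_scale sc b x"
    by (cases x) (auto simp: kz.scale_left_distrib vloop.scale_left_distrib
        sc.scale_left_distrib lookup_add intro!: poly_mapping_eqI)
  show "toroidal_scale sc a (toroidal_scale sc b x) = toroidal_scale sc (a * b) x"
    by (cases x) (auto intro!: poly_mapping_eqI)
  show "toroidal_scale sc 1 x = x"
    by (cases x) (auto intro!: poly_mapping_eqI)
qed

sublocale toroidal: vector_space "toroidal_scale sc :: _ \<Rightarrow> ('g, 'n::finite) toroidal \<Rightarrow> _"
  by (rule toroidal_vector_space)

lemma toroidal_br_scale: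
  fixes x y :: "('g, 'n::finite) toroidal"
  shows "toroidal_br (toroidal_scale sc c x) y = toroidal_scale sc c (toroidal_br x y)"
    and "toroidal_br x (toroidal_scale sc c y) = toroidal_scale sc c (toroidal_br x y)"
proof -
  note simps = toroidal_br_gen toroidal_scale_gen toroidal.scale_right_distrib
    toroidal.scale_right_diff_distrib br_simps f_simps vector_smult_assoc cdot_simps
    vector_add_ldistrib mult.commute mult.left_commute vector_ssub_ldistrib
  show "toroidal_br (toroidal_scale sc c x) y = toroidal_scale sc c (toroidal_br x y)"
  proof (induction x rule: toroidal_induct)
    case (add a b)
    then show ?case by (simp add: toroidal_br_add toroidal.scale_right_distrib)
  qed (induction y rule: toroidal_induct;
      simp add: simps toroidal_br_add toroidal.scale_right_distrib)+
  show "toroidal_br x (toroidal_scale sc c y) = toroidal_scale sc c (toroidal_br x y)"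
  proof (induction x rule: toroidal_induct)
    case (add a b)
    then show ?case by (simp add: toroidal_br_add toroidal.scale_right_distrib)
  qed (induction y rule: toroidal_induct;
      simp add: simps toroidal_br_add toroidal.scale_right_distrib)+
qed

text \<open>On forms this fails and holds only modulo exact ones: the two central terms of the loop
  bracket add up to f(x, y) K(r + s, r + s) = 0, and those of the derivation cocycle to another
  multiple of K(r + s, r + s).\<close>

lemma toroidal_br_anti: "toroidal_br x y + toroidal_br y x = (0 :: ('g, 'n::finite) toroidal)"
proof (induction x rule: toroidal_induct)
  case (X x r)
  show ?case
  proof (induction y rule: toroidal_induct)
    case (X y s)
    have "toroidal_br (X_gen x r) (X_gen y s) + toroidal_br (X_gen y s) (X_gen x r) =
      X_gen (br x y + br y x) (r + s) + K_gen (f x y *s cvec r + f x y *s cvec s) (r + s)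
        + D_gen 0 0"
      by (simp add: toroidal_br_gen gen_add f_sym[of y x] add.commute[of s r])
    also have "\<dots> = 0"
      by (rule toroidal_eqI, simp add: br_anti[of x y], rule K_eq_zeroI[of _ "f x y"])
        (simp_all add: cvec_add vector_add_ldistrib)
    finally show ?case .
  next
    case (add a b)
    then show ?case by (simp add: toroidal_br_add add_eq_0_iff)
  qed (simp_all add: toroidal_br_gen)
next
  case (K u r)
  show ?case
  proof (induction y rule: toroidal_induct)
    case (add a b)
    then show ?case by (simp add: toroidal_br_add add_eq_0_iff)
  qed (simp_all add: toroidal_br_gen)
next
  case (D u r)
  show ?case
  proof (induction y rule: toroidal_induct)
    case (D v s)
    let ?c = "cdot u (cvec s) * cdot v (cvec r)"
    have "toroidal_br (D_gen u r) (D_gen v s) + toroidal_br (D_gen v s) (D_gen u r) =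
      X_gen 0 0 + K_gen (- (?c *s cvec r) - ?c *s cvec s) (r + s) +
      D_gen ((cdot u (cvec s) *s v - cdot v (cvec r) *s u)
        + (cdot v (cvec r) *s u - cdot u (cvec s) *s v)) (r + s)"
      unfolding toroidal_br_gen gen_add diff_conv_add_uminus gen_minus
      by (simp add: add.commute[of s r] mult.commute)
    also have "\<dots> = 0"
      by (rule toroidal_eqI[OF refl K_eq_zeroI[of _ "- ?c"]])
        (simp_all add: cvec_add vec_eq_iff algebra_simps)
    finally show ?case .
  next
    case (add a b)
    then show ?case by (simp add: toroidal_br_add add_eq_0_iff)
  qed (simp_all add: toroidal_br_gen)
next
  case (add a b)
  then show ?case by (simp add: toroidal_br_add add_eq_0_iff)
qed

lemma toroidal_br_self: "toroidal_br x x = (0 :: ('g, 'n::finite) toroidal)"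
proof -
  have "toroidal_scale sc 2 (toroidal_br x x) = toroidal_br x x + toroidal_br x x"
    using toroidal.scale_left_distrib[of 1 1 "toroidal_br x x"] by simp
  then show ?thesis using toroidal_br_anti[of x x] by simp
qed

section \<open>The Jacobi identity, by types of generators\<close>

definition jacobiator ::
    "('g, 'n::finite) toroidal \<Rightarrow> ('g, 'n) toroidal \<Rightarrow> ('g, 'n) toroidal \<Rightarrow> ('g, 'n) toroidal" where
  "jacobiator x y z = toroidal_br x (toroidal_br y z) + toroidal_br y (toroidal_br z x)
     + toroidal_br z (toroidal_br x y)"

lemma jacobiator_add:
  "jacobiator (x + x') y z = jacobiator x y z + jacobiator x' y z"
  "jacobiator x (y + y') z = jacobiator x y z + jacobiator x y' z"
  "jacobiator x y (z + z') = jacobiator x y z + jacobiator x y z'"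
  by (simp_all add: jacobiator_def toroidal_br_add algebra_simps)

lemma jacobiator_cyclic: "jacobiator x y z = jacobiator y z x"
  by (simp add: jacobiator_def algebra_simps)

lemma toroidal_br_diff:
  "toroidal_br (x - y) z = toroidal_br x z - toroidal_br y z"
  "toroidal_br z (x - y) = toroidal_br z x - toroidal_br z y"
  using toroidal_br_add(1)[of x "- y" z] toroidal_br_add(2)[of z x "- y"] by simp_all

lemmas gen_expand = toroidal_br_gen toroidal_br_add toroidal_br_diff gen_add gen_minus gen_diff
  vector_add_ldistrib vector_sadd_rdistrib vector_ssub_ldistrib vector_sub_rdistrib
    vector_smult_assoc
  sc.scale_left_distrib sc.scale_left_diff_distrib cdot_simps algebra_simps

text \<open>By invariance the three central terms carry the same scalar, so they sum to a multiple
  of K(r + s + t, r + s + t) = 0.\<close>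

lemma jacobiator_XXX: "jacobiator (X_gen x r) (X_gen y s) (X_gen z t) = 0"
proof -
  let ?m = "r + s + t" and ?c = "f x (br y z)"
  have c: "f y (br z x) = ?c" "f z (br x y) = ?c"
    using f_invariant[of y z x] f_invariant[of x y z] f_sym by metis+
  have "jacobiator (X_gen x r) (X_gen y s) (X_gen z t) =
      X_gen (br x (br y z) + br y (br z x) + br z (br x y)) ?m
      + K_gen (?c *s cvec r + ?c *s cvec s + ?c *s cvec t) ?m + D_gen 0 0"
    unfolding jacobiator_def by (simp add: gen_expand c)
  also have "\<dots> = 0"
    by (rule toroidal_eqI[OF br_jacobi K_eq_zeroI[of _ ?c]])
      (simp_all add: cvec_add vector_add_ldistrib)
  finally show ?thesis .
qed

lemma jacobiator_DXX: "jacobiator (D_gen u r) (X_gen y s) (X_gen z t) = 0"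
proof -
  let ?m = "r + s + t" and ?us = "cdot u (cvec s)" and ?ut = "cdot u (cvec t)"
  have z: "X_gen (sc c (br z y)) q = - X_gen (sc c (br y z)) q" for c q
    by (subst br_anti) (simp add: gen_minus)
  have "jacobiator (D_gen u r) (X_gen y s) (X_gen z t) =
      X_gen (sc (?us + ?ut) (br y z) - sc ?ut (br y z) - sc ?us (br y z)) ?m
      + K_gen ((?us + ?ut) *s (f y z *s cvec s) + (f y z * ?us) *s cvec r
               - (?ut * f y z) *s cvec s + (?us * f y z) *s cvec t) ?m + D_gen 0 0"
    unfolding jacobiator_def by (simp add: gen_expand z br_simps f_simps f_sym[of z y])
  also have "\<dots> = 0"
    \<comment> \<open>The terms with (u|t) cancel, and (u|s) f(y, z) multiplies each of r, s and
      t.\<close>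
    by (rule toroidal_eqI[OF _ K_eq_zeroI[of _ "f y z * ?us"]])
      (simp_all add: cvec_add vec_eq_iff algebra_simps sc.scale_left_distrib)
  finally show ?thesis .
qed

text \<open>Derivations act on loops by a representation; the cocycle term of [D, D] commutes with
  loops and drops out.\<close>

lemma jacobiator_DDX: "jacobiator (D_gen u r) (D_gen v s) (X_gen z t) = 0"
proof -
  let ?m = "r + s + t" and ?us = "cdot u (cvec s)" and ?ut = "cdot u (cvec t)"
    and ?vr = "cdot v (cvec r)" and ?vt = "cdot v (cvec t)"
  have "jacobiator (D_gen u r) (D_gen v s) (X_gen z t) =
      X_gen (sc ((?us + ?ut) * ?vt) z - sc ((?vr + ?vt) * ?ut) z - sc (?us * ?vt - ?vr * ?ut) z) ?m
      + K_gen 0 0 + D_gen 0 0"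
    unfolding jacobiator_def by (simp add: gen_expand)
  also have "\<dots> = 0"
    by (rule toroidal_eqI) (simp_all add: algebra_simps flip: sc.scale_left_distrib
      sc.scale_left_diff_distrib)
  finally show ?thesis .
qed

text \<open>The action of derivations is a representation already on one-forms, before exact forms
  are divided out. Hence the multiplier 0 in the proof.\<close>

lemma jacobiator_DDK: "jacobiator (D_gen u r) (D_gen v s) (K_gen w t) = 0"
proof -
  let ?m = "r + s + t" and ?us = "cdot u (cvec s)" and ?ut = "cdot u (cvec t)"
    and ?vr = "cdot v (cvec r)" and ?vt = "cdot v (cvec t)" and ?uw = "cdot u w"
      and ?vw = "cdot v w"
  have "jacobiator (D_gen u r) (D_gen v s) (K_gen w t) =
      X_gen 0 0
      + K_gen (((?us + ?ut) *s (?vt *s w + ?vw *s cvec s) + (?vt * ?uw + ?vw * ?us) *s cvec r)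
        - ((?vr + ?vt) *s (?ut *s w + ?uw *s cvec r) + (?ut * ?vw + ?uw * ?vr) *s cvec s)
        - ((?us * ?vt - ?vr * ?ut) *s w + (?us * ?vw - ?vr * ?uw) *s (cvec r + cvec s))) ?m
          + D_gen 0 0"
    unfolding jacobiator_def by (simp add: gen_expand)
  also have "\<dots> = 0"
    by (rule toroidal_eqI[OF _ K_eq_zeroI[of _ 0]]) (simp_all add: vec_eq_iff algebra_simps)
  finally show ?thesis .
qed

lemma jacobiator_DDD: "jacobiator (D_gen u r) (D_gen v s) (D_gen w t) = 0"
proof -
  let ?m = "r + s + t" and ?us = "cdot u (cvec s)" and ?ut = "cdot u (cvec t)"
    and ?vr = "cdot v (cvec r)" and ?vt = "cdot v (cvec t)"
    and ?wr = "cdot w (cvec r)" and ?ws = "cdot w (cvec s)"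
  \<comment> \<open>One cyclic summand, written as a function of the six pairings; rotating the
    arguments gives the other two.\<close>
  let ?D = "\<lambda>us ut vt vr wr ws u v w. (us + ut) *s (vt *s w - ws *s v) - (vt * wr - ws * vr) *s u"
  let ?K = "\<lambda>us ut vt vr wr ws r s. - (((us + ut) * (vt * wr - ws * vr)) *s r)
     - ((us + ut) *s ((vt * ws) *s s) + (vt * ws * us) *s r)"
  have "jacobiator (D_gen u r) (D_gen v s) (D_gen w t) =
      X_gen 0 0
      + K_gen (?K ?us ?ut ?vt ?vr ?wr ?ws (cvec r) (cvec s)
        + ?K ?vt ?vr ?wr ?ws ?us ?ut (cvec s) (cvec t)
          + ?K ?wr ?ws ?us ?ut ?vt ?vr (cvec t) (cvec r)) ?m
      + D_gen (?D ?us ?ut ?vt ?vr ?wr ?ws u v w + ?D ?vt ?vr ?wr ?ws ?us ?ut v w u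
          + ?D ?wr ?ws ?us ?ut ?vt ?vr w u v) ?m"
    unfolding jacobiator_def by (simp add: gen_expand)
  also have "\<dots> = 0"
    \<comment> \<open>This constant is the total coefficient of \<open>cvec r\<close>;
      \<open>cvec s\<close> and \<open>cvec t\<close> get the same one, so the cocycle terms add up
      to an exact form.\<close>
    by (rule toroidal_eqI[OF _ K_eq_zeroI[of _
          "- (?us * ?vt * ?wr) - ?ut * ?vt * ?wr
            + ?ut * ?ws * ?vr - ?vt * ?ws * ?us - ?wr * ?us * ?vr"]])
      (simp_all add: cvec_add vec_eq_iff algebra_simps)
  finally show ?thesis .
qed

text \<open>Additivity and cyclic symmetry leave five types of generators with content, treated
  above. In the types listed as \<open>trivial\<close> each of the three summands is 0.\<close>

lemma jacobiator_eq_zero: "jacobiator x y z = 0"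
proof -
  have cyc: "jacobiator a b c = 0" if "jacobiator b c a = 0 \<or> jacobiator c a b = 0" for a b c
    using that jacobiator_cyclic by metis
  note simps = jacobiator_add jacobiator_XXX jacobiator_DXX jacobiator_DDX jacobiator_DDK
    jacobiator_DDD
    cyc[OF disjI1[OF jacobiator_DXX]] cyc[OF disjI2[OF jacobiator_DXX]]
    cyc[OF disjI1[OF jacobiator_DDX]] cyc[OF disjI2[OF jacobiator_DDX]]
    cyc[OF disjI1[OF jacobiator_DDK]] cyc[OF disjI2[OF jacobiator_DDK]]
  have trivial: "jacobiator (K_gen u r) (K_gen v s) y = 0"
    "jacobiator (X_gen x t) (K_gen u r) (X_gen z q) = 0"
    "jacobiator (X_gen x t) (K_gen u r) (D_gen v s) = 0"
      "jacobiator (K_gen u r) (X_gen x t) (D_gen v s) = 0"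
    for u r v s y x t z q
    by (induction y rule: toroidal_induct) (simp_all add: jacobiator_add, simp_all add:
      jacobiator_def toroidal_br_gen toroidal_br_add)
  note trivial = trivial trivial[THEN disjI1, THEN cyc] trivial[THEN disjI2, THEN cyc]
  show ?thesis
  proof (induction x rule: toroidal_induct)
    case (X x r)
    then show ?case
      by (induction y rule: toroidal_induct; (simp add: jacobiator_add)?;
          induction z rule: toroidal_induct; simp add: simps trivial)
  next
    case (K u r)
    then show ?case
      by (induction y rule: toroidal_induct; (simp add: jacobiator_add)?;
          induction z rule: toroidal_induct; simp add: simps trivial)
  next
    case (D u r)
    then show ?case
      by (induction y rule: toroidal_induct; (simp add: jacobiator_add)?;
          induction z rule: toroidal_induct; simp add: simps trivial)
  qed (simp add: jacobiator_add)
qed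

lemma toroidal_algebra_simps [simp]:
  "carrier (toroidal_algebra sc br f) = UNIV" "x \<oplus>\<^bsub>toroidal_algebra sc br f\<^esub> y = x + y"
  "x \<otimes>\<^bsub>toroidal_algebra sc br f\<^esub> y = toroidal_br x y"
  "c \<odot>\<^bsub>toroidal_algebra sc br f\<^esub> x = toroidal_scale sc c x"
  "\<zero>\<^bsub>toroidal_algebra sc br f\<^esub> = 0"
  by (simp_all add: toroidal_algebra_def type_lie_def)

theorem lie_algebra_toroidal:
  "lie_algebra (toroidal_algebra sc br f :: (complex, ('g, 'n::finite) toroidal) module)"
proof -
  have "module complex_ring (toroidal_algebra sc br f :: (complex, ('g, 'n) toroidal) module)"
  proof (rule moduleI[OF cring_complex_ring abelian_groupI])
    fix x :: "('g, 'n) toroidal"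
    show "\<exists>y\<in>carrier (toroidal_algebra sc br f). y \<oplus>\<^bsub>toroidal_algebra sc br f\<^esub> x
      = \<zero>\<^bsub>toroidal_algebra sc br f\<^esub>"
      by (intro bexI[of _ "- x"]) auto
  qed (auto simp: algebra_simps toroidal.scale_left_distrib toroidal.scale_right_distrib)
  then show ?thesis
    by (rule lie_algebra.intro, unfold_locales)
      (auto simp: toroidal_br_add toroidal_br_scale toroidal_br_self jacobiator_eq_zero[unfolded
        jacobiator_def])
qed

end

section \<open>The invariant form\<close>

lemma mult_minus_right: "(B :: (complex, 'n::finite) vec ^ 'n) *v (- v) = - (B *v v)"
  by (simp add: vec_eq_iff matrix_vector_mult_def sum_negf)

lemma torus_der_eq: "(torus_der :: ('n::finite) vloop set) = range (\<lambda>u. mon 0 u)"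
proof
  have "vloop.subspace (range (\<lambda>u :: (complex, 'n::finite) vec. mon (0 :: (int, 'n) vec) u))"
    by (rule vloop.subspaceI)
      (auto simp: vloop_scale_single image_iff intro: exI[of _ 0] simp flip: single_add)
  then show "(torus_der :: 'n vloop set) \<subseteq> range (\<lambda>u. mon 0 u)"
    unfolding torus_der_def by (intro vloop.span_minimal) auto
  show "range (\<lambda>u. mon 0 u) \<subseteq> (torus_der :: ('n::finite) vloop set)"
  proof clarify
    fix u :: "(complex, 'n) vec"
    have "mon 0 u
        = (\<Sum>i\<in>UNIV. vloop_scale (u $ i) (mon (0 :: (int, 'n) vec) (axis i 1)))"
      by (rule poly_mapping_eqI)
        (auto simp: lookup_sum lookup_single when_def vloop_scale_single basis_expansion
          intro!: vec_eq_iff[THEN iffD2])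
    also have "\<dots> \<in> torus_der"
      unfolding torus_der_def by (intro vloop.span_sum vloop.span_scale vloop.span_base) auto
    finally show "mon 0 u \<in> (torus_der :: 'n vloop set)" .
  qed
qed

text \<open>The spanning set is homogeneous, so membership can be settled coefficient by
  coefficient. The two equivalences share their inclusions and are proved together.\<close>

lemma single_HB_iff:
  "mon r u \<in> HB B \<longleftrightarrow> r = 0 \<or> (\<exists>c. u = c *s (B *v cvec r))" (is "_ \<longleftrightarrow> ?Q")
  and HB_iff: "D \<in> HB B \<longleftrightarrow> (\<forall>r. r \<noteq> 0 \<longrightarrow> (\<exists>c. coef D r = c *s (B *v cvec r)))"
    (is "_ \<longleftrightarrow> ?R D")
proof -
  have "vloop.subspace {D. ?R D}"
  proof (rule vloop.subspaceI)
    fix x y assume "x \<in> {D. ?R D}" "y \<in> {D. ?R D}"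
    then show "x + y \<in> {D. ?R D}" by (auto simp: lookup_add) (metis vector_sadd_rdistrib)
  next
    fix c x assume "x \<in> {D. ?R D}"
    then show "vloop_scale c x \<in> {D. ?R D}" by auto
  qed (auto intro: exI[of _ 0])
  moreover have "{mon r (B *v cvec r) | r. r \<noteq> 0} \<union> torus_der \<subseteq> {D. ?R D}"
    by (auto simp: torus_der_eq lookup_single when_def) (metis vec.scale_one vector_smult_lzero)+
  ultimately have 1: "HB B \<subseteq> {D. ?R D}"
    unfolding HB_def by (rule vloop.span_minimal[rotated])
  have 2: "mon r u \<in> HB B" if *: "r = 0 \<or> (\<exists>c. u = c *s (B *v cvec r))" for r u
  proof (cases "r = 0")
    case True
    then show ?thesis unfolding HB_def by (intro vloop.span_base) (auto simp: torus_der_eq)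
  next
    case False
    then obtain c where "u = c *s (B *v cvec r)" using * by auto
    then have "mon r u = vloop_scale c (mon r (B *v cvec r))"
      by (simp add: vloop_scale_single)
    moreover have "mon r (B *v cvec r) \<in> HB B"
      unfolding HB_def using False by (intro vloop.span_base) auto
    ultimately show ?thesis unfolding HB_def by (simp add: vloop.span_scale)
  qed
  have 3: "D \<in> HB B" if "?R D" for D
  proof -
    have "D = (\<Sum>r\<in>Poly_Mapping.keys D. mon r (coef D r))"
      by (rule poly_mapping_eqI)
        (auto simp: lookup_sum lookup_single when_def in_keys_iff sum.delta)
    also have "\<dots> \<in> HB B"
      unfolding HB_def by (rule vloop.span_sum, fold HB_def) (use that 2 in blast)
    finally show ?thesis .
  qed
  show "D \<in> HB B \<longleftrightarrow> ?R D" using 1 3 by auto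
  show "mon r u \<in> HB B \<longleftrightarrow> ?Q"
  proof
    assume "mon r u \<in> HB B"
    then have "?R (mon r u)" using 1 by auto
    from this[rule_format, of r] show ?Q by auto
  qed (rule 2)
qed

lemma HB_zero: "0 \<in> HB B" and HB_add: "D \<in> HB B \<Longrightarrow> E \<in> HB B \<Longrightarrow> D + E \<in> HB B"
  and HB_scale: "D \<in> HB B \<Longrightarrow> vloop_scale c D \<in> HB B"
  and HB_minus: "D \<in> HB B \<Longrightarrow> - D \<in> HB B"
  unfolding HB_def by (simp_all add: vloop.span_zero vloop.span_add vloop.span_scale vloop.span_neg)

lemma HB_induct [consumes 1, case_names single add]:
  assumes D: "D \<in> HB B"
    and single: "\<And>r u. mon r u \<in> HB B \<Longrightarrow> P (mon r u)"
    and add: "\<And>D E. D \<in> HB B \<Longrightarrow> E \<in> HB B \<Longrightarrow> P D \<Longrightarrow> P E \<Longrightarrow> P (D + E)"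
  shows "P D"
proof -
  let ?s = "\<lambda>r. mon r (coef D r)"
  have "(\<Sum>r\<in>F. ?s r) \<in> HB B \<and> P (\<Sum>r\<in>F. ?s r)" if "finite F" for F
    using that
  proof (induction F rule: finite_induct)
    case empty
    then show ?case using single[of 0 0] by (simp add: HB_zero)
  next
    case (insert r F)
    have "?s r \<in> HB B" using D by (simp add: single_HB_iff HB_iff[of D])  blast
    then show ?case using insert by (simp add: single add HB_add)
  qed
  moreover have "D = (\<Sum>r\<in>Poly_Mapping.keys D. ?s r)"
    by (rule poly_mapping_eqI)
      (auto simp: lookup_sum lookup_single when_def in_keys_iff sum.delta)
  ultimately show ?thesis by (metis finite_keys)
qed

global_interpretation pairing: biadditive_family
  "\<lambda>(r :: (int, 'n::finite) vec) (u :: (complex, 'n) vec) s v. if r + s = 0 then cdot u v else 0"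
  by unfold_locales (simp_all add: cdot_simps)

text \<open>The constant term of the contraction of a one-form with a derivation.\<close>

definition pairing :: "('n::finite) vloop \<Rightarrow> 'n vloop \<Rightarrow> complex" where
  "pairing = bilin_ext (\<lambda>r u s v. if r + s = 0 then cdot u v else 0)"

lemmas pairing_simps = pairing.bilin_ext_simps[folded pairing_def]

lemma pairing_single_left: "pairing (mon r u) D = cdot u (coef D (- r))"
  by (induction D rule: poly_mapping_add_induct)
    (auto simp: pairing_simps cdot_simps lookup_add lookup_single when_def add_eq_0_iff)

text \<open>The value on a representative; it is independent of the representative only for \<open>D \<in> HB B\<close>.\<close>

definition kz_pairing :: "('n::finite) kz \<Rightarrow> 'n vloop \<Rightarrow> complex" where
  "kz_pairing k D = pairing (rep_kz k) D"

locale skew_matrix =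
  fixes B :: "((complex, 'n::finite) vec, 'n) vec"
  assumes skew: "transpose B = - B"
begin

lemma cdot_mult_self [simp]: "cdot (B *v u) u = 0"
  using cdot_mult_skew[OF skew, of u u] by (simp add: cdot_commute[of u])

text \<open>The fields in \<open>HB B\<close> have divergence 0. The invariance computations with
  derivations rest on this.\<close>

lemma HB_single_orthogonal: "mon r u \<in> HB B \<Longrightarrow> cdot u (cvec r) = 0"
  by (auto simp: single_HB_iff cdot_simps)

text \<open>An exact form of degree r meets only the coefficient of degree -r, a multiple of B r,
  which is orthogonal to r. In degree 0 the exact form itself is 0.\<close>

lemma pairing_exact:
  assumes "D \<in> HB B" "w \<in> exact_forms"
  shows "pairing w D = 0"
  using assms(2) unfolding exact_forms_def
proof (induction rule: vloop.span_induct_alt)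
  case base
  then show ?case by (simp add: pairing_simps)
next
  case (step c x y)
  then obtain r where x: "x = mon r (cvec r)" by auto
  have "cdot (cvec r) (coef D (- r)) = 0"
  proof (cases "r = 0")
    case False
    then obtain c where "coef D (- r) = c *s (B *v cvec (- r))"
      using assms(1) unfolding HB_iff by (metis neg_equal_0_iff_equal)
    then show ?thesis
      using cdot_mult_self[of "cvec (- r)"]
      by (simp add: cdot_simps cdot_commute[of "cvec r"])
  qed simp
  then show ?case
    using step by (simp add: x vloop_scale_single pairing_simps pairing_single_left cdot_simps)
qed

lemma kz_pairing_abs: "D \<in> HB B \<Longrightarrow> kz_pairing (abs_kz w) D = pairing w D"
proof -
  assume D: "D \<in> HB B"
  have "rep_kz (abs_kz w) - w \<in> exact_forms"
    using Quotient3_rep_abs[OF Quotient3_kz] by (simp add: exact_forms_zero)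
  from pairing_exact[OF D this] have "pairing (rep_kz (abs_kz w) - w + w) D = pairing w D"
    by (simp only: pairing_simps) simp
  then show ?thesis by (simp add: kz_pairing_def)
qed

lemma kz_pairing_K: "D \<in> HB B \<Longrightarrow> kz_pairing (K u r) D = cdot u (coef D (- r))"
  by (simp add: K_def kz_pairing_abs pairing_single_left)

lemma kz_pairing_add_left:
  "D \<in> HB B \<Longrightarrow> kz_pairing (k + l) D = kz_pairing k D + kz_pairing l D"
  by (induction k rule: kz.abs_induct; induction l rule: kz.abs_induct)
    (simp add: plus_kz.abs_eq kz_pairing_abs pairing_simps)

lemma kz_pairing_zero_left: "D \<in> HB B \<Longrightarrow> kz_pairing 0 D = 0"
  using kz_pairing_add_left[of D 0 0] by simp

lemma kz_pairing_scale_left: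
  "D \<in> HB B \<Longrightarrow> kz_pairing (kz_scale c k) D = c * kz_pairing k D"
  by (induction k rule: kz_induct)
    (simp_all add: kz_scale_K kz_pairing_K cdot_simps kz.scale_right_distrib kz_pairing_add_left
      algebra_simps)

lemma kz_pairing_add_right: "kz_pairing k (D + E) = kz_pairing k D + kz_pairing k E"
  by (simp add: kz_pairing_def pairing_simps)

lemma kz_pairing_zero_right: "kz_pairing k 0 = 0"
  by (simp add: kz_pairing_def pairing_simps)

lemma kz_pairing_minus_left: "D \<in> HB B \<Longrightarrow> kz_pairing (- k) D = - kz_pairing k D"
  using kz_pairing_add_left[of D "- k" k] by (simp add: kz_pairing_zero_left eq_neg_iff_add_eq_0)

lemma K_mem_KB: "r \<noteq> 0 \<Longrightarrow> cdot u (B *v cvec r) = 0 \<Longrightarrow> K u r \<in> KB B"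
  unfolding KB_def by (intro kz.span_base) (use cdot_mult_skew[OF skew, of u "cvec r"] in auto)

lemma kz_pairing_KB:
  assumes D: "D \<in> HB B" and k: "k \<in> KB B"
  shows "kz_pairing k D = 0"
  using k unfolding KB_def
proof (induction rule: kz.span_induct_alt)
  case base
  then show ?case using D by (simp add: kz_pairing_zero_left)
next
  case (step c x y)
  then obtain u r where x: "x = K u r" "r \<noteq> 0" "cdot (B *v u) (cvec r) = 0" by auto
  obtain d where "coef D (- r) = d *s (B *v cvec (- r))"
    using D x(2) unfolding HB_iff by (metis neg_equal_0_iff_equal)
  then have "kz_pairing x D = 0"
    using x cdot_mult_skew[OF skew, of u "cvec (- r)"] D by (simp add: kz_pairing_K cdot_simps)
  then show ?case using step D by (simp add: kz_pairing_add_left kz_pairing_scale_left)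
qed

text \<open>For the converse, a representative is split by degree. Its degree 0 part pairs with
  every constant derivation and so vanishes; in degree r \<noteq> 0, pairing with D(B(-r), -r)
  yields the defining relation of \<open>KB B\<close>.\<close>

lemma KB_iff: "k \<in> KB B \<longleftrightarrow> (\<forall>r u. mon r u \<in> HB B \<longrightarrow> kz_pairing k (mon r u) = 0)"
proof
  assume *: "\<forall>r u. mon r u \<in> HB B \<longrightarrow> kz_pairing k (mon r u) = 0"
  obtain w where k: "k = abs_kz w" by (induction k rule: kz.abs_induct) blast
  have pw: "cdot (coef w (- r)) u = 0" if "mon r u \<in> HB B" for r u
  proof -
    have "pairing w (mon r u) = cdot (coef w (- r)) u"
      by (induction w rule: poly_mapping_add_induct)
        (auto simp: pairing_simps cdot_simps lookup_add lookup_single when_def eq_neg_iff_add_eq_0)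
    then show ?thesis using * that k by (simp add: kz_pairing_abs)
  qed
  have K: "K (coef w r) r \<in> KB B" for r
  proof (cases "r = 0")
    case True
    have "coef w 0 = 0"
      by (rule cdot_nondegenerate) (use pw[of 0] in \<open>simp add: single_HB_iff\<close>)
    then show ?thesis using True by (simp add: KB_def kz.span_zero)
  next
    case False
    have "mon (- r) (B *v cvec (- r)) \<in> HB B"
      unfolding single_HB_iff by (metis vec.scale_one)
    from pw[OF this] have "cdot (coef w r) (B *v cvec (- r)) = 0" by simp
    then have "cdot (coef w r) (B *v cvec r) = 0"
      by (simp add: cdot_simps mult_minus_right)
    then show ?thesis using False by (rule K_mem_KB[rotated])
  qed
  have abs_sum: "abs_kz (\<Sum>r\<in>F. mon r (coef w r))
      = (\<Sum>r\<in>F. K (coef w r) r)" if "finite F" for F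
    using that by (induction F rule: finite_induct)
      (simp_all add: K_def zero_kz_def flip: plus_kz.abs_eq)
  have w: "w = (\<Sum>r\<in>Poly_Mapping.keys w. mon r (coef w r))"
    by (rule poly_mapping_eqI)
      (auto simp: lookup_sum lookup_single when_def in_keys_iff sum.delta)
  have "k = (\<Sum>r\<in>Poly_Mapping.keys w. K (coef w r) r)"
    by (rule trans[OF trans[OF k arg_cong[OF w, of abs_kz]] abs_sum]) simp
  also have "\<dots> \<in> KB B"
    unfolding KB_def by (rule kz.span_sum) (rule K[unfolded KB_def])
  finally show "k \<in> KB B" .
qed (use kz_pairing_KB in auto)

end

section \<open>The algebra before the quotient and its form\<close>

locale tau_data = toroidal_data sc br f + skew_matrix B
  for sc :: "complex \<Rightarrow> 'g::ab_group_add \<Rightarrow> 'g" and br f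
    and B :: "((complex, 'n::finite) vec, 'n) vec" +
  assumes nondegenerate: "nondegenerate_on (type_lie sc br) UNIV f"
begin

abbreviation P :: "('g, 'n) toroidal set" where
  "P \<equiv> UNIV \<times> UNIV \<times> HB B"

abbreviation pre :: "(complex, ('g, 'n) toroidal) module" where
  "pre \<equiv> pre_tau sc br f B"

lemma pre_simps [simp]:
  "carrier pre = P" "x \<oplus>\<^bsub>pre\<^esub> y = x + y"
  "x \<otimes>\<^bsub>pre\<^esub> y = toroidal_br x y" "c \<odot>\<^bsub>pre\<^esub> x = toroidal_scale sc c x" "\<zero>\<^bsub>pre\<^esub> = 0"
  by (simp_all add: pre_tau_def)

lemma gen_mem_pre [simp]:
  "X_gen x r \<in> P" "K_gen u r \<in> P"
  "D_gen u r \<in> P \<longleftrightarrow> mon r u \<in> HB B"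
  by (simp_all add: X_gen_def K_gen_def D_gen_def HB_zero)

lemma pre_add: "x \<in> P \<Longrightarrow> y \<in> P \<Longrightarrow> x + y \<in> P"
  by (auto simp: HB_add)

lemma pre_induct [consumes 1, case_names X K D add]:
  assumes x: "x \<in> P"
    and X: "\<And>y r. Q (X_gen y r)" and K: "\<And>u r. Q (K_gen u r)"
    and D: "\<And>u r. mon r u \<in> HB B \<Longrightarrow> Q (D_gen u r)"
    and add: "\<And>x y. x \<in> P \<Longrightarrow> y \<in> P \<Longrightarrow> Q x \<Longrightarrow> Q y \<Longrightarrow> Q (x + y)"
  shows "Q x"
proof -
  obtain p k D where x: "x = (p, k, D)" "D \<in> HB B" using x by (cases x) auto
  have "Q (p, 0, 0)"
  proof (induction p rule: poly_mapping_add_induct)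
    case (single r y)
    then show ?case using X[of y r] by (simp add: X_gen_def)
  next
    case (add a b)
    then show ?case using assms(5)[OF _ _ add] by (simp add: HB_zero)
  qed
  moreover have "Q (0, k, 0)"
  proof (induction k rule: kz_induct)
    case (K u r)
    then show ?case using assms(3)[of u r] by (simp add: K_gen_def)
  next
    case (add a b)
    then show ?case using assms(5)[OF _ _ add] by (simp add: HB_zero)
  qed
  moreover have "Q (0, 0, D)"
    using x(2)
  proof (induction D rule: HB_induct)
    case (single r u)
    then show ?case using D[of r u] by (simp add: D_gen_def)
  next
    case (add a b)
    then show ?case using assms(5)[of "(0, 0, a)" "(0, 0, b)"] by simp
  qed
  ultimately have "Q ((p, 0, 0) + ((0, k, 0) + (0, 0, D)))"
    using x(2) by (intro add) (auto simp: HB_zero)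
  then show ?thesis using x by simp
qed

text \<open>Since (B s|r) = -(B r|s), the derivation part of [D(B r, r), D(B s, s)] is (B r|s) D(B(r
  + s), r + s). In degree 0 the bracket only rescales the other factor.\<close>

lemma HB_bracket:
  assumes r: "mon r u \<in> HB B" and s: "mon s v \<in> HB B"
  shows "mon (r + s) (cdot u (cvec s) *s v - cdot v (cvec r) *s u) \<in> HB B"
proof (cases "r = 0 \<or> s = 0")
  case True
  then show ?thesis
    using r s by (auto simp: single_HB_iff) (metis vector_smult_assoc vec.scale_minus_left)+
next
  case False
  then obtain c d where c: "u = c *s (B *v cvec r)" and d: "v = d *s (B *v cvec s)"
    using r s by (auto simp: single_HB_iff)
  have "cdot (B *v cvec s) (cvec r) = - cdot (B *v cvec r) (cvec s)"
    using cdot_mult_skew[OF skew, of "cvec s" "cvec r"] by (simp add: cdot_commute)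
  then have "cdot u (cvec s) *s v - cdot v (cvec r) *s u
      = (c * d * cdot (B *v cvec r) (cvec s)) *s (B *v cvec (r + s))"
    unfolding c d
    by (simp add: cdot_simps cvec_add matrix_vector_right_distrib vec_eq_iff algebra_simps)
  then show ?thesis by (auto simp: single_HB_iff)
qed

lemma pre_bracket:
  assumes "x \<in> P" "y \<in> P"
  shows "toroidal_br x y \<in> P"
proof -
  have neg: "- z \<in> P" if "z \<in> P" for z :: "('g, 'n) toroidal"
    using that by (auto simp: HB_minus)
  have zero: "(0 :: ('g, 'n) toroidal) \<in> P" by (simp add: zero_prod_def HB_zero)
  show ?thesis
    using assms(1)
  proof (induction x rule: pre_induct)
    case (X x r)
    show ?case using assms(2)
      by (induction y rule: pre_induct) (auto simp: toroidal_br_gen toroidal_br_add simp del: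
        mem_Times_iff intro!: pre_add neg zero)
  next
    case (K u r)
    show ?case using assms(2)
      by (induction y rule: pre_induct) (auto simp: toroidal_br_gen toroidal_br_add simp del:
        mem_Times_iff intro!: pre_add neg zero)
  next
    case (D u r)
    show ?case using assms(2)
    proof (induction y rule: pre_induct)
      case (D v s)
      show ?case
        unfolding toroidal_br_gen diff_conv_add_uminus[of "D_gen _ _"]
        using HB_bracket[OF \<open>mon r u \<in> HB B\<close> D]
        by (intro pre_add neg) (simp_all del: mem_Times_iff)
    qed (auto simp: toroidal_br_gen toroidal_br_add simp del: mem_Times_iff intro!: pre_add neg
      zero)
  next
    case (add a b)
    then show ?case unfolding toroidal_br_add by (intro pre_add)
  qed
qed

lemma pre_scale: "x \<in> P \<Longrightarrow> toroidal_scale sc c x \<in> P"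
  by (auto simp: HB_scale)

lemma lie_algebra_pre: "lie_algebra pre"
proof -
  interpret T: lie_algebra "toroidal_algebra sc br f :: (complex, ('g, 'n) toroidal) module"
    by (rule lie_algebra_toroidal)
  have "T.subspace P"
    by (rule T.subspaceI) (auto simp: HB_add HB_zero HB_scale zero_prod_def)
  then have "lie_subalgebra (toroidal_algebra sc br f) P"
    unfolding lie_subalgebra_def using pre_bracket by simp
  from T.lie_algebra_subalgebra[OF this] show ?thesis unfolding pre_tau_def .
qed

sublocale loop_form: biadditive_family
  "\<lambda>r x s y. if r + s = (0 :: (int, 'n) vec) then f x y else 0"
  by unfold_locales (simp_all add: f_simps)

definition loop_form :: "('g, 'n) loop \<Rightarrow> ('g, 'n) loop \<Rightarrow> complex" where
  "loop_form = bilin_ext (\<lambda>r x s y. if r + s = 0 then f x y else 0)"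

lemmas loop_form_simps = loop_form.bilin_ext_simps[folded loop_form_def]

definition pre_form :: "('g, 'n) toroidal \<Rightarrow> ('g, 'n) toroidal \<Rightarrow> complex" where
  "pre_form x y = loop_form (fst x) (fst y)
     + kz_pairing (fst (snd x)) (snd (snd y)) + kz_pairing (fst (snd y)) (snd (snd x))"

lemma pre_form_add:
  assumes "x \<in> P" "y \<in> P" "z \<in> P"
  shows "pre_form (x + y) z = pre_form x z + pre_form y z"
    "pre_form z (x + y) = pre_form z x + pre_form z y"
  using assms
  by (auto simp: pre_form_def loop_form_simps kz_pairing_add_left kz_pairing_add_right)

lemma pre_form_sym: "pre_form x y = pre_form y x"
proof -
  have "loop_form p q = loop_form q p" for p q
  proof (induction p rule: poly_mapping_add_induct)
    case (single r x)
    show ?case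
      by (induction q rule: poly_mapping_add_induct)
        (auto simp: loop_form_simps f_sym add.commute)
  qed (simp add: loop_form_simps)
  then show ?thesis unfolding pre_form_def by (simp add: algebra_simps)
qed

lemma pre_form_gen:
  "pre_form (X_gen x r) (X_gen y s) = (if r + s = 0 then f x y else 0)"
  "pre_form (X_gen x r) (K_gen v s) = 0"
  "mon s v \<in> HB B \<Longrightarrow> pre_form (X_gen x r) (D_gen v s) = 0"
  "pre_form (K_gen u r) (X_gen y s) = 0"
  "pre_form (K_gen u r) (K_gen v s) = 0"
  "mon s v \<in> HB B \<Longrightarrow>
    pre_form (K_gen u r) (D_gen v s) = (if r + s = 0 then cdot u v else 0)"
  "mon r u \<in> HB B \<Longrightarrow> pre_form (D_gen u r) (X_gen y s) = 0"
  "mon r u \<in> HB B \<Longrightarrow>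
    pre_form (D_gen u r) (K_gen v s) = (if r + s = 0 then cdot u v else 0)"
  "mon r u \<in> HB B \<Longrightarrow> mon s v \<in> HB B \<Longrightarrow>
    pre_form (D_gen u r) (D_gen v s) = 0"
  by (simp_all add: pre_form_def X_gen_def K_gen_def D_gen_def loop_form_simps kz_pairing_K
      kz_pairing_zero_left kz_pairing_zero_right HB_zero lookup_single when_def cdot_commute[of v
        u] eq_neg_iff_add_eq_0 add.commute)

lemma pre_form_scale:
  assumes "x \<in> P" "y \<in> P"
  shows "pre_form (toroidal_scale sc c x) y = c * pre_form x y"
  using assms(1)
proof (induction x rule: pre_induct)
  case (add a b)
  then show ?case
    using assms(2) by (simp add: toroidal.scale_right_distrib pre_form_add pre_scale algebra_simps
      del: mem_Times_iff)
next
  case (X x r)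
  show ?case using assms(2)
    by (induction y rule: pre_induct)
      (auto simp: toroidal_scale_gen pre_form_gen pre_form_add f_simps algebra_simps simp del:
        mem_Times_iff)
next
  case (K u r)
  show ?case using assms(2)
    by (induction y rule: pre_induct)
      (auto simp: toroidal_scale_gen pre_form_gen pre_form_add cdot_simps algebra_simps simp del:
        mem_Times_iff)
next
  case (D u r)
  then have "mon r (c *s u) \<in> HB B"
    using HB_scale[OF D, of c] by (simp add: vloop_scale_single)
  with D have D': "mon r u \<in> HB B" "mon r (c *s u) \<in> HB B" by auto
  show ?case using assms(2)
    by (induction y rule: pre_induct)
      (auto simp: D' toroidal_scale_gen pre_form_gen pre_form_add cdot_simps algebra_simps simp
        del: mem_Times_iff)
qed

lemma zero_mem_pre [simp]: "(0 :: ('g, 'n) toroidal) \<in> P"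
  by (simp add: zero_prod_def HB_zero)

lemma pre_form_zero:
  assumes "x \<in> P"
  shows "pre_form 0 x = 0" "pre_form x 0 = 0"
  using pre_form_add[OF zero_mem_pre zero_mem_pre assms] by simp_all

lemma pre_minus: "x \<in> P \<Longrightarrow> - x \<in> P"
  by (auto simp: HB_minus)

lemma pre_form_minus:
  assumes "x \<in> P" "y \<in> P"
  shows "pre_form (- x) y = - pre_form x y" "pre_form y (- x) = - pre_form y x"
  using pre_form_add[OF pre_minus[OF assms(1)] assms] pre_form_zero[OF assms(2)]
  by (simp_all add: eq_neg_iff_add_eq_0)

lemma pre_form_diff:
  assumes "x \<in> P" "y \<in> P" "z \<in> P"
  shows "pre_form (x - y) z = pre_form x z - pre_form y z"
    "pre_form z (x - y) = pre_form z x - pre_form z y"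
  using pre_form_add[OF assms(1) pre_minus[OF assms(2)] assms(3)] pre_form_minus[OF assms(2,3)]
  by simp_all

section \<open>Invariance of the form, by types of generators\<close>

definition inv_defect :: "('g, 'n) toroidal \<Rightarrow> ('g, 'n) toroidal \<Rightarrow> ('g, 'n) toroidal \<Rightarrow> complex" where
  "inv_defect x y z = pre_form (toroidal_br x y) z - pre_form x (toroidal_br y z)"

lemma inv_defect_add:
  assumes "x \<in> P" "x' \<in> P" "y \<in> P" "z \<in> P"
  shows "inv_defect (x + x') y z = inv_defect x y z + inv_defect x' y z"
    "inv_defect y (x + x') z = inv_defect y x z + inv_defect y x' z"
    "inv_defect y z (x + x') = inv_defect y z x + inv_defect y z x'"
  using assms
  by (simp_all add: inv_defect_def toroidal_br_add pre_form_add pre_bracket pre_add del: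
    mem_Times_iff)

lemma sum_eq_zero_iff3: "(r :: (int, 'n) vec) + s + t = 0 \<longleftrightarrow> t = - r - s"
  using add_eq_0_iff[of "r + s" t] by simp

lemmas pre_form_expand = toroidal_br_gen pre_form_gen pre_form_add pre_form_minus pre_form_zero
  pre_form_diff pre_minus HB_bracket

lemma inv_defect_XXX: "inv_defect (X_gen x r) (X_gen y s) (X_gen z t) = 0"
  unfolding inv_defect_def
  by (simp add: pre_form_expand add.assoc f_invariant del: mem_Times_iff)

text \<open>A nonzero pairing requires r + s + t = 0. Then (w|t) = 0 becomes (w|s) = -(w|r), which
  matches the central term of the loop bracket with the action of D on loops.\<close>

lemma inv_defect_XXD:
  assumes w: "mon t w \<in> HB B"
  shows "inv_defect (X_gen x r) (X_gen y s) (D_gen w t) = 0"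
    "inv_defect (X_gen x r) (D_gen w t) (X_gen y s) = 0"
    "inv_defect (D_gen w t) (X_gen x r) (X_gen y s) = 0"
proof -
  have c: "r + s + t = 0 \<longleftrightarrow> t = - r - s" "r + (t + s) = 0 \<longleftrightarrow> t = - r - s"
    "t + r + s = 0 \<longleftrightarrow> t = - r - s" "t + (r + s) = 0 \<longleftrightarrow> t = - r - s"
    by (simp_all add: add_ac flip: sum_eq_zero_iff3)
  have o: "cdot w (cvec s) = - cdot w (cvec r)" if "t = - r - s"
    using HB_single_orthogonal[OF w] unfolding that by (simp add: cdot_simps)
  show "inv_defect (X_gen x r) (X_gen y s) (D_gen w t) = 0"
    "inv_defect (X_gen x r) (D_gen w t) (X_gen y s) = 0"
    "inv_defect (D_gen w t) (X_gen x r) (X_gen y s) = 0"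
    unfolding inv_defect_def using w
    by (simp_all add: pre_form_expand c f_simps cdot_simps o cdot_commute[of _ w] del:
      mem_Times_iff)
qed

lemma inv_defect_DDK:
  assumes r: "mon r u \<in> HB B" and s: "mon s v \<in> HB B"
  shows "inv_defect (D_gen u r) (D_gen v s) (K_gen w t) = 0"
    "inv_defect (D_gen u r) (K_gen w t) (D_gen v s) = 0"
    "inv_defect (K_gen w t) (D_gen u r) (D_gen v s) = 0"
proof -
  have c: "r + (s + t) = 0 \<longleftrightarrow> r + s + t = 0" "t + r + s = 0 \<longleftrightarrow> r + s + t = 0"
    "t + (r + s) = 0 \<longleftrightarrow> r + s + t = 0" "r + t + s = 0 \<longleftrightarrow> r + s + t = 0"
    "r + (t + s) = 0 \<longleftrightarrow> r + s + t = 0" "s + t + r = 0 \<longleftrightarrow> r + s + t = 0"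
    by (simp_all add: add_ac)
  have o: "cdot u (cvec t) = - cdot u (cvec s)" "cdot v (cvec t) = - cdot v (cvec r)"
    if "r + s + t = 0"
    using HB_single_orthogonal[OF r] HB_single_orthogonal[OF s] that
    by (simp_all add: sum_eq_zero_iff3 cdot_simps)
  show "inv_defect (D_gen u r) (D_gen v s) (K_gen w t) = 0"
    "inv_defect (D_gen u r) (K_gen w t) (D_gen v s) = 0"
    "inv_defect (K_gen w t) (D_gen u r) (D_gen v s) = 0"
    unfolding inv_defect_def using r s HB_single_orthogonal[OF r] HB_single_orthogonal[OF s]
    by (simp_all add: pre_form_expand c cdot_simps o cdot_commute[of _ v] cdot_commute[of _ u]
        del: mem_Times_iff)
qed

text \<open>Derivations are isotropic, so only the cocycle contributes. Both sides contain (u|s),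
  and replacing (v|t) by -(v|r) and (w|s) by -(w|r) identifies them.\<close>

lemma inv_defect_DDD:
  assumes r: "mon r u \<in> HB B" and s: "mon s v \<in> HB B"
    and t: "mon t w \<in> HB B"
  shows "inv_defect (D_gen u r) (D_gen v s) (D_gen w t) = 0"
proof -
  have c: "r + (s + t) = 0 \<longleftrightarrow> r + s + t = 0" by (simp add: add_ac)
  have o: "cdot v (cvec t) = - cdot v (cvec r)" "cdot w (cvec s) = - cdot w (cvec r)"
    if "r + s + t = 0"
    using HB_single_orthogonal[OF s] HB_single_orthogonal[OF t] that
    by (simp_all add: sum_eq_zero_iff3 cdot_simps)
  show ?thesis
    unfolding inv_defect_def using r s t
    by (simp add: pre_form_expand c cdot_simps o cdot_commute[of _ w] cdot_commute[of "cvec _" u]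
        del: mem_Times_iff)
qed

lemma inv_defect_eq_zero:
  assumes "x \<in> P" "y \<in> P" "z \<in> P"
  shows "inv_defect x y z = 0"
proof -
  note trivial = inv_defect_def pre_form_expand
  note [simp del] = mem_Times_iff
  note nontrivial = inv_defect_XXX inv_defect_XXD inv_defect_DDK inv_defect_DDD
  \<comment> \<open>Additivity is used in one argument at a time: here the last two are generators,
    in \<open>gen1\<close> only the last. For triples outside the lemmas above both sides of the
    identity are 0, because their kinds do not pair.\<close>
  have gen2: "inv_defect x y z = 0"
    if "x \<in> P" "(\<exists>a r. y = X_gen a r) \<or> (\<exists>u r. y = K_gen u r) \<or> (\<exists>u r. y = D_gen u r
      \<and> mon r u \<in> HB B)"
      "(\<exists>a r. z = X_gen a r) \<or> (\<exists>u r. z = K_gen u r) \<or> (\<exists>u r. z = D_gen u r \<and> mon r u \<in> HB B)"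
    for x y z
    using that(1)
  proof (induction x rule: pre_induct)
    case (add a b)
    show ?case using that(2,3) add by (elim exE disjE conjE; simp add: inv_defect_add)
  qed (use that(2,3) in \<open>(elim exE disjE conjE; simp add: nontrivial; simp add: trivial)+\<close>)
  have gen1: "inv_defect x y z = 0"
    if "x \<in> P" "y \<in> P"
      and z: "(\<exists>a r. z = X_gen a r) \<or> (\<exists>u r. z = K_gen u r) \<or> (\<exists>u r. z = D_gen u r
        \<and> mon r u \<in> HB B)"
    for x y z
    using that(2)
  proof (induction y rule: pre_induct)
    case (add a b)
    show ?case using that(1) z add by (elim exE disjE conjE; simp add: inv_defect_add)
  qed (rule gen2[OF that(1) _ z], blast)+
  show ?thesis
    using assms(3)
  proof (induction z rule: pre_induct)
    case (add a b)
    then show ?case using assms(1,2) by (simp add: inv_defect_add)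
  qed (rule gen1[OF assms(1,2)], blast)+
qed

lemma invariant_pre_form: "invariant_symmetric_form pre pre_form"
  unfolding invariant_symmetric_form_def
  using inv_defect_eq_zero
  by (auto simp: pre_form_add(1) pre_form_scale inv_defect_def simp del: mem_Times_iff intro:
    pre_form_sym)

text \<open>Each part is detected by one kind of generator: the loop part by loops, as
  \<open>f\<close> is nondegenerate; the derivation part by K(u, r) with unrestricted u; the central
  part by \<open>HB B\<close>, through \<open>KB_iff\<close>.\<close>

lemma radical_pre_form: "form_radical pre pre_form = {0} \<times> KB B \<times> {0}"
proof (rule Set.set_eqI)
  fix x :: "('g, 'n) toroidal"
  obtain p k D where x: "x = (p, k, D)" by (cases x)
  have loop_form_single: "loop_form p (mon s y) = f (coef p (- s)) y" for s y
    by (induction p rule: poly_mapping_add_induct)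
      (auto simp: loop_form_simps f_simps lookup_add lookup_single when_def eq_neg_iff_add_eq_0)
  show "x \<in> form_radical pre pre_form \<longleftrightarrow> x \<in> {0} \<times> KB B \<times> {0}"
  proof
    assume rad: "x \<in> form_radical pre pre_form"
    then have D: "D \<in> HB B" and rad: "\<And>y. y \<in> P \<Longrightarrow> pre_form x y = 0"
      by (auto simp: form_radical_def x)
    have "p = 0"
    proof (rule poly_mapping_eqI)
      fix r
      have "f (coef p r) y = 0" for y
        using rad[of "X_gen y (- r)"] D
        by (simp add: x X_gen_def pre_form_def loop_form_single kz_pairing_zero_left
          kz_pairing_zero_right HB_zero)
      then show "coef p r = coef 0 r"
        using nondegenerate unfolding nondegenerate_on_def by simp
    qed
    moreover have "D = 0"
    proof (rule poly_mapping_eqI)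
      fix r
      have "cdot (coef D r) u = 0" for u
        using rad[of "K_gen u (- r)"] D
        by (simp add: x K_gen_def pre_form_def loop_form_simps kz_pairing_zero_right kz_pairing_K
          HB_zero cdot_commute)
      then show "coef D r = coef 0 r"
        using cdot_nondegenerate[of "coef D r"] by simp
    qed
    moreover have "k \<in> KB B"
      unfolding KB_iff
    proof (intro allI impI)
      fix r u assume "mon r u \<in> HB B"
      then show "kz_pairing k (mon r u) = 0"
        using rad[of "D_gen u r"] D
        by (simp add: x D_gen_def pre_form_def loop_form_simps kz_pairing_zero_left)
    qed
    ultimately show "x \<in> {0} \<times> KB B \<times> {0}" by (simp add: x)
  next
    assume "x \<in> {0} \<times> KB B \<times> {0}"
    then show "x \<in> form_radical pre pre_form"
      by (auto simp: form_radical_def x HB_zero pre_form_def loop_form_simps kz_pairing_KB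
        kz_pairing_zero_right)
  qed
qed

sublocale pre: lie_quotient pre "{0} \<times> KB B \<times> {0}"
  using lie_algebra_pre lie_algebra.lie_ideal_form_radical[OF lie_algebra_pre invariant_pre_form]
  unfolding radical_pre_form by (intro lie_quotient.intro lie_quotient_axioms.intro)

end

section \<open>The algebra \<open>\<tau>\<^sub>B\<close>\<close>

lemma pairing_single_right:
  "pairing w (mon r u) = cdot (coef w (- r)) u"
  by (induction w rule: poly_mapping_add_induct)
    (auto simp: pairing_simps cdot_simps lookup_add lookup_single when_def eq_neg_iff_add_eq_0)

lemma cvec_eq_iff [simp]: "cvec r = cvec s \<longleftrightarrow> r = s"
  by (simp add: cvec_def vec_eq_iff)

lemma zero_mem_GB_iff: "r \<notin> GB B \<Longrightarrow> r \<noteq> 0"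
  by (auto simp: GB_def)

context tau_data
begin

abbreviation \<tau> :: "(complex, ('g, 'n) toroidal set) module" where
  "\<tau> \<equiv> tau sc br f B"

abbreviation proj :: "('g, 'n) toroidal \<Rightarrow> ('g, 'n) toroidal set" where
  "proj \<equiv> tau_proj sc br f B"

declare mem_Times_iff [simp del]

lemmas pre_closed = pre_add pre_minus pre_bracket pre_scale

lemma tau_carrier: "carrier \<tau> = proj ` P"
  unfolding tau_def tau_proj_def pre.carrier_quot by simp

lemma proj_closed [simp]: "x \<in> P \<Longrightarrow> proj x \<in> carrier \<tau>"
  by (simp add: tau_carrier)

lemma proj_add: "x \<in> P \<Longrightarrow> y \<in> P \<Longrightarrow> proj x \<oplus>\<^bsub>\<tau>\<^esub> proj y = proj (x + y)"
  using pre.add_quot[of x y] unfolding tau_def tau_proj_def by simp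

lemma proj_bracket: "x \<in> P \<Longrightarrow> y \<in> P \<Longrightarrow> proj x \<otimes>\<^bsub>\<tau>\<^esub> proj y = proj (toroidal_br x y)"
  using pre.bracket_quot[of x y] unfolding tau_def tau_proj_def by simp

lemma proj_scale: "x \<in> P \<Longrightarrow> c \<odot>\<^bsub>\<tau>\<^esub> proj x = proj (toroidal_scale sc c x)"
  using pre.scale_quot[of x c] unfolding tau_def tau_proj_def by simp

lemma proj_zero: "\<zero>\<^bsub>\<tau>\<^esub> = proj 0"
  using pre.coset_zero pre.zero_quot unfolding tau_def tau_proj_def by simp

sublocale T: lie_algebra \<tau>
  unfolding tau_def by (rule pre.lie_algebra_quot)

lemma pre_diff: "x \<in> P \<Longrightarrow> y \<in> P \<Longrightarrow> x \<ominus>\<^bsub>pre\<^esub> y = x - y"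
proof -
  assume xy: "x \<in> P" "y \<in> P"
  have "\<ominus>\<^bsub>pre\<^esub> y = - y"
    using xy pre.M.minus_equality[of "- y" y] by (simp add: pre_minus)
  then show ?thesis by (simp add: a_minus_def)
qed

lemma proj_eq_iff:
  "x \<in> P \<Longrightarrow> y \<in> P \<Longrightarrow> proj x = proj y \<longleftrightarrow>
     fst x = fst y \<and> fst (snd x) - fst (snd y) \<in> KB B \<and> snd (snd x) = snd (snd y)"
  using pre.coset_eq_iff[of x y] unfolding tau_proj_def
  by (cases x; cases y) (auto simp: pre_diff)

lemma proj_eq_zero_iff:
  "x \<in> P \<Longrightarrow> proj x = \<zero>\<^bsub>\<tau>\<^esub> \<longleftrightarrow> fst x = 0 \<and> fst (snd x) \<in> KB B \<and> snd (snd x) = 0"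
  unfolding proj_zero using proj_eq_iff[of x 0] by simp

text \<open>By the annihilator property it suffices to pair with degree -r of \<open>HB B\<close>:
  all vectors for r = 0, the line through B r otherwise.\<close>

lemma K_mem_KB_iff: "K u r \<in> KB B \<longleftrightarrow> (if r = 0 then u = 0 else cdot u (B *v cvec r) = 0)"
proof (cases "r = 0")
  case True
  have "u = 0" if "K u 0 \<in> KB B"
  proof (rule cdot_nondegenerate)
    fix v
    have v: "mon 0 v \<in> HB B" by (simp add: single_HB_iff)
    with that have "kz_pairing (K u 0) (mon 0 v) = 0" unfolding KB_iff by blast
    then show "cdot u v = 0" using v by (simp add: kz_pairing_K)
  qed
  moreover have "K 0 0 \<in> KB B" using kz.span_zero unfolding KB_def by simp
  ultimately show ?thesis using True by auto
next
  case False
  have "cdot u (B *v cvec r) = 0" if K: "K u r \<in> KB B"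
  proof -
    have v: "mon (- r) (B *v cvec (- r)) \<in> HB B"
      unfolding single_HB_iff by (metis vec.scale_one)
    with K have "kz_pairing (K u r) (mon (- r) (B *v cvec (- r))) = 0"
      unfolding KB_iff by blast
    then show ?thesis using v by (simp add: kz_pairing_K cdot_simps mult_minus_right)
  qed
  then show ?thesis using K_mem_KB[OF False] False by auto
qed

lemma gen_fst_snd [simp]:
  "fst (X_gen x r) = mon r x" "fst (K_gen u r) = 0" "fst (D_gen u r) = 0"
  "fst (snd (X_gen x r)) = 0" "fst (snd (K_gen u r)) = K u r" "fst (snd (D_gen u r)) = 0"
  "snd (snd (X_gen x r)) = 0" "snd (snd (K_gen u r)) = 0" "snd (snd (D_gen u r)) = mon r u"
  by (simp_all add: X_gen_def K_gen_def D_gen_def)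

lemma single_eq_zero_iff [simp]: "mon r u = 0 \<longleftrightarrow> u = 0"
  by (metis lookup_single_eq lookup_zero single_zero)

lemma KB_zero [simp]: "0 \<in> KB B"
  unfolding KB_def by (rule kz.span_zero)

section \<open>Dimensions of the homogeneous components\<close>

lemma tau_Z_deg_eq: "tau_Z_deg sc br f B r = range (\<lambda>u. proj (K_gen u r))"
  by (auto simp: tau_Z_deg_def K_gen_def)

lemma tau_H_deg_eq:
  "tau_H_deg sc br f B r = (\<lambda>u. proj (D_gen u r)) ` {u. mon r u \<in> HB B}"
proof -
  have "D = mon r (coef D r)" if "Poly_Mapping.keys D \<subseteq> {r}" for D :: "'n vloop"
    using that by (intro poly_mapping_eqI) (auto simp: lookup_single when_def in_keys_iff)
  then have "{(0, 0, D) | D. D \<in> HB B \<and> Poly_Mapping.keys D \<subseteq> {r}}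
      = (\<lambda>u. D_gen u r :: ('g, 'n) toroidal) ` {u. mon r u \<in> HB B}"
    by (auto simp: D_gen_def image_iff) metis
  then show ?thesis by (simp add: tau_H_deg_def image_image)
qed

lemma independent_axes:
  "vector_space ((*s) :: complex \<Rightarrow> complex ^ 'n \<Rightarrow> complex ^ 'n)"
  "finite (range (\<lambda>i. axis i 1 :: complex ^ 'n))"
    "vec.span (range (\<lambda>i. axis i 1 :: complex ^ 'n)) = UNIV"
  "\<not> vec.dependent (range (\<lambda>i. axis i 1 :: complex ^ 'n))"
    "card (range (\<lambda>i. axis i 1 :: complex ^ 'n)) = CARD('n)"
proof -
  have *: "range (\<lambda>i. axis i 1 :: complex ^ 'n) = cart_basis" by (auto simp: cart_basis_def)
  show "vec.span (range (\<lambda>i. axis i 1 :: complex ^ 'n)) = UNIV"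
    "\<not> vec.dependent (range (\<lambda>i. axis i 1 :: complex ^ 'n))"
      "card (range (\<lambda>i. axis i 1 :: complex ^ 'n)) = CARD('n)"
    unfolding * by (simp_all add: span_cart_basis independent_cart_basis card_cart_basis)
qed (simp_all add: vec.vector_space_axioms)

lemma has_dim_one:
  assumes "\<And>c. \<phi> c \<in> carrier \<tau>" "\<And>c d. \<phi> (c + d) = \<phi> c \<oplus>\<^bsub>\<tau>\<^esub> \<phi> d" "\<And>c d. \<phi> (c * d) = c \<odot>\<^bsub>\<tau>\<^esub> \<phi> d"
    "\<And>c. \<phi> c = \<zero>\<^bsub>\<tau>\<^esub> \<Longrightarrow> c = 0"
  shows "has_dim \<tau> (range \<phi>) 1"
proof -
  have "vector_space_over_itself.span {1 :: complex} = UNIV"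
    by (auto simp: vector_space_over_itself.span_singleton image_iff)
  moreover have "\<not> vector_space_over_itself.dependent {1 :: complex}" by simp
  ultimately show ?thesis
    using T.has_dim_injective_image[OF vector_space_over_itself.vector_space_axioms assms, of
      "{1}"] by simp
qed

lemma dim_Z_GB: "r \<noteq> 0 \<Longrightarrow> r \<in> GB B \<Longrightarrow> has_dim \<tau> (tau_Z_deg sc br f B r) 0"
proof -
  assume r: "r \<noteq> 0" "r \<in> GB B"
  then have "proj (K_gen u r) = \<zero>\<^bsub>\<tau>\<^esub>" for u
    by (simp add: proj_eq_zero_iff K_mem_KB_iff GB_def)
  then have "tau_Z_deg sc br f B r = {\<zero>\<^bsub>\<tau>\<^esub>}" by (auto simp: tau_Z_deg_eq)
  then show ?thesis using T.has_dim_zero by simp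
qed

text \<open>The functional w \<mapsto> (w|B r) is nonzero and its kernel is what \<open>KB B\<close>
  removes in degree r. Normalizing (u|B r) = 1 makes K(u, r) a basis of the quotient.\<close>

lemma dim_Z_nonGB:
  assumes r: "r \<notin> GB B"
  shows "has_dim \<tau> (tau_Z_deg sc br f B r) 1"
proof -
  have r0: "r \<noteq> 0" using zero_mem_GB_iff[OF r] .
  let ?b = "B *v cvec r"
  have "?b \<noteq> 0" using r by (simp add: GB_def)
  then obtain v where "cdot ?b v \<noteq> 0" using cdot_nondegenerate by blast
  define u where "u = (1 / cdot ?b v) *s v"
  have u: "cdot u ?b = 1"
    using \<open>cdot ?b v \<noteq> 0\<close> by (simp add: u_def cdot_simps cdot_commute[of v])
  let ?\<phi> = "\<lambda>c. proj (K_gen (c *s u) r)"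
  have "proj (K_gen w r) = ?\<phi> (cdot w ?b)" for w
  proof -
    have "K w r - K (cdot w ?b *s u) r = K (w - cdot w ?b *s u) r"
      using K_add[of w "- (cdot w ?b *s u)" r] by (simp add: K_minus)
    then show ?thesis using r0 u by (simp add: proj_eq_iff K_mem_KB_iff cdot_simps)
  qed
  then have "tau_Z_deg sc br f B r = range ?\<phi>" by (auto simp: tau_Z_deg_eq)
  moreover have "has_dim \<tau> (range ?\<phi>) 1"
  proof (rule has_dim_one)
    show "c = 0" if "?\<phi> c = \<zero>\<^bsub>\<tau>\<^esub>" for c
      using that u r0 by (simp add: proj_eq_zero_iff K_mem_KB_iff cdot_simps)
  qed (simp_all add: proj_add proj_scale toroidal_scale_gen vector_smult_assoc flip: gen_add)
  ultimately show ?thesis by simp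
qed

lemma dim_Z_zero: "has_dim \<tau> (tau_Z_deg sc br f B 0) CARD('n)"
  unfolding tau_Z_deg_eq independent_axes(5)[symmetric]
  by (rule T.has_dim_injective_image[OF independent_axes(1)])
    (simp_all add: proj_add proj_scale toroidal_scale_gen proj_eq_zero_iff K_mem_KB_iff
      independent_axes gen_add(2)[symmetric])

lemma dim_H_GB: "r \<noteq> 0 \<Longrightarrow> r \<in> GB B \<Longrightarrow> has_dim \<tau> (tau_H_deg sc br f B r) 0"
proof -
  assume r: "r \<noteq> 0" "r \<in> GB B"
  then have "{u. mon r u \<in> HB B} = {0}"
    by (auto simp: single_HB_iff GB_def)
  then show ?thesis using T.has_dim_zero by (simp add: tau_H_deg_eq proj_zero)
qed

lemma dim_H_nonGB:
  assumes r: "r \<notin> GB B"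
  shows "has_dim \<tau> (tau_H_deg sc br f B r) 1"
proof -
  let ?\<phi> = "\<lambda>c. proj (D_gen (c *s (B *v cvec r)) r)"
  have mem: "mon r (c *s (B *v cvec r)) \<in> HB B" for c
    by (auto simp: single_HB_iff)
  have "{u. mon r u \<in> HB B} = range (\<lambda>c. c *s (B *v cvec r))"
    using zero_mem_GB_iff[OF r] by (auto simp: single_HB_iff)
  then have "tau_H_deg sc br f B r = range ?\<phi>" by (auto simp: tau_H_deg_eq)
  moreover have "has_dim \<tau> (range ?\<phi>) 1"
  proof (rule has_dim_one)
    show "c = 0" if "?\<phi> c = \<zero>\<^bsub>\<tau>\<^esub>" for c
      using that r mem[of c] by (simp add: proj_eq_zero_iff GB_def)
  qed (simp_all add: mem proj_add proj_scale toroidal_scale_gen vector_smult_assoc flip: gen_add)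
  ultimately show ?thesis by simp
qed

lemma single_zero_HB [simp]: "mon 0 u \<in> HB B"
  by (simp add: single_HB_iff)

lemma dim_H_zero: "has_dim \<tau> (tau_H_deg sc br f B 0) CARD('n)"
proof -
  have eq: "tau_H_deg sc br f B 0 = range (\<lambda>u. proj (D_gen u 0))" by (simp add: tau_H_deg_eq)
  show ?thesis
    unfolding eq independent_axes(5)[symmetric]
    by (rule T.has_dim_injective_image[OF independent_axes(1)])
      (simp_all add: proj_add proj_scale toroidal_scale_gen proj_eq_zero_iff
        independent_axes gen_add(3)[symmetric])
qed

end

subsection \<open>Roots\<close>

locale simple_tau_data = tau_data sc br f B + g: simple_split_lie_algebra "type_lie sc br" h f
  for sc :: "complex \<Rightarrow> 'g::ab_group_add \<Rightarrow> 'g" and br f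
    and B :: "((complex, 'n::finite) vec, 'n) vec" and h :: "'g set"
begin

abbreviation \<g> :: "(complex, 'g) module" where
  "\<g> \<equiv> type_lie sc br"

abbreviation H :: "('g, 'n) toroidal set set" where
  "H \<equiv> tau_cartan sc br f B h"

definition E :: "'g \<Rightarrow> complex ^ 'n \<Rightarrow> complex ^ 'n \<Rightarrow> ('g, 'n) toroidal" where
  "E x w u = X_gen x 0 + K_gen w 0 + D_gen u 0"

lemma span_K0: "kz.span (range (\<lambda>i. K (axis i 1) 0)) = range (\<lambda>w :: complex ^ 'n. K w 0)"
proof
  have "kz.subspace (range (\<lambda>w :: complex ^ 'n. K w 0))"
    by (rule kz.subspaceI)
      (auto simp: kz_scale_K image_iff intro: exI[of _ 0] simp flip: K_add)
  then show "kz.span (range (\<lambda>i. K (axis i 1) 0)) \<subseteq> range (\<lambda>w :: complex ^ 'n. K w 0)"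
    by (intro kz.span_minimal) auto
  show "range (\<lambda>w :: complex ^ 'n. K w 0) \<subseteq> kz.span (range (\<lambda>i. K (axis i 1) 0))"
  proof clarify
    fix w :: "complex ^ 'n"
    have "K (\<Sum>i\<in>F. w $ i *s axis i 1) 0 = (\<Sum>i\<in>F. kz_scale (w $ i) (K (axis i 1) 0))"
      if "finite F" for F
      using that by (induction F rule: finite_induct) (simp_all add: K_add kz_scale_K)
    from this[of UNIV] have "K w 0 = (\<Sum>i\<in>UNIV. kz_scale (w $ i) (K (axis i 1) 0))"
      by (simp only: basis_expansion finite)
    also have "\<dots> \<in> kz.span (range (\<lambda>i. K (axis i 1) 0))"
      by (intro kz.span_sum kz.span_scale kz.span_base) auto
    finally show "K w 0 \<in> kz.span (range (\<lambda>i. K (axis i 1) 0))" .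
  qed
qed

lemma E_mem [simp]: "E x w u \<in> P"
  unfolding E_def by (intro pre_add) simp_all

lemma E_fst_snd [simp]: "fst (E x w u) = mon 0 x" "fst (snd (E x w u)) = K w 0"
  "snd (snd (E x w u)) = mon 0 u"
  by (simp_all add: E_def)

lemma E_add: "E x w u + E x' w' u' = E (x + x') (w + w') (u + u')"
  by (simp add: E_def gen_add)

lemma E_scale: "toroidal_scale sc c (E x w u) = E (sc c x) (c *s w) (c *s u)"
  by (simp add: E_def toroidal.scale_right_distrib toroidal_scale_gen)

lemma E_zero: "E 0 0 0 = 0"
  by (simp add: E_def)

lemma H_eq: "H = {proj (E x w u) | x w u. x \<in> h}"
proof -
  have "E x w u = (mon 0 x, K w 0, mon 0 u)" for x w u
    by (simp add: E_def X_gen_def K_gen_def D_gen_def)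
  then have eq: "{(mon 0 x, k, D) | x k D. x \<in> h \<and> k \<in> range (\<lambda>w. K w 0) \<and>
      D \<in> range (\<lambda>u. mon 0 u)} = {E x w u | x w u. x \<in> h}"
    by auto
  then show ?thesis
    unfolding tau_cartan_def span_K0 torus_der_eq eq by blast
qed

lemma H_I [simp]: "x \<in> h \<Longrightarrow> proj (E x w u) \<in> H"
  unfolding H_eq by auto

lemma H_E:
  assumes "t \<in> H"
  obtains x w u where "x \<in> h" "t = proj (E x w u)"
  using assms unfolding H_eq by auto

text \<open>The quotient removes nothing in degree 0, so x, w and u are coordinates on H. The
  definite description in \<open>ext\<close> rests on this.\<close>

lemma proj_E_inject: "proj (E x w u) = proj (E x' w' u') \<longleftrightarrow> x = x' \<and> w = w' \<and> u = u'"
proof -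
  have "K w 0 - K w' 0 = K (w - w') (0 :: (int, 'n) vec)"
    using K_add[of w "- w'" 0] by (simp add: K_minus)
  then show ?thesis by (simp add: proj_eq_iff K_mem_KB_iff inj_eq[OF inj_single])
qed

lemma h_zero [simp]: "0 \<in> h" and h_add: "x \<in> h \<Longrightarrow> y \<in> h \<Longrightarrow> x + y \<in> h"
  and h_scale: "x \<in> h \<Longrightarrow> sc c x \<in> h"
  using g.H_subspace(2,3,4) by simp_all

text \<open>The root \<open>\<alpha> + \<delta>\<^sub>s\<close>, where \<open>\<delta>\<^sub>s(D(u, 0)) = (u|s)\<close>.\<close>

definition ext :: "('g \<Rightarrow> complex) \<Rightarrow> (int, 'n) vec \<Rightarrow> ('g, 'n) toroidal set \<Rightarrow> complex" where
  "ext a s t = (if t \<in> H then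
     (THE c. \<exists>x w u. x \<in> h \<and> t = proj (E x w u) \<and> c = a x + cdot u (cvec s)) else 0)"

lemma ext_E: "x \<in> h \<Longrightarrow> ext a s (proj (E x w u)) = a x + cdot u (cvec s)"
  unfolding ext_def by (auto simp: proj_E_inject)

lemma ext_not_H: "t \<notin> H \<Longrightarrow> ext a s t = 0"
  by (simp add: ext_def)

lemma H_add: "proj (E x w u) \<oplus>\<^bsub>\<tau>\<^esub> proj (E x' w' u') = proj (E (x + x') (w + w') (u + u'))"
  by (simp add: proj_add E_add)

lemma H_scale: "c \<odot>\<^bsub>\<tau>\<^esub> proj (E x w u) = proj (E (sc c x) (c *s w) (c *s u))"
  by (simp add: proj_scale E_scale)

lemma g_dualD:
  assumes "a \<in> dual \<g> h"
  shows "x \<in> h \<Longrightarrow> y \<in> h \<Longrightarrow> a (x + y) = a x + a y" "x \<in> h \<Longrightarrow> a (sc c x) = c * a x"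
    "x \<notin> h \<Longrightarrow> a x = 0" "a 0 = 0"
proof -
  show sc: "a (sc c x) = c * a x" if "x \<in> h" for c x using assms that unfolding dual_def by simp
  show "x \<in> h \<Longrightarrow> y \<in> h \<Longrightarrow> a (x + y) = a x + a y" "x \<notin> h \<Longrightarrow> a x = 0"
    using assms unfolding dual_def by auto
  show "a 0 = 0" using sc[of 0 0] by simp
qed

lemma ext_dual: "a \<in> dual \<g> h \<Longrightarrow> ext a s \<in> dual \<tau> H"
  unfolding dual_def[of \<tau>]
  by (auto elim!: H_E simp: H_add H_scale ext_E ext_not_H h_add h_scale g_dualD cdot_simps
    algebra_simps)

lemma tau_dual_eqI:
  assumes "\<beta> \<in> dual \<tau> H" "\<gamma> \<in> dual \<tau> H"
    "\<And>x w u. x \<in> h \<Longrightarrow> \<beta> (proj (E x w u)) = \<gamma> (proj (E x w u))"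
  shows "\<beta> = \<gamma>"
proof
  fix t show "\<beta> t = \<gamma> t"
  proof (cases "t \<in> H")
    case True
    then show ?thesis using assms(3) by (auto elim!: H_E)
  next
    case False
    then show ?thesis using assms(1,2) unfolding dual_def by simp
  qed
qed

lemma ext_inject:
  assumes "a \<in> dual \<g> h" "b \<in> dual \<g> h"
  shows "ext a s = ext b t \<longleftrightarrow> a = b \<and> s = t"
proof
  assume eq: "ext a s = ext b t"
  have "a x = b x" for x
    using fun_cong[OF eq, of "proj (E x 0 0)"] g_dualD[OF assms(1)] g_dualD[OF assms(2)]
    by (cases "x \<in> h") (simp_all add: ext_E)
  moreover have "cdot (cvec s - cvec t) u = 0" for u
    using fun_cong[OF eq, of "proj (E 0 0 u)"] g_dualD[OF assms(1)] g_dualD[OF assms(2)]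
    by (simp add: ext_E cdot_simps cdot_commute[of _ u])
  then have "cvec s - cvec t = 0" by (rule cdot_nondegenerate)
  ultimately show "a = b \<and> s = t" by auto
qed simp

lemma ext_add: "(\<lambda>t. ext a s t + ext b r t) = ext (\<lambda>x. a x + b x) (s + r)"
proof
  fix t show "ext a s t + ext b r t = ext (\<lambda>x. a x + b x) (s + r) t"
    by (cases "t \<in> H") (auto elim!: H_E simp: ext_E ext_not_H cdot_simps)
qed

lemma ext_uminus: "(\<lambda>t. - ext a s t) = ext (\<lambda>x. - a x) (- s)"
proof
  fix t show "- ext a s t = ext (\<lambda>x. - a x) (- s) t"
    by (cases "t \<in> H") (auto elim!: H_E simp: ext_E ext_not_H cdot_simps)
qed

lemma ext_zero: "ext (\<lambda>_. 0) 0 = (\<lambda>_. 0)"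
proof
  fix t show "ext (\<lambda>_. 0) 0 t = 0"
    by (cases "t \<in> H") (auto elim!: H_E simp: ext_E ext_not_H)
qed

text \<open>The elements K(w, 0) do not act: their bracket with D(v, s) is a multiple of K(s, s) =
  0. Only \<open>x\<close> and \<open>u\<close> contribute weights.\<close>

lemma br_E:
  "toroidal_br (E x w u) (X_gen y s) = X_gen (br x y + sc (cdot u (cvec s)) y) s"
  "toroidal_br (E x w u) (K_gen v s) = K_gen (cdot u (cvec s) *s v) s"
  "toroidal_br (E x w u) (D_gen v s) = D_gen (cdot u (cvec s) *s v) s"
proof -
  have "K_gen (c *s cvec s) s = (0 :: ('g, 'n) toroidal)" for c and s :: "(int, 'n) vec"
    using K_eq_zeroI[of "c *s cvec s" c s] by (simp add: K_gen_def zero_prod_def)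
  then show "toroidal_br (E x w u) (X_gen y s) = X_gen (br x y + sc (cdot u (cvec s)) y) s"
    "toroidal_br (E x w u) (K_gen v s) = K_gen (cdot u (cvec s) *s v) s"
    "toroidal_br (E x w u) (D_gen v s) = D_gen (cdot u (cvec s) *s v) s"
    by (simp_all add: E_def toroidal_br_add toroidal_br_gen gen_add)
qed

lemma root_space_gen:
  assumes y: "y \<in> root_space \<g> h a"
  shows "proj (X_gen y s) \<in> root_space \<tau> H (ext a s)"
proof -
  have "proj (E x w u) \<otimes>\<^bsub>\<tau>\<^esub> proj (X_gen y s) = ext a s (proj (E x w u)) \<odot>\<^bsub>\<tau>\<^esub> proj (X_gen y s)"
    if "x \<in> h" for x w u
  proof -
    have "br x y = sc (a x) y" using y that unfolding root_space_def by simp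
    then show ?thesis
      using that by (simp add: proj_bracket proj_scale br_E ext_E toroidal_scale_gen
        sc.scale_left_distrib)
  qed
  then show ?thesis unfolding root_space_def by (auto elim!: H_E)
qed

lemma null_root_space_gen:
  "proj (K_gen v s) \<in> root_space \<tau> H (ext (\<lambda>_. 0) s)"
  "mon s v \<in> HB B \<Longrightarrow> proj (D_gen v s) \<in> root_space \<tau> H (ext (\<lambda>_. 0) s)"
  unfolding root_space_def
  by (auto elim!: H_E simp: proj_bracket proj_scale br_E ext_E toroidal_scale_gen)

text \<open>
  The components of degree \<open>s\<close> of an element \<open>z\<close>; the one in \<open>\<Z> / \<K>\<^sub>B\<close> is seen through the
  pairing with \<open>D(v, -s)\<close>.
\<close>

lemma br_E_components:
  assumes z: "z \<in> P"
  shows "coef (fst (toroidal_br (E x w u) z)) s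
      = br x (coef (fst z) s) + sc (cdot u (cvec s)) (coef (fst z) s)"
    "coef (snd (snd (toroidal_br (E x w u) z))) s
      = cdot u (cvec s) *s coef (snd (snd z)) s"
    "mon (- s) v \<in> HB B \<Longrightarrow>
      kz_pairing (fst (snd (toroidal_br (E x w u) z))) (mon (- s) v)
      = cdot u (cvec s) * kz_pairing (fst (snd z)) (mon (- s) v)"
proof -
  show "coef (fst (toroidal_br (E x w u) z)) s
      = br x (coef (fst z) s) + sc (cdot u (cvec s)) (coef (fst z) s)"
    by (induction z rule: toroidal_induct)
      (auto simp: br_E toroidal_br_add br_simps sc.scale_right_distrib lookup_add lookup_single
        when_def)
  show "coef (snd (snd (toroidal_br (E x w u) z))) s
      = cdot u (cvec s) *s coef (snd (snd z)) s"
    by (induction z rule: toroidal_induct)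
      (auto simp: br_E toroidal_br_add vector_add_ldistrib lookup_add lookup_single when_def)
  assume v: "mon (- s) v \<in> HB B"
  show "kz_pairing (fst (snd (toroidal_br (E x w u) z))) (mon (- s) v)
      = cdot u (cvec s) * kz_pairing (fst (snd z)) (mon (- s) v)"
    by (induction z rule: toroidal_induct)
      (auto simp: br_E toroidal_br_add kz_pairing_add_left kz_pairing_zero_left kz_pairing_K v
        cdot_simps
        lookup_single when_def algebra_simps)
qed

lemma scale_components:
  "coef (fst (toroidal_scale sc c z)) s = sc c (coef (fst z) s)"
  "coef (snd (snd (toroidal_scale sc c z))) s = c *s coef (snd (snd z)) s"
  "D \<in> HB B \<Longrightarrow> kz_pairing (fst (snd (toroidal_scale sc c z))) D = c * kz_pairing (fst (snd z)) D"
  by (cases z; simp add: kz_pairing_scale_left)+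

text \<open>Records only what survives in \<tau>: elements of \<open>KB B\<close> have no component
  in any degree.\<close>

definition has_component :: "('g, 'n) toroidal \<Rightarrow> (int, 'n) vec \<Rightarrow> bool" where
  "has_component z s \<longleftrightarrow> coef (fst z) s \<noteq> 0 \<or> coef (snd (snd z)) s \<noteq> 0
     \<or> (\<exists>v. mon (- s) v \<in> HB B \<and> kz_pairing (fst (snd z)) (mon (- s) v) \<noteq> 0)"

lemma exists_component:
  assumes "z \<in> P" "proj z \<noteq> \<zero>\<^bsub>\<tau>\<^esub>"
  shows "\<exists>s. has_component z s"
proof (rule ccontr)
  assume *: "\<not> ?thesis"
  then have "fst z = 0" "snd (snd z) = 0"
    unfolding has_component_def by (auto intro!: poly_mapping_eqI)
  moreover have "fst (snd z) \<in> KB B"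
    using * unfolding KB_iff has_component_def by (metis minus_minus)
  ultimately show False using assms by (simp add: proj_eq_zero_iff)
qed

text \<open>The loop and derivation parts are literally monomials. The central part is compared,
  through all pairings with \<open>HB B\<close>, with the degree s coefficient of one of its
  representatives.\<close>

lemma proj_eq_components:
  assumes z: "z \<in> P" and uniq: "\<And>r. has_component z r \<Longrightarrow> r = s"
  obtains w where "proj z =
    proj (X_gen (coef (fst z) s) s + K_gen w s + D_gen (coef (snd (snd z)) s) s)"
proof -
  have sing: "p = mon s (coef p s)"
    if "\<And>r. coef p r \<noteq> 0 \<Longrightarrow> r = s" for p :: "(int, 'n) vec \<Rightarrow>\<^sub>0 'b::zero"
    using that by (intro poly_mapping_eqI) (auto simp: lookup_single when_def)
  obtain p k D where zz: "z = (p, k, D)" by (cases z)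
  have p: "p = mon s (coef p s)"
    and D: "D = mon s (coef D s)"
    by (rule sing, rule uniq, simp add: has_component_def zz)+
  obtain \<omega> where k: "k = abs_kz \<omega>" by (induction k rule: kz.abs_induct) blast
  define w where "w = coef \<omega> s"
  have "k - K w s \<in> KB B"
    unfolding KB_iff
  proof (intro allI impI)
    fix r v assume v: "mon r v \<in> HB B"
    have "kz_pairing k (mon r v) = kz_pairing (K w s) (mon r v)"
    proof (cases "r = - s")
      case True
      then show ?thesis
        using v by (simp add: k kz_pairing_abs pairing_single_right kz_pairing_K w_def)
    next
      case False
      then have "\<not> has_component z (- r)" using uniq[of "- r"] by auto
      then have "kz_pairing k (mon r v) = 0"
        using v by (auto simp: has_component_def zz)
      then show ?thesis using False v
        by (auto simp: kz_pairing_K lookup_single when_def)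
    qed
    then show "kz_pairing (k - K w s) (mon r v) = 0"
      using v kz_pairing_add_left[OF v, of k "- K w s"] by (simp add: kz_pairing_minus_left)
  qed
  moreover have Dmem: "mon s (coef D s) \<in> HB B"
    using z D by (simp add: zz mem_Times_iff)
  ultimately have "proj z =
      proj (X_gen (coef p s) s + K_gen w s + D_gen (coef D s) s)"
    using z p D by (subst proj_eq_iff) (auto simp: zz intro!: pre_add)
  then show thesis using that by (simp add: zz)
qed

text \<open>If \<open>a\<close> is nonzero, only the loop part survives, since \<open>h\<close> acts
  by 0 on central elements and derivations. This last alternative is what places nonisotropic root
  spaces inside the core.\<close>

lemma tau_root_spaceE:
  assumes \<beta>: "\<beta> \<in> dual \<tau> H" and A: "A \<in> root_space \<tau> H \<beta>" "A \<noteq> \<zero>\<^bsub>\<tau>\<^esub>"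
  obtains a s y w v where "a \<in> roots \<g> h" "\<beta> = ext a s" "y \<in> root_space \<g> h a"
    "mon s v \<in> HB B" "A = proj (X_gen y s + K_gen w s + D_gen v s)"
    "a \<noteq> (\<lambda>_. 0) \<Longrightarrow> A = proj (X_gen y s)"
proof -
  obtain z where z: "z \<in> P" "A = proj z" using A(1) by (auto simp: root_space_def tau_carrier)
  obtain p k D where zz: "z = (p, k, D)" by (cases z)
  let ?\<beta> = "\<lambda>x w u. \<beta> (proj (E x w u))"
  have act: "toroidal_br (E x w u) z \<in> P" "toroidal_scale sc (?\<beta> x w u) z \<in> P"
    "proj (toroidal_br (E x w u) z) = proj (toroidal_scale sc (?\<beta> x w u) z)" if "x \<in> h" for x w u
  proof -
    have "proj (E x w u) \<otimes>\<^bsub>\<tau>\<^esub> proj z = ?\<beta> x w u \<odot>\<^bsub>\<tau>\<^esub> proj z"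
      using A(1) H_I[OF that, of w u] unfolding root_space_def z(2) by blast
    then show "proj (toroidal_br (E x w u) z) = proj (toroidal_scale sc (?\<beta> x w u) z)"
      using z(1) by (simp add: proj_bracket proj_scale)
  qed (use z in \<open>simp_all add: pre_closed\<close>)
  have act': "fst (toroidal_br (E x w u) z) = fst (toroidal_scale sc (?\<beta> x w u) z)"
    "fst (snd (toroidal_br (E x w u) z)) - fst (snd (toroidal_scale sc (?\<beta> x w u) z)) \<in> KB B"
    "snd (snd (toroidal_br (E x w u) z)) = snd (snd (toroidal_scale sc (?\<beta> x w u) z))"
    if "x \<in> h" for x w u
    using act(3)[OF that, of w u]
    unfolding proj_eq_iff[OF act(1)[OF that, of w u] act(2)[OF that, of w u]] by auto
  have pc: "br x (coef p s) + sc (cdot u (cvec s)) (coef p s)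
      = sc (?\<beta> x w u) (coef p s)" if "x \<in> h" for x w u s
    using act'(1)[OF that, of w u] br_E_components(1)[OF z(1), of x w u s] scale_components(1)[of
      "?\<beta> x w u" z s]
    by (simp add: zz)
  have Dc: "cdot u (cvec s) *s coef D s = ?\<beta> x w u *s coef D s"
    if "x \<in> h" for x w u s
    using act'(3)[OF that, of w u] br_E_components(2)[OF z(1), of x w u s] scale_components(2)[of
      "?\<beta> x w u" z s]
    by (auto simp: zz)
  have kc: "cdot u (cvec s) * kz_pairing k (mon (- s) v)
      = ?\<beta> x w u * kz_pairing k (mon (- s) v)"
    if x: "x \<in> h" and v: "mon (- s) v \<in> HB B" for x w u s v
  proof -
    have "fst (snd (toroidal_br (E x w u) z)) - fst (snd (toroidal_scale sc (?\<beta> x w u) z)) \<in> KB B"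
      by (rule act'(2)[OF x])
    from kz_pairing_KB[OF v this] show ?thesis
      using br_E_components(3)[OF z(1) v, of x w u] scale_components(3)[OF v, of "?\<beta> x w u" z]
        kz_pairing_add_left[OF v, of "fst (snd (toroidal_br (E x w u) z))"
          "- fst (snd (toroidal_scale sc (?\<beta> x w u) z))"]
      by (simp add: kz_pairing_minus_left[OF v]) (simp add: zz)
  qed
  \<comment> \<open>Whichever of the three parts is nonzero in degree s, D(u, 0) acts on it by
    (u|s), so \<beta> determines the degree.\<close>
  have \<beta>0: "?\<beta> 0 w u = cdot u (cvec s)" if s: "has_component z s" for s w u
  proof -
    have "sc (cdot u (cvec s)) (coef p s) = sc (?\<beta> 0 w u) (coef p s)"
      using pc[OF h_zero] by simp
    moreover have "cdot u (cvec s) *s coef D s = ?\<beta> 0 w u *s coef D s"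
      by (rule Dc[OF h_zero])
    moreover have "cdot u (cvec s) * kz_pairing k (mon (- s) v)
        = ?\<beta> 0 w u * kz_pairing k (mon (- s) v)"
      if "mon (- s) v \<in> HB B" for v
      by (rule kc[OF h_zero that])
    ultimately have "cdot u (cvec s) = ?\<beta> 0 w u" using s unfolding has_component_def
      by (auto simp: zz)
    then show ?thesis by simp
  qed
  obtain s where s: "has_component z s" using exists_component[of z] A(2) z by auto
  have uniq: "r = s" if "has_component z r" for r
  proof -
    have "cdot (cvec r - cvec s) u = 0" for u
      using \<beta>0[OF that, of 0 u] \<beta>0[OF s, of 0 u] by (simp add: cdot_simps cdot_commute[of _ u])
    then have "cvec r - cvec s = 0" by (rule cdot_nondegenerate)
    then show ?thesis by simp
  qed
  define y where "y = coef p s"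
  define v where "v = coef D s"
  obtain w where Aw: "A = proj (X_gen y s + K_gen w s + D_gen v s)"
    using proj_eq_components[OF z(1) uniq] z(2) by (auto simp: y_def v_def zz)
  \<comment> \<open>The restriction of \<beta> to \<open>h\<close>, set to 0 elsewhere as
    \<open>dual\<close> demands.\<close>
  define a where "a x = (if x \<in> h then ?\<beta> x 0 0 else 0)" for x
  have \<beta>_add: "\<beta> (proj (E x w u) \<oplus>\<^bsub>\<tau>\<^esub> proj (E x' w' u')) = ?\<beta> x w u + ?\<beta> x' w' u'"
    if "x \<in> h" "x' \<in> h" for x w u x' w' u' using \<beta> that unfolding dual_def by simp
  have \<beta>_scale: "\<beta> (c \<odot>\<^bsub>\<tau>\<^esub> proj (E x w u)) = c * ?\<beta> x w u" if "x \<in> h" for c x w u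
    using \<beta> that unfolding dual_def by simp
  have a: "a \<in> dual \<g> h"
    unfolding dual_def using \<beta>_add[of _ _ 0 0 0 0] \<beta>_scale[of _ _ 0 0]
    by (auto simp: a_def h_add h_scale H_add H_scale)
  have \<beta>_eq: "\<beta> = ext a s"
  proof (rule tau_dual_eqI[OF \<beta> ext_dual[OF a]])
    fix x w u assume x: "x \<in> h"
    have "?\<beta> x w u = ?\<beta> x 0 0 + ?\<beta> 0 w u" using \<beta>_add[OF x h_zero, of 0 0 w u] by (simp add: H_add)
    then show "?\<beta> x w u = ext a s (proj (E x w u))"
      using x \<beta>0[OF s] by (simp add: ext_E a_def)
  qed
  have y: "y \<in> root_space \<g> h a"

  proof -
    have "br x y = sc (?\<beta> x 0 0) y" if "x \<in> h" for x
      using pc[OF that, of s 0 0] unfolding y_def by simp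
    then show ?thesis unfolding root_space_def by (simp add: a_def)
  qed
  have v: "mon s v \<in> HB B"
  proof -
    have "D \<in> HB B" using z by (simp add: zz)
    then show ?thesis unfolding single_HB_iff HB_iff[of D] v_def by blast
  qed
  have nonzero: "A = proj (X_gen y s)" if a0: "a \<noteq> (\<lambda>_. 0)"
  proof -
    \<comment> \<open>\<open>E x 0 0\<close> kills the derivation and central parts, while the
      weight equation multiplies them by the nonzero number \<open>a x\<close>.\<close>
    obtain x where x: "x \<in> h" "?\<beta> x 0 0 \<noteq> 0" using a0 unfolding a_def by (metis ext)
    have "0 = ?\<beta> x 0 0 *s v"
      using Dc[OF x(1)] unfolding v_def by (metis cdot_zero_left vector_smult_lzero)
    then have "v = 0" using x(2) by simp
    moreover have "\<not> (\<exists>v. mon (- s) v \<in> HB B \<and> kz_pairing k (mon (- s) v) \<noteq> 0)"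
    proof clarify
      fix v assume v: "mon (- s) v \<in> HB B" "kz_pairing k (mon (- s) v) \<noteq> 0"
      have "cdot 0 (cvec s) * kz_pairing k (mon (- s) v)
          = ?\<beta> x 0 0 * kz_pairing k (mon (- s) v)"
        by (rule kc[OF x(1) v(1)])
      then show False using x(2) v(2) by simp
    qed
    ultimately have "fst z = mon s y" "D = 0" "k \<in> KB B"
    proof -
      show "fst z = mon s y"
        by (rule poly_mapping_eqI) (use uniq in \<open>auto simp: lookup_single when_def
          has_component_def y_def zz\<close>)
      show "D = 0" if "v = 0"
        by (rule poly_mapping_eqI) (use uniq that in \<open>auto simp: has_component_def v_def zz\<close>)
      show "k \<in> KB B"
        if none: "\<not> (\<exists>v. mon (- s) v \<in> HB B \<and> kz_pairing k (mon (- s) v) \<noteq> 0)"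
        unfolding KB_iff
      proof (intro allI impI)
        fix r v assume rv: "mon r v \<in> HB B"
        show "kz_pairing k (mon r v) = 0"
        proof (cases "r = - s")
          case True
          then show ?thesis using none rv by auto
        next
          case False
          then have "\<not> has_component z (- r)" using uniq[of "- r"] by auto
          then show ?thesis using rv by (auto simp: has_component_def zz)
        qed
      qed
    qed
    then show ?thesis using z by (subst z(2), subst proj_eq_iff) (auto simp: zz)
  qed
  have "a \<in> roots \<g> h"
  proof (cases "a = (\<lambda>_. 0)")
    case True
    then show ?thesis using g.zero_root by simp
  next
    case False
    have "y \<noteq> 0" using nonzero[OF False] A(2) by (auto simp: proj_zero)
    then show ?thesis using g.rootI[OF a y] by simp
  qed
  then show thesis using \<beta>_eq y v Aw nonzero by (rule that)
qed

end

subsection \<open>The extended affine structure\<close>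

context simple_tau_data
begin

lemma proj_X_gen_eq_zero_iff: "proj (X_gen y s) = \<zero>\<^bsub>\<tau>\<^esub> \<longleftrightarrow> y = 0"
  by (simp add: proj_eq_zero_iff)

lemma ext_root: "a \<in> roots \<g> h \<Longrightarrow> ext a s \<in> roots \<tau> H"
proof -
  assume "a \<in> roots \<g> h"
  then obtain y where y: "a \<in> dual \<g> h" "y \<in> root_space \<g> h a" "y \<noteq> 0"
    by (rule g.rootE) simp
  then show ?thesis
    using ext_dual[OF y(1), of s] root_space_gen[OF y(2), of s] proj_X_gen_eq_zero_iff[of y s]
    unfolding roots_def by blast
qed

lemma tau_rootE:
  assumes "\<beta> \<in> roots \<tau> H"
  obtains a s where "a \<in> roots \<g> h" "\<beta> = ext a s"
proof -
  have \<beta>: "\<beta> \<in> dual \<tau> H" "root_space \<tau> H \<beta> \<noteq> {\<zero>\<^bsub>\<tau>\<^esub>}" using assms unfolding roots_def by auto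
  have "\<zero>\<^bsub>\<tau>\<^esub> \<in> root_space \<tau> H \<beta>"
    unfolding root_space_def by (auto elim!: H_E)
  then obtain A where "A \<in> root_space \<tau> H \<beta>" "A \<noteq> \<zero>\<^bsub>\<tau>\<^esub>" using \<beta>(2) by blast
  then show thesis using tau_root_spaceE[OF \<beta>(1)] that by metis
qed

lemma g_dual_of_root: "a \<in> roots \<g> h \<Longrightarrow> a \<in> dual \<g> h"
  unfolding roots_def by auto

lemma H_carrier: "H \<subseteq> carrier \<tau>"
  by (auto elim!: H_E)

lemma H_zero: "\<zero>\<^bsub>\<tau>\<^esub> \<in> H"
  using H_I[OF h_zero, of 0 0] by (simp add: E_zero proj_zero)

lemma subspace_H: "T.subspace H"
  by (rule T.subspaceI[OF H_carrier H_zero])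
    (auto elim!: H_E simp: H_add H_scale h_add h_scale)

lemma abelian_H: "abelian_on \<tau> H"
proof -
  have "toroidal_br (E x w u) (E x' w' u') = 0" if "x \<in> h" "x' \<in> h" for x w u x' w' u'
  proof -
    have "br x x' = 0" using g.abelian that unfolding abelian_on_def by simp
    then show ?thesis by (simp add: E_def[of x'] toroidal_br_add br_E)
  qed
  then show ?thesis unfolding abelian_on_def by (auto elim!: H_E simp: proj_bracket proj_zero)
qed

lemma self_centralizing_H: "self_centralizing \<tau> H"
  unfolding self_centralizing_def
proof
  let ?V = "{x \<in> carrier \<tau>. \<forall>t\<in>H. t \<otimes>\<^bsub>\<tau>\<^esub> x = \<zero>\<^bsub>\<tau>\<^esub>}"
  show "H \<subseteq> ?V"
    using abelian_H H_carrier unfolding abelian_on_def by auto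
  show "?V \<subseteq> H"
  proof
    fix A assume A: "A \<in> ?V"
    show "A \<in> H"
    proof (cases "A = \<zero>\<^bsub>\<tau>\<^esub>")
      case True
      then show ?thesis using H_zero by simp
    next
      case False
      have "A \<in> root_space \<tau> H (ext (\<lambda>_. 0) 0)"
        unfolding ext_zero root_space_def using A by auto
      then obtain a s y w v where *: "a \<in> roots \<g> h" "ext (\<lambda>_. 0) 0 = ext a s"
        "y \<in> root_space \<g> h a"
        "A = proj (X_gen y s + K_gen w s + D_gen v s)"
        using tau_root_spaceE[OF ext_dual[OF g.dual_zero] _ False] by metis
      then have "a = (\<lambda>_. 0)" "s = 0"
        using ext_inject[OF g.dual_zero g_dual_of_root[OF *(1)]] by auto
      moreover have "y \<in> h" if "a = (\<lambda>_. 0)" using *(3) unfolding that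
        by (simp add: g.root_space_zero)
      ultimately show ?thesis using *(4) H_I[of y w v] by (simp add: E_def)
    qed
  qed
qed

lemma root_space_carrier: "root_space \<tau> H \<beta> \<subseteq> carrier \<tau>"
  unfolding root_space_def by auto

lemma ad_diagonalizable_H: "ad_diagonalizable \<tau> H"
proof -
  define R where "R = (\<Union>\<alpha>\<in>dual \<tau> H. root_space \<tau> H \<alpha>)"
  have Rc: "R \<subseteq> carrier \<tau>" unfolding R_def using root_space_carrier by auto
  note span = T.subspaceD[OF T.subspace_lin_span[OF Rc]]
  have R: "A \<in> lin_span \<tau> R" if "A \<in> root_space \<tau> H (ext a s)" "a \<in> dual \<g> h" for A a s
    using that ext_dual[of a s] T.lin_span_superset[of R] unfolding R_def by blast
  have X: "proj (X_gen y s) \<in> lin_span \<tau> R" for y s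
  proof -
    let ?V = "{y. proj (X_gen y s) \<in> lin_span \<tau> R}"
    have "carrier \<g> \<subseteq> ?V"
    proof (rule g.root_space_induct)
      show "g.subspace ?V"
      proof (rule g.subspaceI)
        show "\<zero>\<^bsub>\<g>\<^esub> \<in> ?V" using span(2) by (simp add: proj_zero)
        fix x y assume "x \<in> ?V" "y \<in> ?V"
        then show "x \<oplus>\<^bsub>\<g>\<^esub> y \<in> ?V"
          using span(3)[of "proj (X_gen x s)" "proj (X_gen y s)"] by (simp add: proj_add gen_add)
      next
        fix c x assume "x \<in> ?V"
        then show "c \<odot>\<^bsub>\<g>\<^esub> x \<in> ?V"
          using span(4)[of "proj (X_gen x s)" c] by (simp add: proj_scale toroidal_scale_gen)
      qed simp
      show "root_space \<g> h a \<subseteq> ?V" if "a \<in> dual \<g> h" for a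
        using R[OF root_space_gen that] by auto
    qed
    then show ?thesis by auto
  qed
  have "proj z \<in> lin_span \<tau> R" if "z \<in> P" for z
    using that
  proof (induction z rule: pre_induct)
    case (add a b)
    then show ?case using span(3) by (simp flip: proj_add)
  next
    case (K u r)
    show ?case by (rule R[OF null_root_space_gen(1) g.dual_zero])
  next
    case (D u r)
    then show ?case by (intro R[OF null_root_space_gen(2) g.dual_zero])
  qed (rule X)
  then have "carrier \<tau> \<subseteq> lin_span \<tau> R" by (auto simp: tau_carrier)
  then show ?thesis
    using span(1) unfolding ad_diagonalizable_def R_def by blast
qed

lemma lie_subalgebra_H: "lie_subalgebra \<tau> H"
  unfolding lie_subalgebra_def using subspace_H abelian_H H_zero unfolding abelian_on_def by auto

lemma split_tau:
  assumes "invariant_symmetric_form \<tau> \<phi>" "nondegenerate_on \<tau> (carrier \<tau>) \<phi>"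
  shows "split_quadratic_lie_algebra \<tau> H \<phi>"
  by unfold_locales
    (rule assms lie_subalgebra_H abelian_H self_centralizing_H ad_diagonalizable_H)+

definition tau_form :: "('g, 'n) toroidal set \<Rightarrow> ('g, 'n) toroidal set \<Rightarrow> complex" where
  "tau_form = quot_form pre ({0} \<times> KB B \<times> {0}) pre_form"

lemma tau_form: "invariant_symmetric_form \<tau> tau_form" "nondegenerate_on \<tau> (carrier \<tau>) tau_form"
  using pre.quot_form_nondegenerate[OF invariant_pre_form radical_pre_form[symmetric]]
  unfolding tau_form_def tau_def by simp_all

text \<open>For the summand \<open>h\<close>: independent sets in the finite dimensional simple
  algebra are finite, so \<open>h\<close> has a finite basis. The other two summands are spanned by
  unit vectors.\<close>

lemma finite_dimensional_H: "finite_dimensional \<tau> H"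
proof -
  obtain S where S: "finite S" "lin_span \<g> S = UNIV"
    using g.finite_dim unfolding finite_dimensional_def has_dim_def by auto
  have "lin_span \<g> ((\<lambda>x. x) ` S) = (\<lambda>x. x) ` sc.span S"
    by (rule g.lin_span_linear_image[OF sc.vector_space_axioms]) simp_all
  then have span_S: "sc.span S = UNIV" using S(2) by simp
  have "sc.subspace h" by (rule sc.subspaceI) (simp_all add: h_add h_scale)
  obtain C where C: "C \<subseteq> h" "sc.independent C" "h \<subseteq> sc.span C"
    using sc.basis_exists[of h] by metis
  have "finite C" using sc.independent_span_bound[OF S(1) C(2)] span_S by auto
  have span_C: "sc.span C = h"
    using C sc.span_minimal[OF C(1) \<open>sc.subspace h\<close>] by auto
  define F where "F = (\<lambda>x. proj (E x 0 0)) ` C \<union> (\<lambda>w. proj (E 0 w 0)) ` range (\<lambda>i. axis i 1)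
    \<union> (\<lambda>u. proj (E 0 0 u)) ` range (\<lambda>i. axis i 1)"
  have FH: "F \<subseteq> H" using C(1) by (auto simp: F_def)
  then have Fc: "F \<subseteq> carrier \<tau>" using H_carrier by auto
  note span = T.subspaceD[OF T.subspace_lin_span[OF Fc]]
  have x: "proj (E x 0 0) \<in> lin_span \<tau> F" if "x \<in> h" for x
  proof -
    have "lin_span \<tau> ((\<lambda>x. proj (E x 0 0)) ` C) = (\<lambda>x. proj (E x 0 0)) ` sc.span C"
      by (rule T.lin_span_linear_image[OF sc.vector_space_axioms]) (simp_all add: H_add H_scale)
    moreover have "lin_span \<tau> ((\<lambda>x. proj (E x 0 0)) ` C) \<subseteq> lin_span \<tau> F"
      by (rule T.lin_span_mono[OF _ Fc]) (auto simp: F_def)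
    ultimately show ?thesis using that span_C by auto
  qed
  have w: "proj (E 0 w 0) \<in> lin_span \<tau> F" for w
  proof -
    have "lin_span \<tau> ((\<lambda>w. proj (E 0 w 0)) ` range (\<lambda>i. axis i 1))
        = (\<lambda>w. proj (E 0 w 0)) ` vec.span (range (\<lambda>i. axis i 1))"
      by (rule T.lin_span_linear_image[OF independent_axes(1)]) (simp_all add: H_add H_scale)
    moreover have "lin_span \<tau> ((\<lambda>w. proj (E 0 w 0)) ` range (\<lambda>i. axis i 1)) \<subseteq> lin_span \<tau> F"
      by (rule T.lin_span_mono[OF _ Fc]) (auto simp: F_def)
    ultimately show ?thesis by (auto simp: independent_axes(3))
  qed
  have u: "proj (E 0 0 u) \<in> lin_span \<tau> F" for u
  proof -
    have "lin_span \<tau> ((\<lambda>w. proj (E 0 0 w)) ` range (\<lambda>i. axis i 1))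
        = (\<lambda>w. proj (E 0 0 w)) ` vec.span (range (\<lambda>i. axis i 1))"
      by (rule T.lin_span_linear_image[OF independent_axes(1)]) (simp_all add: H_add H_scale)
    moreover have "lin_span \<tau> ((\<lambda>w. proj (E 0 0 w)) ` range (\<lambda>i. axis i 1)) \<subseteq> lin_span \<tau> F"
      by (rule T.lin_span_mono[OF _ Fc]) (auto simp: F_def)
    ultimately show ?thesis by (auto simp: independent_axes(3))
  qed
  have "H \<subseteq> lin_span \<tau> F"
  proof
    fix t assume "t \<in> H"
    then obtain x w v where t: "x \<in> h" "t = proj (E x w v)" by (rule H_E)
    have "t = proj (E x 0 0) \<oplus>\<^bsub>\<tau>\<^esub> (proj (E 0 w 0) \<oplus>\<^bsub>\<tau>\<^esub> proj (E 0 0 v))"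
      by (simp add: t H_add)
    then show "t \<in> lin_span \<tau> F" using x[OF t(1)] w[of w] u[of v] span(3) by metis
  qed
  then have "H = lin_span \<tau> F" using T.lin_span_minimal[OF subspace_H FH] by auto
  moreover have "finite F" using \<open>finite C\<close> by (simp add: F_def)
  ultimately show ?thesis using T.finite_dimensionalI[OF _ Fc] by simp
qed

lemma H_nontrivial: "H \<noteq> {\<zero>\<^bsub>\<tau>\<^esub>}"
proof
  assume "H = {\<zero>\<^bsub>\<tau>\<^esub>}"
  then have "proj (E 0 0 (axis undefined 1)) = \<zero>\<^bsub>\<tau>\<^esub>" using H_I[OF h_zero] by blast
  then show False by (simp add: proj_eq_zero_iff)
qed

text \<open>At the elements D of degree 0 with unit vectors, a root takes the integer entries of its
  degree. Distance below 1 there fixes the degree, which leaves finitely many roots.\<close>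

lemma discrete_roots: "discrete (roots \<tau> H)"
proof (rule discreteI)
  fix \<beta> assume \<beta>: "\<beta> \<in> roots \<tau> H"
  then obtain a s where as: "a \<in> roots \<g> h" "\<beta> = ext a s" by (rule tau_rootE)
  define d where "d i = proj (E 0 0 (axis i 1))" for i
  have d: "ext b t (d i) = of_int (t $ i)" if "b \<in> roots \<g> h" for b t i
    using g_dualD(4)[OF g_dual_of_root[OF that]] by (simp add: d_def ext_E cvec_def)
  define U where "U = (\<Inter>i. {\<gamma> :: ('g, 'n) toroidal set \<Rightarrow> complex. dist (\<gamma> (d i)) (\<beta> (d i)) < 1})"
  have "open U"
    unfolding U_def
  proof (rule open_INT, simp, intro ballI)
    fix i
    have "{\<gamma> :: ('g, 'n) toroidal set \<Rightarrow> complex. dist (\<gamma> (d i)) (\<beta> (d i)) < 1}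
        = (\<lambda>\<gamma>. \<gamma> (d i)) -` ball (\<beta> (d i)) 1"
      by (auto simp: dist_commute)
    then show "open {\<gamma> :: ('g, 'n) toroidal set \<Rightarrow> complex. dist (\<gamma> (d i)) (\<beta> (d i)) < 1}"
      using open_vimage[OF open_ball continuous_on_product_coordinates[of "d i"]] by simp
  qed
  have "U \<inter> roots \<tau> H \<subseteq> (\<lambda>b. ext b s) ` roots \<g> h"
  proof
    fix \<gamma> assume \<gamma>: "\<gamma> \<in> U \<inter> roots \<tau> H"
    then obtain b t where b: "b \<in> roots \<g> h" "\<gamma> = ext b t" using tau_rootE by blast
    have "t $ i = s $ i" for i
    proof -
      have "dist (of_int (t $ i) :: complex) (of_int (s $ i)) < 1"
        using \<gamma> d[OF b(1)] d[OF as(1)] unfolding U_def b(2) as(2) by auto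
      then have "norm (of_int (t $ i - s $ i) :: complex) < 1" by (simp add: dist_norm)
      then show ?thesis unfolding norm_of_int by linarith
    qed
    then have "t = s" by (simp add: vec_eq_iff)
    then show "\<gamma> \<in> (\<lambda>b. ext b s) ` roots \<g> h" using b by auto
  qed
  then have fin: "finite (U \<inter> roots \<tau> H - {\<beta>})"
    using g.finite_roots finite_surj finite_Diff by metis
  define F where "F = U \<inter> roots \<tau> H - {\<beta>}"
  have "\<exists>t. \<gamma> t \<noteq> \<beta> t" if "\<gamma> \<in> F" for \<gamma> using that unfolding F_def by auto
  then obtain t where t: "\<And>\<gamma>. \<gamma> \<in> F \<Longrightarrow> \<gamma> (t \<gamma>) \<noteq> \<beta> (t \<gamma>)" by metis
  \<comment> \<open>Excludes the finitely many remaining roots, each at a point where it differs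
    from \<beta>.\<close>
  define W where "W = (\<Inter>\<gamma>\<in>F. (\<lambda>\<delta>. \<delta> (t \<gamma>)) -` (- {\<gamma> (t \<gamma>)}))"
  have "open W"
    unfolding W_def using fin
    by (intro open_INT ballI open_vimage continuous_on_product_coordinates) (auto simp: F_def)
  show "\<beta> isolated_in roots \<tau> H"
  proof (rule isolated_inI[where T = "U \<inter> W"])
    show "open (U \<inter> W)" using \<open>open U\<close> \<open>open W\<close> by (rule open_Int)
    have "\<beta> \<in> U \<inter> W" using t by (force simp: U_def W_def)
    moreover have "\<gamma> \<notin> W" if "\<gamma> \<in> F" for \<gamma> using that by (auto simp: W_def)
    ultimately show "U \<inter> W \<inter> roots \<tau> H = {\<beta>}" using \<beta> unfolding F_def by blast
  qed (rule \<beta>)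
qed

text \<open>
  The following facts hold for every form with the properties required of an extended affine Lie
  algebra: whether a root is isotropic can be read off the brackets \<open>[L\<^sub>\<alpha>, L\<^sub>-\<^sub>\<alpha>]\<close>.
\<close>

context
  fixes \<phi> :: "('g, 'n) toroidal set \<Rightarrow> ('g, 'n) toroidal set \<Rightarrow> complex"
  assumes \<phi>: "invariant_symmetric_form \<tau> \<phi>" "nondegenerate_on \<tau> (carrier \<tau>) \<phi>"
begin

interpretation S: split_quadratic_lie_algebra \<tau> H \<phi>
  by (rule split_tau[OF \<phi>])

lemma opposite_bracket:
  "proj (X_gen x s) \<otimes>\<^bsub>\<tau>\<^esub> proj (X_gen y (- s)) = proj (E (br x y) (f x y *s cvec s) 0)"
  by (simp add: proj_bracket toroidal_br_gen E_def)

lemma opposite_root_vector: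
  "y \<in> root_space \<g> h (\<lambda>x. - a x) \<Longrightarrow> proj (X_gen y (- s)) \<in> root_space \<tau> H (\<lambda>t. - ext a s t)"
  unfolding ext_uminus by (rule root_space_gen)

text \<open>For nonzero \<open>a\<close>, opposite root vectors x, y give a bracket with
  \<open>h\<close>-part [x, y], where \<open>a\<close> is nonzero. For a = 0, choose x, y in
  \<open>h\<close> with f(x, y) \<noteq> 0: the bracket is f(x, y) K(s, 0), where
  \<open>\<delta>\<^sub>s\<close> vanishes. If \<open>\<delta>\<^sub>s\<close> were nonisotropic,
  \<phi> would vanish on this pair.\<close>

lemma nonisotropic_ext_iff:
  assumes a: "a \<in> roots \<g> h"
  shows "ext a s \<in> nonisotropic_roots \<tau> H \<phi> \<longleftrightarrow> a \<noteq> (\<lambda>_. 0)"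
proof
  assume a0: "a \<noteq> (\<lambda>_. 0)"
  from a obtain x where x: "x \<in> root_space \<g> h a" "x \<noteq> \<zero>\<^bsub>\<g>\<^esub>" by (rule g.rootE)
  then obtain y where y: "y \<in> root_space \<g> h (\<lambda>t. - a t)" "f x y \<noteq> 0"
    by (rule g.exists_dual_root_vector)
  have "a (br x y) \<noteq> 0"
    using g.dual_form_bracket[OF a a x(1) y(1)] y(2) g.nonzero_root_nonisotropic[OF a a0] by simp
  moreover have "br x y \<in> h" using g.bracket_opposite_in_H[OF x(1) y(1)] by simp
  ultimately have "ext a s (proj (X_gen x s) \<otimes>\<^bsub>\<tau>\<^esub> proj (X_gen y (- s))) \<noteq> 0"
    by (simp add: opposite_bracket ext_E)
  then show "ext a s \<in> nonisotropic_roots \<tau> H \<phi>"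
    unfolding S.nonisotropic_roots_iff
    using ext_root[OF a] root_space_gen[OF x(1), of s] opposite_root_vector[OF y(1), of s] by blast
next
  assume ni: "ext a s \<in> nonisotropic_roots \<tau> H \<phi>"
  show "a \<noteq> (\<lambda>_. 0)"
  proof
    assume a0: "a = (\<lambda>_. 0)"
    from g.zero_root obtain x where "x \<in> root_space \<g> h (\<lambda>_. 0)" "x \<noteq> \<zero>\<^bsub>\<g>\<^esub>"
      by (rule g.rootE)
    then have x: "x \<in> h" "x \<noteq> 0" using g.root_space_zero[of "\<lambda>_. 0"] by simp_all
    then obtain y where y: "y \<in> h" "f x y \<noteq> 0"
      using g.form_nondegenerate_on_H[of x] by auto
    have xy: "x \<in> root_space \<g> h a" "y \<in> root_space \<g> h (\<lambda>t. - a t)"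
      using x y by (simp_all add: a0 g.root_space_zero)
    have root: "ext a s \<in> roots \<tau> H" by (rule ext_root[OF a])
    have "br x y = 0" using g.abelian x(1) y(1) unfolding abelian_on_def by simp
    then have br: "proj (X_gen x s) \<otimes>\<^bsub>\<tau>\<^esub> proj (X_gen y (- s)) = proj (E 0 (f x y *s cvec s) 0)"
      by (simp add: opposite_bracket)
    have "\<phi> (proj (X_gen x s)) (proj (X_gen y (- s))) * dual_form H \<phi> (ext a s) (ext a s) = 0"
      using S.dual_form_bracket[OF root root root_space_gen[OF xy(1)] opposite_root_vector[OF
        xy(2)]]
      unfolding br by (simp add: ext_E a0)
    moreover have "dual_form H \<phi> (ext a s) (ext a s) \<noteq> 0"
      using ni unfolding nonisotropic_roots_def by simp
    ultimately have \<phi>0: "\<phi> (proj (X_gen x s)) (proj (X_gen y (- s))) = 0" by simp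
    \<comment> \<open>The bracket pairs with t in H to the root value at t times \<phi>(x(s),
      y(-s)), which is 0. So K(s, 0) vanishes, s = 0, and the root is the zero functional.\<close>
    have "proj (E 0 (f x y *s cvec s) 0) = \<zero>\<^bsub>\<tau>\<^esub>"
    proof (rule S.form_nondegenerate_on_H)
      fix t assume "t \<in> H"
      then show "\<phi> (proj (E 0 (f x y *s cvec s) 0)) t = 0"
        using S.form_bracket_opposite[OF root_space_gen[OF xy(1), of s] opposite_root_vector[OF
          xy(2)]] \<phi>0
        by (simp add: br)
    qed simp
    then have "s = 0"
      using y(2) cvec_eq_iff[of s 0] by (simp add: proj_eq_zero_iff K_mem_KB_iff)
    then have "ext a s = (\<lambda>_. 0)" by (simp add: a0 ext_zero)
    then show False using ni unfolding S.nonisotropic_roots_iff by auto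
  qed
qed

lemma nonisotropic_roots_eq:
  "nonisotropic_roots \<tau> H \<phi> = {ext a s | a s. a \<in> roots \<g> h \<and> a \<noteq> (\<lambda>_. 0)}"
proof -
  have "\<beta> \<in> roots \<tau> H" if "\<beta> \<in> nonisotropic_roots \<tau> H \<phi>" for \<beta>
    using that unfolding nonisotropic_roots_def by simp
  then show ?thesis using nonisotropic_ext_iff tau_rootE by (auto, metis)
qed

text \<open>Evaluating \<open>ext b t\<close> on one and the same bracket gives both products, each
  up to a scalar. The scalar for \<phi> is nonzero because \<open>a\<close> is nonisotropic for
  \<open>f\<close>.\<close>

lemma dual_form_ext_eq_zero_iff:
  assumes a: "a \<in> roots \<g> h" "a \<noteq> (\<lambda>_. 0)" and b: "b \<in> roots \<g> h"
  shows "dual_form H \<phi> (ext a s) (ext b t) = 0 \<longleftrightarrow> dual_form h f a b = 0"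
proof -
  from a(1) obtain x where x: "x \<in> root_space \<g> h a" "x \<noteq> \<zero>\<^bsub>\<g>\<^esub>" by (rule g.rootE)
  then obtain y where y: "y \<in> root_space \<g> h (\<lambda>t. - a t)" "f x y \<noteq> 0"
    by (rule g.exists_dual_root_vector)
  let ?x = "proj (X_gen x s)" and ?y = "proj (X_gen y (- s))"
  have "br x y \<in> h" using g.bracket_opposite_in_H[OF x(1) y(1)] by simp
  then have val: "ext c r (?x \<otimes>\<^bsub>\<tau>\<^esub> ?y) = f x y * dual_form h f a c" if "c \<in> roots \<g> h" for c r
    using g.dual_form_bracket[OF a(1) that x(1) y(1)] by (simp add: opposite_bracket ext_E)
  have br: "ext c r (?x \<otimes>\<^bsub>\<tau>\<^esub> ?y) = \<phi> ?x ?y * dual_form H \<phi> (ext a s) (ext c r)"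
    if "c \<in> roots \<g> h" for c r
    by (rule S.dual_form_bracket[OF ext_root[OF a(1)] ext_root[OF that] root_space_gen[OF x(1)]
          opposite_root_vector[OF y(1)]])
  have "\<phi> ?x ?y \<noteq> 0"
    using br[OF a(1), of s] val[OF a(1), of s] y(2) g.nonzero_root_nonisotropic[OF a] by auto
  then show ?thesis using br[OF b, of t] val[OF b, of t] y(2) by auto
qed

text \<open>Nonvanishing powers would give roots \<beta> + n \<alpha> for all n. Restricted to
  \<open>h\<close> these form an infinite string b + n a of roots of the simple algebra, impossible
  for nonzero \<open>a\<close>.\<close>

lemma tau_EA3:
  assumes \<alpha>: "\<alpha> \<in> nonisotropic_roots \<tau> H \<phi>" and x: "x \<in> root_space \<tau> H \<alpha>" and y: "y \<in> carrier \<tau>"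
  shows "\<exists>n. ((\<lambda>z. x \<otimes>\<^bsub>\<tau>\<^esub> z) ^^ n) y = \<zero>\<^bsub>\<tau>\<^esub>"
proof (rule S.ad_locally_nilpotentI[OF S.root_spaceD(1)[OF x] _ y])
  fix \<beta> y assume \<beta>: "\<beta> \<in> dual \<tau> H" and y: "y \<in> root_space \<tau> H \<beta>"
  obtain a s where a: "a \<in> roots \<g> h" "a \<noteq> (\<lambda>_. 0)" "\<alpha> = ext a s"
    using \<alpha> unfolding nonisotropic_roots_eq by auto
  show "\<exists>n. ((\<lambda>z. x \<otimes>\<^bsub>\<tau>\<^esub> z) ^^ n) y = \<zero>\<^bsub>\<tau>\<^esub>"
  proof (rule ccontr)
    assume nz: "\<not> ?thesis"
    let ?b = "\<lambda>n t. \<beta> t + of_nat n * \<alpha> t"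
    have roots: "?b n \<in> roots \<tau> H" for n
      using S.rootI[OF _ S.ad_power_root_space[OF x y, of n]] nz
        S.dual_add[OF \<beta> S.dual_scale[OF ext_dual[OF g_dual_of_root[OF a(1)]]]]
      unfolding a(3) by blast
    define b where "b x = (if x \<in> h then \<beta> (proj (E x 0 0)) else 0)" for x
    have "(\<lambda>x. b x + of_int n * a x) \<in> roots \<g> h" if n: "n \<in> range int" for n
    proof -
      obtain m where m: "n = int m" using n by auto
      obtain c r where c: "c \<in> roots \<g> h" "?b m = ext c r" using tau_rootE[OF roots] by metis
      have "c x = b x + of_int n * a x" for x
        using fun_cong[OF c(2), of "proj (E x 0 0)"] g_dualD(3)[OF g_dual_of_root[OF c(1)], of x]
          g_dualD(3)[OF g_dual_of_root[OF a(1)], of x]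
        by (cases "x \<in> h") (simp_all add: a(3) b_def ext_E m)
      then have "c = (\<lambda>x. b x + of_int n * a x)" by auto
      with c show ?thesis by simp
    qed
    then have "range int \<subseteq> {n. (\<lambda>x. b x + of_int n * a x) \<in> roots \<g> h}" by auto
    then have "finite (range int)" using g.root_string_finite[OF a(2)] finite_subset by blast
    then show False using finite_imageD[of int UNIV] by simp
  qed
qed

text \<open>Forgetting degrees turns the two parts into sets \<open>P1\<close>, \<open>P2\<close> of
  roots of the simple algebra. They might overlap, which is why \<open>roots_irreducible\<close>
  does not ask for disjointness.\<close>

lemma tau_EA5i:
  assumes R: "nonisotropic_roots \<tau> H \<phi> = R1 \<union> R2"
    and orth: "\<forall>\<alpha>\<in>R1. \<forall>\<beta>\<in>R2. dual_form H \<phi> \<alpha> \<beta> = 0"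
  shows "R1 = {} \<or> R2 = {}"
proof -
  define P1 where "P1 = {a \<in> roots \<g> h. a \<noteq> (\<lambda>_. 0) \<and> (\<exists>s. ext a s \<in> R1)}"
  define P2 where "P2 = {a \<in> roots \<g> h. a \<noteq> (\<lambda>_. 0) \<and> (\<exists>s. ext a s \<in> R2)}"
  have "P1 = {} \<or> P2 = {}"
  proof (rule g.roots_irreducible)
    show "roots \<g> h - {\<lambda>_. 0} = P1 \<union> P2"
      using R unfolding nonisotropic_roots_eq P1_def P2_def by blast
    show "dual_form h f a b = 0" if "a \<in> P1" "b \<in> P2" for a b
      using that orth dual_form_ext_eq_zero_iff unfolding P1_def P2_def by blast
  qed
  moreover have "\<exists>a s. \<beta> = ext a s \<and> a \<in> roots \<g> h \<and> a \<noteq> (\<lambda>_. 0)" if "\<beta> \<in> R1 \<union> R2" for \<beta>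
    using that unfolding R[symmetric] nonisotropic_roots_eq by blast
  ultimately show ?thesis unfolding P1_def P2_def by blast
qed

text \<open>An isotropic root is some \<open>\<delta>\<^sub>s\<close>, and adding any nonzero root b
  in degree 0 gives b + \<open>\<delta>\<^sub>s\<close>.\<close>

lemma tau_EA5ii:
  assumes "\<sigma> \<in> isotropic_roots \<tau> H \<phi>"
  shows "\<exists>\<alpha>\<in>nonisotropic_roots \<tau> H \<phi>. (\<lambda>t. \<sigma> t + \<alpha> t) \<in> roots \<tau> H"
proof -
  have \<sigma>: "\<sigma> \<in> roots \<tau> H" "\<sigma> \<notin> nonisotropic_roots \<tau> H \<phi>"
    using assms unfolding isotropic_roots_def nonisotropic_roots_def by auto
  obtain a s where as: "a \<in> roots \<g> h" "\<sigma> = ext a s" using tau_rootE[OF \<sigma>(1)] by metis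
  have "a = (\<lambda>_. 0)" using \<sigma>(2) nonisotropic_ext_iff[OF as(1)] as(2) by auto
  obtain b where b: "b \<in> roots \<g> h" "b \<noteq> (\<lambda>_. 0)" using g.exists_nonzero_root by auto
  have "(\<lambda>t. \<sigma> t + ext b 0 t) = ext b s"
    unfolding as(2) ext_add \<open>a = (\<lambda>_. 0)\<close> by simp
  then show ?thesis
    using b ext_root[OF b(1)] nonisotropic_ext_iff[OF b(1)] by (intro bexI[of _ "ext b 0"]) auto
qed

lemma extended_affine_tau: "extended_affine_lie_algebra \<tau> H \<phi>"
  by (intro extended_affine_lie_algebra.intro extended_affine_lie_algebra_axioms.intro
      T.lie_algebra_axioms \<phi> lie_subalgebra_H H_nontrivial finite_dimensional_H abelian_H
      self_centralizing_H ad_diagonalizable_H tau_EA3 discrete_roots tau_EA5i tau_EA5ii)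

lemma tau_gA_Z_eq: "tau_gA_Z sc br f B = {proj z | z. snd (snd z) = 0}"
  unfolding tau_gA_Z_def by auto

lemma snd_snd_mem: "snd (snd z) = 0 \<Longrightarrow> z \<in> P" for z :: "('g, 'n) toroidal"
  by (cases z) (simp add: HB_zero)

text \<open>Brackets of elements without derivation part have none, and root vectors for nonzero
  \<open>a\<close> are loops by \<open>tau_root_spaceE\<close>.\<close>

lemma core_subset: "core \<tau> H \<phi> \<subseteq> tau_gA_Z sc br f B"
  unfolding core_def
proof (rule T.generated_minimal)
  note [simp] = snd_snd_mem
  have br0: "snd (snd (toroidal_br x y)) = 0"
    if "snd (snd x) = 0" "snd (snd y) = 0" for x y :: "('g, 'n) toroidal"
    using that by (cases x; cases y) (simp add: vect_bracket.bilin_ext_simps)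
  have sc0: "snd (snd (toroidal_scale sc c x)) = 0"
    if "snd (snd x) = 0" for c and x :: "('g, 'n) toroidal"
    using that by (cases x) simp
  let ?V = "{proj z |z. snd (snd z) = 0}"
  have "T.subspace (tau_gA_Z sc br f B)"
    unfolding tau_gA_Z_eq
  proof (rule T.subspaceI)
    fix A C assume "A \<in> ?V" "C \<in> ?V"
    then obtain x y where "A = proj x" "C = proj y" "snd (snd x) = 0" "snd (snd y) = 0" by auto
    then have "A \<oplus>\<^bsub>\<tau>\<^esub> C = proj (x + y)" "snd (snd (x + y)) = 0" by (simp_all add: proj_add)
    then show "A \<oplus>\<^bsub>\<tau>\<^esub> C \<in> ?V" by blast
  next
    fix c A assume "A \<in> ?V"
    then obtain x where "A = proj x" "snd (snd x) = 0" by auto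
    then have "c \<odot>\<^bsub>\<tau>\<^esub> A = proj (toroidal_scale sc c x)" "snd (snd (toroidal_scale sc c x)) = 0"
      by (simp_all only: proj_scale snd_snd_mem sc0)
    then show "c \<odot>\<^bsub>\<tau>\<^esub> A \<in> ?V" by blast
  next
    have "\<zero>\<^bsub>\<tau>\<^esub> = proj 0 \<and> snd (snd (0 :: ('g, 'n) toroidal)) = 0" by (simp add: proj_zero)
    then show "\<zero>\<^bsub>\<tau>\<^esub> \<in> ?V" by blast
  qed (auto intro: proj_closed simp: HB_zero)
  moreover have "A \<otimes>\<^bsub>\<tau>\<^esub> C \<in> tau_gA_Z sc br f B"
    if "A \<in> tau_gA_Z sc br f B" "C \<in> tau_gA_Z sc br f B" for A C
  proof -
    from that obtain x y where xy: "A = proj x" "C = proj y" "snd (snd x) = 0" "snd (snd y) = 0"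
      unfolding tau_gA_Z_eq by blast
    then have "A \<otimes>\<^bsub>\<tau>\<^esub> C = proj (toroidal_br x y)" by (simp only: proj_bracket snd_snd_mem)
    with br0[OF xy(3,4)] show ?thesis unfolding tau_gA_Z_eq by blast
  qed
  ultimately show "lie_subalgebra \<tau> (tau_gA_Z sc br f B)"
    unfolding lie_subalgebra_def by auto
  show "(\<Union>\<alpha>\<in>nonisotropic_roots \<tau> H \<phi>. root_space \<tau> H \<alpha>) \<subseteq> tau_gA_Z sc br f B"
  proof clarify
    fix \<alpha> A assume \<alpha>: "\<alpha> \<in> nonisotropic_roots \<tau> H \<phi>" and A: "A \<in> root_space \<tau> H \<alpha>"
    obtain a s where a: "a \<in> roots \<g> h" "a \<noteq> (\<lambda>_. 0)" "\<alpha> = ext a s"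
      using \<alpha> unfolding nonisotropic_roots_eq by auto
    note ad = g_dual_of_root[OF a(1)]
    show "A \<in> tau_gA_Z sc br f B"
    proof (cases "A = \<zero>\<^bsub>\<tau>\<^esub>")
      case True
      then have "A = proj 0 \<and> snd (snd (0 :: ('g, 'n) toroidal)) = 0" by (simp add: proj_zero)
      then show ?thesis unfolding tau_gA_Z_eq by blast
    next
      case False
      from A[unfolded a(3)] obtain b t y where *: "b \<in> roots \<g> h" "ext a s = ext b t"
        "b \<noteq> (\<lambda>_. 0) \<Longrightarrow> A = proj (X_gen y t)"
        using tau_root_spaceE[OF ext_dual[OF ad] _ False] by metis
      then have "b = a" using ext_inject[OF ad g_dual_of_root[OF *(1)]] by auto
      then have "A = proj (X_gen y t)" using * a(2) by simp
      moreover have "snd (snd (X_gen y t :: ('g, 'n) toroidal)) = 0" by simp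
      ultimately show ?thesis unfolding tau_gA_Z_eq by blast
    qed
  qed
qed

text \<open>
  For root vectors \<open>x\<close>, \<open>y\<close> of opposite nonzero roots, \<open>[x(r), y(s)]\<close> has the central part
  \<open>\<langle>x, y\<rangle> K(r, r + s)\<close> and the loop part \<open>[x, y](r + s)\<close>; comparing two splittings of the same degree
  isolates the former.
\<close>

lemma core_superset: "tau_gA_Z sc br f B \<subseteq> core \<tau> H \<phi>"
proof -
  define C where "C = core \<tau> H \<phi>"
  have C: "lie_subalgebra \<tau> C"
    unfolding C_def core_def by (rule T.lie_subalgebra_generated) (auto simp:
      root_space_carrier[THEN subsetD])
  note Cs = T.subspaceD[OF T.lie_subalgebraD(1)[OF C]] and Cb = T.lie_subalgebraD(2)[OF C]
  have root: "proj (X_gen x s) \<in> C"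
    if "a \<in> roots \<g> h" "a \<noteq> (\<lambda>_. 0)" "x \<in> root_space \<g> h a" for a x s
  proof -
    have "ext a s \<in> nonisotropic_roots \<tau> H \<phi>" using nonisotropic_ext_iff[OF that(1)] that(2) by simp
    then have "proj (X_gen x s) \<in> (\<Union>\<alpha>\<in>nonisotropic_roots \<tau> H \<phi>. root_space \<tau> H \<alpha>)"
      using root_space_gen[OF that(3), of s] by blast
    then show ?thesis unfolding C_def core_def by (rule subsetD[OF T.generated_superset])
  qed
  have K: "proj (K_gen u m) \<in> C" for u m
  proof -
    obtain a where a: "a \<in> roots \<g> h" "a \<noteq> (\<lambda>_. 0)" using g.exists_nonzero_root by auto
    from a(1) obtain x where x: "x \<in> root_space \<g> h a" "x \<noteq> \<zero>\<^bsub>\<g>\<^esub>" by (rule g.rootE)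
    then obtain y where y: "y \<in> root_space \<g> h (\<lambda>t. - a t)" "f x y \<noteq> 0"
      by (rule g.exists_dual_root_vector)
    have "(\<lambda>t. - a t) \<noteq> (\<lambda>_. 0)" using a(2) by (auto simp: fun_eq_iff)
    note y' = root[OF g.uminus_root[OF a(1)] this y(1)]
    have br: "proj (X_gen (br x y) m + K_gen (f x y *s cvec r) m) \<in> C" for r
      using Cb[OF root[OF a x(1), of r] y'[of "m - r"]] by (simp add: proj_bracket toroidal_br_gen)
    have "proj (K_gen (cvec r) m) \<in> C" for r
    proof -
      \<comment> \<open>The splittings r + (m - r) and 0 + m of the degree; the difference is f(x,
        y) K(r, m).\<close>
      let ?A = "X_gen (br x y) m + K_gen (f x y *s cvec r) m"
        and ?Z = "X_gen (br x y) m + K_gen (f x y *s cvec 0) m"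
      have P: "?A \<in> P" "?Z \<in> P" by (intro pre_add gen_mem_pre)+
      have "?A + toroidal_scale sc (-1) ?Z = K_gen (f x y *s cvec r) m" by simp
      then have "toroidal_scale sc (1 / f x y) (?A + toroidal_scale sc (-1) ?Z) = K_gen (cvec r) m"
        using y(2) by (simp only: toroidal_scale_gen vector_smult_assoc) simp
      moreover have "(1 / f x y) \<odot>\<^bsub>\<tau>\<^esub> (proj ?A \<oplus>\<^bsub>\<tau>\<^esub> (-1) \<odot>\<^bsub>\<tau>\<^esub> proj ?Z) \<in> C"
        using br[of r] br[of 0] Cs(3,4) by blast
      ultimately show ?thesis
        using P by (simp only: proj_scale proj_add pre_add pre_scale)
    qed
    note Kint = this
    \<comment> \<open>Unit vectors are integral, so the elements K(r, m) with r integral span degree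
      m.\<close>
    have axis: "cvec (axis i 1) = axis i 1" for i :: 'n
      by (simp add: cvec_def axis_def vec_eq_iff)
    have "proj (K_gen (\<Sum>i\<in>F. u $ i *s axis i 1) m) \<in> C" if "finite F" for F
      using that
    proof (induction F rule: finite_induct)
      case empty
      then show ?case using Cs(2) by (simp add: proj_zero)
    next
      case (insert i F)
      have "u $ i \<odot>\<^bsub>\<tau>\<^esub> proj (K_gen (axis i 1) m) \<in> C" using Cs(4)[OF Kint[of "axis i 1"]]
        by (simp add: axis)
      with insert show ?case using Cs(3)
        by (simp add: proj_scale toroidal_scale_gen gen_add flip: proj_add)
    qed
    from this[of UNIV] show ?thesis by (simp add: basis_expansion)
  qed
  have X: "proj (X_gen x m) \<in> C" for x m
  proof -
    \<comment> \<open>All degrees at once: [x, y](m) is obtained from x in degree 0 and y in degree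
      m, where the central term is K(0, m) = 0.\<close>
    let ?V = "{x. \<forall>m. proj (X_gen x m) \<in> C}"
    have "lie_subalgebra \<g> ?V"
      unfolding lie_subalgebra_def
    proof (intro conjI ballI g.subspaceI)
      fix x y assume xy: "x \<in> ?V" "y \<in> ?V"
      have "proj (X_gen x m) \<oplus>\<^bsub>\<tau>\<^esub> proj (X_gen y m) \<in> C"
        "proj (X_gen x 0) \<otimes>\<^bsub>\<tau>\<^esub> proj (X_gen y m) \<in> C" for m
        using xy Cs(3) Cb by auto
      then show "x \<oplus>\<^bsub>\<g>\<^esub> y \<in> ?V" "x \<otimes>\<^bsub>\<g>\<^esub> y \<in> ?V"
        by (simp_all add: proj_add proj_bracket toroidal_br_gen gen_add)
    next
      fix c x assume x: "x \<in> ?V"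
      have "c \<odot>\<^bsub>\<tau>\<^esub> proj (X_gen x m) \<in> C" for m using x Cs(4) by auto
      then show "c \<odot>\<^bsub>\<g>\<^esub> x \<in> ?V" by (simp add: proj_scale toroidal_scale_gen)
    next
      show "\<zero>\<^bsub>\<g>\<^esub> \<in> ?V" using Cs(2) by (simp add: proj_zero)
    qed simp
    moreover have "(\<Union>\<alpha>\<in>roots \<g> h - {\<lambda>_. 0}. root_space \<g> h \<alpha>) \<subseteq> ?V" using root by auto
    ultimately have "carrier \<g> \<subseteq> ?V"
      unfolding g.generated_by_nonzero_root_spaces[symmetric] by (rule g.generated_minimal)
    then show ?thesis by auto
  qed
  have "proj z \<in> C" if "snd (snd z) = 0" for z
  proof -
    obtain p k where z: "z = (p, k, 0)" using \<open>snd (snd z) = 0\<close> by (cases z) auto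
    have "proj (p, 0, 0) \<in> C"
    proof (induction p rule: poly_mapping_add_induct)
      case (single r x)
      then show ?case using X[of x r] by (simp add: X_gen_def)
    next
      case (add a b)
      then show ?case using Cs(3)[OF add] proj_add[of "(a, 0, 0)" "(b, 0, 0)"]
        by (simp add: HB_zero)
    qed
    moreover have "proj (0, k, 0) \<in> C"
    proof (induction k rule: kz_induct)
      case (K u r)
      then show ?case using \<open>\<And>u m. proj (K_gen u m) \<in> C\<close>[of u r] by (simp add: K_gen_def)
    next
      case (add a b)
      then show ?case using Cs(3)[OF add] proj_add[of "(0, a, 0)" "(0, b, 0)"]
        by (simp add: HB_zero)
    qed
    ultimately show ?thesis
      using Cs(3)[of "proj (p, 0, 0)" "proj (0, k, 0)"] proj_add[of "(p, 0, 0)" "(0, k, 0)"]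
      by (simp add: z HB_zero)
  qed
  then show ?thesis unfolding tau_gA_Z_eq C_def by auto
qed

lemma core_eq: "core \<tau> H \<phi> = tau_gA_Z sc br f B"
  using core_subset core_superset by auto

end

end

theorem proposition3p1:
  fixes sc :: "complex \<Rightarrow> 'g::ab_group_add \<Rightarrow> 'g"
    and br :: "'g \<Rightarrow> 'g \<Rightarrow> 'g"
    and f :: "'g \<Rightarrow> 'g \<Rightarrow> complex"
    and h :: "'g set"
    and B :: "((complex, 'n::finite) vec, 'n) vec"
  assumes "simple_lie_algebra (type_lie sc br)"
    and "finite_dimensional (type_lie sc br) UNIV"
    and "cartan_subalgebra (type_lie sc br) h"
    and "invariant_symmetric_form (type_lie sc br) f"
    and "nondegenerate_on (type_lie sc br) UNIV f"
    and "transpose B = - B"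
    and "B \<noteq> 0"
  shows
    "(\<forall>r. r \<noteq> 0 \<and> r \<in> GB B \<longrightarrow> has_dim (tau sc br f B) (tau_Z_deg sc br f B r) 0)
     \<and> (\<forall>r. r \<notin> GB B \<longrightarrow> has_dim (tau sc br f B) (tau_Z_deg sc br f B r) 1)
     \<and> has_dim (tau sc br f B) (tau_Z_deg sc br f B 0) CARD('n)
     \<and> (\<forall>r. r \<noteq> 0 \<and> r \<in> GB B \<longrightarrow> has_dim (tau sc br f B) (tau_H_deg sc br f B r) 0)
     \<and> (\<forall>r. r \<notin> GB B \<longrightarrow> has_dim (tau sc br f B) (tau_H_deg sc br f B r) 1)
     \<and> has_dim (tau sc br f B) (tau_H_deg sc br f B 0) CARD('n)
     \<and> (\<exists>form. extended_affine_lie_algebra (tau sc br f B) (tau_cartan sc br f B h) form)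
     \<and> (\<forall>form. extended_affine_lie_algebra (tau sc br f B) (tau_cartan sc br f B h) form
          \<longrightarrow> core (tau sc br f B) (tau_cartan sc br f B h) form = tau_gA_Z sc br f B)"
proof -
  have lie: "lie_algebra (type_lie sc br)" using assms(1) unfolding simple_lie_algebra_def by simp
  have carrier: "carrier (type_lie sc br) = UNIV" by (simp add: type_lie_def)
  interpret simple_tau_data sc br f B h
    by (intro simple_tau_data.intro tau_data.intro toroidal_data.intro skew_matrix.intro
        tau_data_axioms.intro simple_split_lie_algebra.intro split_quadratic_lie_algebra.intro
        split_quadratic_lie_algebra_axioms.intro simple_split_lie_algebra_axioms.intro lie)
      (use assms in \<open>simp_all add: carrier cartan_subalgebra_def\<close>)
  \<comment> \<open>The core was computed for an arbitrary form satisfying EA1, so every EALA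
    structure with this H has the same core.\<close>
  have "core \<tau> H form = tau_gA_Z sc br f B" if "extended_affine_lie_algebra \<tau> H form" for form
    using extended_affine_lie_algebra.EA1[OF that] by (rule core_eq)
  moreover have "\<exists>form. extended_affine_lie_algebra \<tau> H form"
    by (rule exI[of _ tau_form], rule extended_affine_tau[OF tau_form])
  ultimately show ?thesis
    by (simp add: dim_Z_GB dim_Z_nonGB dim_Z_zero dim_H_GB dim_H_nonGB dim_H_zero del: One_nat_def)
qed

end
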